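(* Let $X:M\to\mathbb{R}^{n+1}$ be an $n$-dimensional compact $\lambda$-hypersurface in $\mathbb{R}^{n+1}$. If $H-\lambda\ge 0$ and $\lambda\bigl(f_3(H-\lambda)-S\bigr)\ge 0$ on $M$, then $X:M\to\mathbb{R}^{n+1}$ is isometric to a round sphere $S^n(r)$ with $\lambda=\frac{n}{r}-r$.
   Context: $X:M\to\mathbb{R}^{n+1}$ is a smooth immersion of a connected $n$-dimensional manifold with unit normal $N$. The second fundamental form is $h_{ij}=-\langle D_{e_i}N,e_j\rangle$ for a local orthonormal tangent frame $e_1,\dots,e_n$ ($D$ the Euclidean derivative); $H=\sum_i h_{ii}$, $S=\sum_{i,j}h_{ij}^2$, $f_3=\sum_{i,j,k}h_{ij}h_{jk}h_{ki}$. For a constant $\lambda\in\mathbb{R}$, $X$ is a $\lambda$-hypersurface if $\langle X,N\rangle+H=\lambda$ on $M$. $S^n(r)$ is the round sphere of radius $r>0$.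
   Formalization: The dimension is assumed to satisfy n ≥ 2; for n = 1 the claim is false for every λ, since a circle of radius r with λ = 1/r − r traversed twice satisfies all the hypotheses but is isometric only to S^1(2r). *)

theory Defs
  imports "HOL-Analysis.Analysis"
begin

(* C^k and C^infinity maps.  The set S is always open in what follows; in finite
   dimension, continuity of the iterated directional derivatives is the usual C^k. *)

primrec Ck_on :: "nat \<Rightarrow> 'a::euclidean_space set \<Rightarrow> ('a \<Rightarrow> 'b::euclidean_space) \<Rightarrow> bool" where
  "Ck_on 0 S f \<longleftrightarrow> continuous_on S f"
| "Ck_on (Suc k) S f \<longleftrightarrow>
     (\<forall>x\<in>S. f differentiable (at x)) \<and>
     (\<forall>v. Ck_on k S (\<lambda>x. frechet_derivative f (at x) v))"

definition smooth_on :: "'a::euclidean_space set \<Rightarrow> ('a \<Rightarrow> 'b::euclidean_space) \<Rightarrow> bool" where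
  "smooth_on S f \<longleftrightarrow> (\<forall>k. Ck_on k S f)"


(* Smooth manifolds without boundary, modelled on real^'n.  A chart is a pair (U, c) of a
   domain and a coordinate map; the values of c outside U are irrelevant. *)

type_synonym ('a, 'n) chart = "'a set \<times> ('a \<Rightarrow> real ^ 'n)"

definition is_chart :: "'a topology \<Rightarrow> ('a, 'n::finite) chart \<Rightarrow> bool" where
  "is_chart M C \<longleftrightarrow> (case C of (U, c) \<Rightarrow>
     openin M U \<and> open (c ` U) \<and>
     homeomorphic_map (subtopology M U) (subtopology euclidean (c ` U)) c)"

definition smooth_atlas :: "'a topology \<Rightarrow> ('a, 'n::finite) chart set \<Rightarrow> bool" where
  "smooth_atlas M A \<longleftrightarrow>
     (\<forall>C\<in>A. is_chart M C) \<and> (\<Union>C\<in>A. fst C) = topspace M \<and>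
     (\<forall>(U, c)\<in>A. \<forall>(V, d)\<in>A. smooth_on (c ` (U \<inter> V)) (d \<circ> inv_into U c))"

definition smooth_manifold :: "'a topology \<Rightarrow> ('a, 'n::finite) chart set \<Rightarrow> bool" where
  "smooth_manifold M A \<longleftrightarrow>
     topspace M \<noteq> {} \<and> Hausdorff_space M \<and> second_countable M \<and> smooth_atlas M A"


(* Maps from a manifold into a Euclidean space *)

definition smooth_map :: "('a, 'n::finite) chart set \<Rightarrow> ('a \<Rightarrow> real ^ 'm::finite) \<Rightarrow> bool" where
  "smooth_map A f \<longleftrightarrow> (\<forall>(U, c)\<in>A. smooth_on (c ` U) (f \<circ> inv_into U c))"

(* The differential of f at p.  A tangent vector at p is given by its coordinates v with
   respect to the chart C, so tangent_map C f p v is D_w f for w = sum_i v_i d/dx_i. *)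

definition tangent_map ::
  "('a, 'n::finite) chart \<Rightarrow> ('a \<Rightarrow> real ^ 'm::finite) \<Rightarrow> 'a \<Rightarrow> real ^ 'n \<Rightarrow> real ^ 'm" where
  "tangent_map C f p = (case C of (U, c) \<Rightarrow> frechet_derivative (f \<circ> inv_into U c) (at (c p)))"

definition smooth_immersion :: "('a, 'n::finite) chart set \<Rightarrow> ('a \<Rightarrow> real ^ 'm::finite) \<Rightarrow> bool" where
  "smooth_immersion A X \<longleftrightarrow>
     smooth_map A X \<and> (\<forall>C\<in>A. \<forall>p\<in>fst C. inj (tangent_map C X p))"

definition unit_normal_field ::
  "('a, 'n::finite) chart set \<Rightarrow> ('a \<Rightarrow> real ^ 'm::finite) \<Rightarrow> ('a \<Rightarrow> real ^ 'm) \<Rightarrow> bool" where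
  "unit_normal_field A X N \<longleftrightarrow>
     smooth_map A N \<and>
     (\<forall>C\<in>A. \<forall>p\<in>fst C. norm (N p) = 1 \<and> (\<forall>v. N p \<bullet> tangent_map C X p v = 0))"


(* Orthonormality is with respect to the metric induced by X. *)

definition orthonormal_frame_at ::
  "('a, 'n::finite) chart \<Rightarrow> ('a \<Rightarrow> real ^ 'm::finite) \<Rightarrow> 'a \<Rightarrow> ('n \<Rightarrow> real ^ 'n) \<Rightarrow> bool" where
  "orthonormal_frame_at C X p e \<longleftrightarrow>
     (\<forall>i j. tangent_map C X p (e i) \<bullet> tangent_map C X p (e j) = (if i = j then 1 else 0))"

(* One chart and one orthonormal frame are chosen at each point.  The components h_ij depend
   on this choice, but their orthogonal invariants H, S, f_3 below do not; only the values of
   the frame at the point itself enter. *)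

definition chosen_frame ::
  "('a, 'n::finite) chart set \<Rightarrow> ('a \<Rightarrow> real ^ 'm::finite) \<Rightarrow> 'a \<Rightarrow> ('a, 'n) chart \<times> ('n \<Rightarrow> real ^ 'n)" where
  "chosen_frame A X p =
     (SOME (C, e). C \<in> A \<and> p \<in> fst C \<and> orthonormal_frame_at C X p e)"

definition second_fundamental_form ::
  "('a, 'n::finite) chart set \<Rightarrow> ('a \<Rightarrow> real ^ 'm::finite) \<Rightarrow> ('a \<Rightarrow> real ^ 'm) \<Rightarrow> 'a \<Rightarrow> 'n \<Rightarrow> 'n \<Rightarrow> real" where
  "second_fundamental_form A X N p i j =
     (case chosen_frame A X p of (C, e) \<Rightarrow>
        - (tangent_map C N p (e i) \<bullet> tangent_map C X p (e j)))"

definition mean_curvature ::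
  "('a, 'n::finite) chart set \<Rightarrow> ('a \<Rightarrow> real ^ 'm::finite) \<Rightarrow> ('a \<Rightarrow> real ^ 'm) \<Rightarrow> 'a \<Rightarrow> real" where
  "mean_curvature A X N p = (\<Sum>i\<in>UNIV. second_fundamental_form A X N p i i)"

definition sq_norm_sff ::
  "('a, 'n::finite) chart set \<Rightarrow> ('a \<Rightarrow> real ^ 'm::finite) \<Rightarrow> ('a \<Rightarrow> real ^ 'm) \<Rightarrow> 'a \<Rightarrow> real" where
  "sq_norm_sff A X N p = (\<Sum>i\<in>UNIV. \<Sum>j\<in>UNIV. (second_fundamental_form A X N p i j)\<^sup>2)"

definition f3 ::
  "('a, 'n::finite) chart set \<Rightarrow> ('a \<Rightarrow> real ^ 'm::finite) \<Rightarrow> ('a \<Rightarrow> real ^ 'm) \<Rightarrow> 'a \<Rightarrow> real" where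
  "f3 A X N p = (\<Sum>i\<in>UNIV. \<Sum>j\<in>UNIV. \<Sum>k\<in>UNIV.
     second_fundamental_form A X N p i j * second_fundamental_form A X N p j k *
     second_fundamental_form A X N p k i)"

definition lambda_hypersurface ::
  "'a topology \<Rightarrow> ('a, 'n::finite) chart set \<Rightarrow> ('a \<Rightarrow> real ^ 'm::finite) \<Rightarrow> ('a \<Rightarrow> real ^ 'm) \<Rightarrow> real \<Rightarrow> bool" where
  "lambda_hypersurface M A X N lam \<longleftrightarrow>
     CARD('m) = CARD('n) + 1 \<and> smooth_manifold M A \<and> connected_space M \<and>
     smooth_immersion A X \<and> unit_normal_field A X N \<and>
     (\<forall>p\<in>topspace M. X p \<bullet> N p + mean_curvature A X N p = lam)"


(* Diffeomorphism of M onto a subset S of Euclidean space: the inverse is smooth in the sense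
   that, near each point, it is in coordinates the restriction to S of a smooth map F defined
   on an open set W of the ambient space. *)

definition diffeomorphism_onto ::
  "'a topology \<Rightarrow> ('a, 'n::finite) chart set \<Rightarrow> ('a \<Rightarrow> real ^ 'm::finite) \<Rightarrow> (real ^ 'm) set \<Rightarrow> bool" where
  "diffeomorphism_onto M A \<phi> S \<longleftrightarrow>
     bij_betw \<phi> (topspace M) S \<and> smooth_map A \<phi> \<and>
     (\<forall>(U, c)\<in>A. \<forall>p\<in>U. \<exists>W F. open W \<and> \<phi> p \<in> W \<and> smooth_on W F \<and>
        (\<forall>q\<in>topspace M. \<phi> q \<in> W \<longrightarrow> q \<in> U \<and> F (\<phi> q) = c q))"

(* Riemannian isometry from M with the metric induced by X onto a subset S of Euclidean space
   with the metric induced by the inclusion. *)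

definition riemannian_isometry_onto ::
  "'a topology \<Rightarrow> ('a, 'n::finite) chart set \<Rightarrow> ('a \<Rightarrow> real ^ 'm::finite) \<Rightarrow>
   ('a \<Rightarrow> real ^ 'm) \<Rightarrow> (real ^ 'm) set \<Rightarrow> bool" where
  "riemannian_isometry_onto M A X \<phi> S \<longleftrightarrow>
     diffeomorphism_onto M A \<phi> S \<and>
     (\<forall>C\<in>A. \<forall>p\<in>fst C. \<forall>v w.
        tangent_map C \<phi> p v \<bullet> tangent_map C \<phi> p w = tangent_map C X p v \<bullet> tangent_map C X p w)"

definition isometric_to_round_sphere ::
  "'a topology \<Rightarrow> ('a, 'n::finite) chart set \<Rightarrow> ('a \<Rightarrow> real ^ 'm::finite) \<Rightarrow> real \<Rightarrow> bool" where
  "isometric_to_round_sphere M A X r \<longleftrightarrow>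
     r > 0 \<and> (\<exists>\<phi>. riemannian_isometry_onto M A X \<phi> (sphere 0 r))"

end

theory Submission
  imports Defs
begin

text \<open>Write \<open>u = - X \<cdot> N = H - lam\<close>, \<open>S\<close> for the squared norm of the second fundamental form (the
function \<open>sq\<close> below), and
\<open>L = Lap - X \<cdot> grad\<close>.  Constancy of \<open>X \<cdot> N + H\<close> gives \<open>L N = - S N\<close> and \<open>L X = lam N - X\<close>, and hence
\<open>L u = (1 - S) u + lam\<close> together with the Simons identity
\<open>L S / 2 = |T|^2 + (1 - S) S + lam f3\<close>, where \<open>T\<close> is the covariant derivative of the second
fundamental form.

At the point of \<open>M\<close> farthest from the origin \<open>u H \<ge> n\<close>, and from this, the equation for \<open>u\<close> and,
if \<open>lam > 0\<close>, the curvature hypothesis, the hypothesis \<open>u \<ge> 0\<close> improves to \<open>u > 0\<close>.  Let \<open>K\<close> be the maximum of \<open>S / u^2\<close>.  The function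
\<open>w = K u^2 - S \<ge> 0\<close> vanishes somewhere and satisfies
\<open>L w - (2/u) grad u \<cdot> grad w + (2/u^2) |u T - grad u \<otimes> A|^2 \<le> C w\<close>; the hypothesis on
\<open>lam (f3 (H - lam) - S)\<close> is exactly what bounds the zeroth-order terms (\<open>pinching_inequality\<close>).  By the strong
minimum principle \<open>w\<close> vanishes identically, so \<open>u T = grad u \<otimes> A\<close> (\<open>rigidity\<close>).  Tracing this gives
\<open>lam grad u = 0\<close>.  If \<open>lam = 0\<close> and \<open>grad u\<close> is not zero somewhere, the Codazzi symmetry of \<open>T\<close> makes \<open>A\<close>
of rank one there, so \<open>S = H^2\<close> there and, since \<open>S / u^2\<close> is constant, everywhere; at the farthest point,
where \<open>A\<close> is positive definite, \<open>S < H^2\<close> because \<open>n \<ge> 2\<close>.  Hence \<open>u\<close> is a constant \<open>r\<close>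
(\<open>gradient_zero\<close>).  Then \<open>Lap (|X|^2 / 2) = n - u H\<close> is constant, and zero by comparing its signs at a
maximum and a minimum of \<open>|X|\<close>, so \<open>|X|\<close> is constant.  Therefore \<open>X = - r N\<close> and \<open>r (r + lam) = n\<close>.

Two devices replace the usual machinery.  Instead of covariant derivatives, the coordinates \<open>X_a\<close>, \<open>N_a\<close> and the
shape operator, extended by zero in the normal direction to a matrix \<open>A_ab\<close>, are differentiated by the
tangential derivatives \<open>\<delta>_a\<close> along the projections of the standard basis vectors; these satisfy a closed system of
identities with a simple commutator.  And instead of integrating over \<open>M\<close>, everything rests on the Hopf
strong minimum principle, which is local and so can be applied chart by chart.

Finally \<open>X\<close> is a local diffeomorphism from \<open>M\<close> to a sphere of dimension \<open>n \<ge> 2\<close>.  As \<open>M\<close> is compact it is a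
covering map, and the sphere is simply connected, so \<open>X\<close> is injective; its local inverses are smooth
(\<open>sphere_chart_inverse\<close>), and \<open>X\<close> itself is the isometry.\<close>

section \<open>Smooth maps between Euclidean spaces\<close>

text \<open>Nearly all sums below run over a finite index type; they take over the notation of infinite series.\<close>

no_notation suminf (binder "\<Sum>" 10)

abbreviation total :: "('i::finite \<Rightarrow> 'b::comm_monoid_add) \<Rightarrow> 'b" (binder "\<Sum>" 10) where
  "total f \<equiv> sum f UNIV"

lemma has_derivative_cong_open:
  assumes "open S" "x \<in> S" "\<And>y. y \<in> S \<Longrightarrow> f y = g y"
  shows "(f has_derivative D) (at x) \<longleftrightarrow> (g has_derivative D) (at x)"
  using has_derivative_transform_within_open[of f D x UNIV S g]
      has_derivative_transform_within_open[of g D x UNIV S f] assms by auto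

lemma frechet_derivative_cong_open:
  assumes "open S" "x \<in> S" "\<And>y. y \<in> S \<Longrightarrow> f y = g y"
  shows "frechet_derivative f (at x) = frechet_derivative g (at x)"
  using has_derivative_cong_open[OF assms] by (simp add: frechet_derivative_def)

lemma differentiable_cong_open:
  assumes "open S" "x \<in> S" "\<And>y. y \<in> S \<Longrightarrow> f y = g y"
  shows "f differentiable (at x) \<longleftrightarrow> g differentiable (at x)"
  using has_derivative_cong_open[OF assms] by (simp add: differentiable_def)

lemma Ck_on_cong:
  assumes "open S" "\<And>x. x \<in> S \<Longrightarrow> f x = g x"
  shows "Ck_on k S f \<longleftrightarrow> Ck_on k S g"
  using assms(2)
proof (induction k arbitrary: f g)
  case 0
  show ?case using continuous_on_cong[OF refl 0] by simp
next
  case (Suc k)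
  have "Ck_on k S (\<lambda>x. frechet_derivative f (at x) v) \<longleftrightarrow> Ck_on k S (\<lambda>x. frechet_derivative g (at x) v)" for v
    by (rule Suc.IH) (use frechet_derivative_cong_open[OF assms(1), of _ f g] Suc.prems in auto)
  moreover have "(\<forall>x\<in>S. f differentiable (at x)) \<longleftrightarrow> (\<forall>x\<in>S. g differentiable (at x))"
    using differentiable_cong_open[OF assms(1), of _ f g] Suc.prems by auto
  ultimately show ?case by (simp only: Ck_on.simps)
qed

lemma Ck_on_subset: "Ck_on k S f \<Longrightarrow> T \<subseteq> S \<Longrightarrow> Ck_on k T f"
  by (induction k arbitrary: f) (auto intro: continuous_on_subset)

lemma smooth_on_cong:
  assumes "open S" "\<And>x. x \<in> S \<Longrightarrow> f x = g x"
  shows "smooth_on S f \<longleftrightarrow> smooth_on S g"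
  using Ck_on_cong[OF assms] by (simp add: smooth_on_def)

lemma Ck_on_Suc_imp: "Ck_on (Suc k) S f \<Longrightarrow> Ck_on k S f"
proof (induction k arbitrary: f)
  case 0
  then show ?case
    by (auto intro!: continuous_at_imp_continuous_on differentiable_imp_continuous_within)
qed auto

lemma smooth_on_imp_continuous_on: "smooth_on S f \<Longrightarrow> continuous_on S f"
  unfolding smooth_on_def by (metis Ck_on.simps(1))

lemma smooth_on_differentiable: "smooth_on S f \<Longrightarrow> x \<in> S \<Longrightarrow> f differentiable (at x)"
  unfolding smooth_on_def by (metis Ck_on.simps(2))

lemma smooth_on_has_derivative:
  "smooth_on S f \<Longrightarrow> x \<in> S \<Longrightarrow> (f has_derivative frechet_derivative f (at x)) (at x)"
  using smooth_on_differentiable frechet_derivative_works by blast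

lemma smooth_on_frechet_derivative:
  "smooth_on S f \<Longrightarrow> smooth_on S (\<lambda>x. frechet_derivative f (at x) v)"
  unfolding smooth_on_def by (metis Ck_on.simps(2))

lemma smooth_on_subset: "smooth_on S f \<Longrightarrow> T \<subseteq> S \<Longrightarrow> smooth_on T f"
  by (auto simp: smooth_on_def intro: Ck_on_subset)

lemma Ck_on_const: "Ck_on k S (\<lambda>x. c)"
  by (induction k arbitrary: c) (auto simp: frechet_derivative_const)

text \<open>Exhibiting a derivative avoids computing with the choice operator behind \<open>frechet_derivative\<close>; the closure properties below are all inductions through this rule.\<close>

lemma Ck_on_SucI:
  assumes "open S" "\<And>x. x \<in> S \<Longrightarrow> (f has_derivative D x) (at x)" "\<And>v. Ck_on k S (\<lambda>x. D x v)"
  shows "Ck_on (Suc k) S f"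
proof -
  have D: "frechet_derivative f (at x) = D x" if "x \<in> S" for x
    using frechet_derivative_at assms(2) that by metis
  have "Ck_on k S (\<lambda>x. frechet_derivative f (at x) v)" for v
    using Ck_on_cong[OF assms(1), of "\<lambda>x. frechet_derivative f (at x) v" "\<lambda>x. D x v"] D assms(3) by simp
  then show ?thesis using assms(2) by (auto simp: differentiable_def)
qed

lemma Ck_on_SucD:
  assumes "Ck_on (Suc k) S f"
  shows "x \<in> S \<Longrightarrow> (f has_derivative frechet_derivative f (at x)) (at x)"
    and "Ck_on k S (\<lambda>x. frechet_derivative f (at x) v)" and "Ck_on k S f"
  using assms Ck_on_Suc_imp[OF assms] frechet_derivative_works by auto

text \<open>Left to itself the simplifier would take \<open>Ck_on (Suc k)\<close> apart, after which the closure rules no longer apply.\<close>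

declare Ck_on.simps(2) [simp del]

lemma Ck_on_add:
  assumes "open S" shows "Ck_on k S f \<Longrightarrow> Ck_on k S g \<Longrightarrow> Ck_on k S (\<lambda>x. f x + g x)"
proof (induction k arbitrary: f g)
  case 0 then show ?case by (auto intro: continuous_intros)
next
  case (Suc k)
  note f = Ck_on_SucD[OF Suc.prems(1)] and g = Ck_on_SucD[OF Suc.prems(2)]
  show ?case
    by (rule Ck_on_SucI[OF assms has_derivative_add[OF f(1) g(1)]]) (assumption | rule Suc.IH f g)+
qed

lemma Ck_on_sum:
  assumes "open S" "\<And>i. i \<in> I \<Longrightarrow> Ck_on k S (f i)"
  shows "Ck_on k S (\<lambda>x. \<Sum>i\<in>I. f i x)"
  using assms(2)
  by (induction I rule: infinite_finite_induct) (auto intro: Ck_on_const Ck_on_add[OF assms(1)])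

lemma Ck_on_linear:
  assumes "open S" "bounded_linear L"
  shows "Ck_on k S f \<Longrightarrow> Ck_on k S (\<lambda>x. L (f x))"
proof (induction k arbitrary: f)
  case 0 then show ?case
    using assms(2) by (auto intro: bounded_linear.continuous_on)
next
  case (Suc k)
  note f = Ck_on_SucD[OF Suc.prems]
  show ?case
    by (rule Ck_on_SucI[OF assms(1) bounded_linear.has_derivative[OF assms(2) f(1)]])
      (assumption | rule Suc.IH f)+
qed

lemma Ck_on_bilinear:
  assumes "open S" "bounded_bilinear B"
  shows "Ck_on k S f \<Longrightarrow> Ck_on k S g \<Longrightarrow> Ck_on k S (\<lambda>x. B (f x) (g x))"
proof (induction k arbitrary: f g)
  case 0 then show ?case
    using assms(2) by (auto intro: bounded_bilinear.continuous_on)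
next
  case (Suc k)
  note f = Ck_on_SucD[OF Suc.prems(1)] and g = Ck_on_SucD[OF Suc.prems(2)]
  show ?case
    by (rule Ck_on_SucI[OF assms(1) bounded_bilinear.FDERIV[OF assms(2) f(1) g(1)]])
      (assumption | rule Suc.IH f g Ck_on_add[OF assms(1)])+
qed

lemmas Ck_on_mult = Ck_on_bilinear[OF _ bounded_bilinear_mult]
lemmas Ck_on_scaleR = Ck_on_bilinear[OF _ bounded_bilinear_scaleR]
lemmas Ck_on_inner = Ck_on_bilinear[OF _ bounded_bilinear_inner]

text \<open>The derivative of \<open>1/f\<close> is a polynomial in \<open>1/f\<close> and \<open>Df\<close>, so each order of differentiability follows from the previous one.\<close>

lemma Ck_on_inverse:
  fixes f :: "'a::euclidean_space \<Rightarrow> real"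
  assumes "open S" "\<And>x. x \<in> S \<Longrightarrow> f x \<noteq> 0"
  shows "Ck_on k S f \<Longrightarrow> Ck_on k S (\<lambda>x. inverse (f x))"
proof (induction k)
  case 0 then show ?case using assms(2) by (auto intro: continuous_intros)
next
  case (Suc k)
  have IH: "Ck_on k S (\<lambda>x. inverse (f x))" using Suc Ck_on_SucD by blast
  note f = Ck_on_SucD[OF Suc.prems]
  have 1: "((\<lambda>x. inverse (f x)) has_derivative
        (\<lambda>v. - (inverse (f x) * frechet_derivative f (at x) v * inverse (f x)))) (at x)" if "x \<in> S" for x
    using f(1) assms(2) that by (auto intro!: derivative_eq_intros)
  have 2: "Ck_on k S (\<lambda>x. - (inverse (f x) * frechet_derivative f (at x) v * inverse (f x)))" for v
    by (rule Ck_on_linear[OF assms(1) bounded_linear_minus[OF bounded_linear_ident]])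
      (rule Ck_on_mult[OF assms(1)] IH f)+
  show ?case by (rule Ck_on_SucI[OF assms(1) 1 2])
qed

lemma Ck_on_exp:
  fixes f :: "'a::euclidean_space \<Rightarrow> real"
  assumes "open S"
  shows "Ck_on k S f \<Longrightarrow> Ck_on k S (\<lambda>x. exp (f x))"
proof (induction k)
  case 0 then show ?case by (auto intro: continuous_intros)
next
  case (Suc k)
  have IH: "Ck_on k S (\<lambda>x. exp (f x))" using Suc Ck_on_SucD by blast
  note f = Ck_on_SucD[OF Suc.prems]
  have 1: "((\<lambda>x. exp (f x)) has_derivative (\<lambda>v. exp (f x) * frechet_derivative f (at x) v)) (at x)" if "x \<in> S" for x
    using f(1) that by (auto intro!: derivative_eq_intros)
  have 2: "Ck_on k S (\<lambda>x. exp (f x) * frechet_derivative f (at x) v)" for v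
    by (rule Ck_on_mult[OF assms(1)] IH f)+
  show ?case by (rule Ck_on_SucI[OF assms(1) 1 2])
qed

lemma linear_euclidean_expansion:
  fixes L :: "'a::euclidean_space \<Rightarrow> 'b::real_vector"
  assumes "linear L" shows "L v = (\<Sum>b\<in>Basis. (v \<bullet> b) *\<^sub>R L b)"
proof -
  have "L v = L (\<Sum>b\<in>Basis. (v \<bullet> b) *\<^sub>R b)" by (simp add: euclidean_representation)
  also have "\<dots> = (\<Sum>b\<in>Basis. (v \<bullet> b) *\<^sub>R L b)"
    using assms by (simp add: linear_sum linear_cmul)
  finally show ?thesis .
qed

text \<open>The chain rule differentiates \<open>g\<close> in a direction that varies with the point.  Expanding that direction in a basis leaves only derivatives of \<open>g\<close> in fixed directions, to which the induction hypothesis applies.\<close>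

lemma Ck_on_compose:
  fixes f :: "'a::euclidean_space \<Rightarrow> 'b::euclidean_space" and g :: "'b \<Rightarrow> 'c::euclidean_space"
  assumes "open S" "open T" "f ` S \<subseteq> T"
  shows "Ck_on k S f \<Longrightarrow> Ck_on k T g \<Longrightarrow> Ck_on k S (\<lambda>x. g (f x))"
proof (induction k arbitrary: g)
  case 0 then show ?case
    using assms(3) by (auto intro: continuous_on_compose2)
next
  case (Suc k)
  note f = Ck_on_SucD[OF Suc.prems(1)] and g = Ck_on_SucD[OF Suc.prems(2)]
  let ?D = "\<lambda>x v. frechet_derivative g (at (f x)) (frechet_derivative f (at x) v)"
  show ?case
  proof (rule Ck_on_SucI[OF assms(1)])
    fix x assume x: "x \<in> S"
    show "((\<lambda>x. g (f x)) has_derivative ?D x) (at x)"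
      using has_derivative_compose[OF f(1)[OF x] g(1)] assms(3) x by auto
  next
    fix v
    have "Ck_on k S (\<lambda>x. \<Sum>b\<in>Basis. (frechet_derivative f (at x) v \<bullet> b) *\<^sub>R frechet_derivative g (at (f x)) b)"
      by (intro Ck_on_sum Ck_on_scaleR Ck_on_inner Suc.IH assms(1) Ck_on_const f g)
    moreover have "?D x v = (\<Sum>b\<in>Basis. (frechet_derivative f (at x) v \<bullet> b) *\<^sub>R frechet_derivative g (at (f x)) b)"
      if "x \<in> S" for x
      by (rule linear_euclidean_expansion)
        (use g(1) assms(3) that has_derivative_linear in blast)
    ultimately show "Ck_on k S (\<lambda>x. ?D x v)"
      using Ck_on_cong[OF assms(1)] by (metis (no_types, lifting))
  qed
qed

lemma smooth_on_const [simp]: "smooth_on S (\<lambda>x. c)"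
  by (simp add: smooth_on_def Ck_on_const)

lemma smooth_on_add: "open S \<Longrightarrow> smooth_on S f \<Longrightarrow> smooth_on S g \<Longrightarrow> smooth_on S (\<lambda>x. f x + g x)"
  by (simp add: smooth_on_def Ck_on_add)

lemma smooth_on_linear: "open S \<Longrightarrow> bounded_linear L \<Longrightarrow> smooth_on S f \<Longrightarrow> smooth_on S (\<lambda>x. L (f x))"
  by (simp add: smooth_on_def Ck_on_linear)

lemma smooth_on_uminus: "open S \<Longrightarrow> smooth_on S f \<Longrightarrow> smooth_on S (\<lambda>x. - f x)"
  by (rule smooth_on_linear[OF _ bounded_linear_minus[OF bounded_linear_ident]])

lemma smooth_on_diff: "open S \<Longrightarrow> smooth_on S f \<Longrightarrow> smooth_on S g \<Longrightarrow> smooth_on S (\<lambda>x. f x - g x)"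
  using smooth_on_add[OF _ _ smooth_on_uminus] by fastforce

lemma smooth_on_sum: "open S \<Longrightarrow> (\<And>i. i \<in> I \<Longrightarrow> smooth_on S (f i)) \<Longrightarrow> smooth_on S (\<lambda>x. \<Sum>i\<in>I. f i x)"
  by (simp add: smooth_on_def Ck_on_sum)

lemma smooth_on_mult:
  fixes f g :: "_ \<Rightarrow> real"
  shows "open S \<Longrightarrow> smooth_on S f \<Longrightarrow> smooth_on S g \<Longrightarrow> smooth_on S (\<lambda>x. f x * g x)"
  by (simp add: smooth_on_def Ck_on_mult)

lemma smooth_on_power:
  fixes f :: "_ \<Rightarrow> real"
  shows "open S \<Longrightarrow> smooth_on S f \<Longrightarrow> smooth_on S (\<lambda>x. f x ^ k)"
  by (induction k) (auto intro: smooth_on_mult)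

lemma smooth_on_prod:
  fixes f :: "_ \<Rightarrow> _ \<Rightarrow> real"
  shows "open S \<Longrightarrow> (\<And>i. i \<in> I \<Longrightarrow> smooth_on S (f i)) \<Longrightarrow> smooth_on S (\<lambda>x. \<Prod>i\<in>I. f i x)"
  by (induction I rule: infinite_finite_induct) (auto intro: smooth_on_mult)

lemma smooth_on_scaleR: "open S \<Longrightarrow> smooth_on S f \<Longrightarrow> smooth_on S g \<Longrightarrow> smooth_on S (\<lambda>x. f x *\<^sub>R g x)"
  by (simp add: smooth_on_def Ck_on_scaleR)

lemma smooth_on_inner: "open S \<Longrightarrow> smooth_on S f \<Longrightarrow> smooth_on S g \<Longrightarrow> smooth_on S (\<lambda>x. f x \<bullet> g x)"
  by (simp add: smooth_on_def Ck_on_inner)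

lemma smooth_on_divide:
  fixes f g :: "_ \<Rightarrow> real"
  shows "open S \<Longrightarrow> smooth_on S f \<Longrightarrow> smooth_on S g \<Longrightarrow> (\<And>x. x \<in> S \<Longrightarrow> g x \<noteq> 0) \<Longrightarrow> smooth_on S (\<lambda>x. f x / g x)"
  by (simp add: smooth_on_def Ck_on_mult Ck_on_inverse divide_inverse)

lemma smooth_on_exp:
  fixes f :: "_ \<Rightarrow> real"
  shows "open S \<Longrightarrow> smooth_on S f \<Longrightarrow> smooth_on S (\<lambda>x. exp (f x))"
  by (simp add: smooth_on_def Ck_on_exp)

lemma smooth_on_id:
  fixes S :: "'a::euclidean_space set"
  assumes "open S" shows "smooth_on S (\<lambda>x. x)"
proof -
  have "Ck_on k S (\<lambda>x. x)" for k
  proof (cases k)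
    case (Suc n)
    show ?thesis unfolding Suc by (rule Ck_on_SucI[OF assms has_derivative_ident]) (rule Ck_on_const)
  qed auto
  then show ?thesis by (simp add: smooth_on_def)
qed

lemma smooth_on_vec_nth: "open S \<Longrightarrow> smooth_on S f \<Longrightarrow> smooth_on S (\<lambda>x. f x $ i)"
  using smooth_on_linear[OF _ bounded_linear_vec_nth] by blast

lemma smooth_on_vec_lambda:
  fixes f :: "'i::finite \<Rightarrow> 'a::euclidean_space \<Rightarrow> real"
  assumes "open S" "\<And>i. smooth_on S (f i)"
  shows "smooth_on S (\<lambda>x. \<chi> i. f i x)"
proof -
  have "smooth_on S (\<lambda>x. \<Sum>i. f i x *\<^sub>R axis i (1::real))"
    by (intro smooth_on_sum smooth_on_scaleR assms smooth_on_const)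
  moreover have "(\<chi> i. f i x) = (\<Sum>i. f i x *\<^sub>R axis i (1::real))" for x
    by (simp add: vec_eq_iff axis_def if_distrib[of "\<lambda>t. _ * t"] cong: if_cong)
  ultimately show ?thesis by simp
qed

lemma smooth_on_det:
  fixes F :: "'a::euclidean_space \<Rightarrow> real^'n^'n"
  assumes "open S" "\<And>i j. smooth_on S (\<lambda>x. F x $ i $ j)"
  shows "smooth_on S (\<lambda>x. det (F x))"
  unfolding det_def by (intro smooth_on_sum smooth_on_mult smooth_on_prod assms smooth_on_const)

text \<open>The second difference over the parallelogram spanned by \<open>s v\<close> and \<open>t w\<close> is the increment along \<open>v\<close> of the function \<open>y \<mapsto> f (y + t w) - f y\<close>.  Two applications of the mean value theorem, along \<open>v\<close> and then along \<open>w\<close>, turn it into a mixed derivative.\<close>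

lemma mixed_difference_mean_value:
  fixes f :: "'a::euclidean_space \<Rightarrow> real"
  assumes f: "Ck_on 2 S f" and "0 < s" "0 < t"
    and S: "\<And>a b. \<lbrakk>0 \<le> a; a \<le> s; 0 \<le> b; b \<le> t\<rbrakk> \<Longrightarrow> x + a *\<^sub>R v + b *\<^sub>R w \<in> S"
  obtains a b where "0 < a" "a < s" "0 < b" "b < t"
    "f (x + s *\<^sub>R v + t *\<^sub>R w) - f (x + s *\<^sub>R v) - f (x + t *\<^sub>R w) + f x
      = s * t * frechet_derivative (\<lambda>y. frechet_derivative f (at y) v) (at (x + a *\<^sub>R v + b *\<^sub>R w)) w"
proof -
  have f: "Ck_on (Suc (Suc 0)) S f" using assms(1) by (simp add: numeral_2_eq_2 del: Ck_on.simps)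
  note f1 = Ck_on_SucD[OF f] 
  note f2 = Ck_on_SucD[OF f1(2)]
  define \<phi> where "\<phi> a = f (x + a *\<^sub>R v + t *\<^sub>R w) - f (x + a *\<^sub>R v)" for a
  have d\<phi>: "(\<phi> has_real_derivative frechet_derivative f (at (x + a *\<^sub>R v + t *\<^sub>R w)) v
      - frechet_derivative f (at (x + a *\<^sub>R v)) v) (at a)" if "0 \<le> a" "a \<le> s" for a
  proof -
    have 1: "((\<lambda>a. f (x + a *\<^sub>R v + t *\<^sub>R w)) has_derivative
      (\<lambda>h. frechet_derivative f (at (x + a *\<^sub>R v + t *\<^sub>R w)) (h *\<^sub>R v))) (at a)"
      by (rule has_derivative_compose[of "\<lambda>a. x + a *\<^sub>R v + t *\<^sub>R w" "\<lambda>h. h *\<^sub>R v" _ _ f])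
         (use f1(1) S that assms in \<open>auto intro!: derivative_eq_intros\<close>)
    have 2: "((\<lambda>a. f (x + a *\<^sub>R v)) has_derivative
      (\<lambda>h. frechet_derivative f (at (x + a *\<^sub>R v)) (h *\<^sub>R v))) (at a)"
      by (rule has_derivative_compose[of "\<lambda>a. x + a *\<^sub>R v" "\<lambda>h. h *\<^sub>R v" _ _ f])
         (use f1(1) S[of a 0] that assms in \<open>auto intro!: derivative_eq_intros\<close>)
    have l: "linear (frechet_derivative f (at y))" if "y \<in> S" for y
      using f1(1)[OF that] has_derivative_linear by blast
    have l1: "frechet_derivative f (at (x + a *\<^sub>R v + t *\<^sub>R w)) (h *\<^sub>R v) = h * frechet_derivative f (at (x + a *\<^sub>R v + t *\<^sub>R w)) v" for h
      using linear_cmul[OF l[OF S], of a t h v] that assms by simp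
    have l2: "frechet_derivative f (at (x + a *\<^sub>R v)) (h *\<^sub>R v) = h * frechet_derivative f (at (x + a *\<^sub>R v)) v" for h
      using linear_cmul[OF l[of "x + a *\<^sub>R v"], of h v] S[of a 0] that assms by simp
    show ?thesis unfolding has_field_derivative_def \<phi>_def
      by (rule has_derivative_eq_rhs[OF has_derivative_diff[OF 1 2]])
        (rule ext, simp only: l1 l2, simp add: left_diff_distrib right_diff_distrib mult.commute)
  qed
  obtain a where a: "0 < a" "a < s" and ea: "\<phi> s - \<phi> 0 = (s - 0) * (frechet_derivative f (at (x + a *\<^sub>R v + t *\<^sub>R w)) v
      - frechet_derivative f (at (x + a *\<^sub>R v)) v)"
    using MVT2[OF \<open>0 < s\<close> d\<phi>] by auto
  define \<psi> where "\<psi> b = frechet_derivative f (at (x + a *\<^sub>R v + b *\<^sub>R w)) v" for b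
  have d\<psi>: "(\<psi> has_real_derivative frechet_derivative (\<lambda>y. frechet_derivative f (at y) v) (at (x + a *\<^sub>R v + b *\<^sub>R w)) w) (at b)"
    if "0 \<le> b" "b \<le> t" for b
  proof -
    let ?g = "\<lambda>y. frechet_derivative f (at y) v"
    have 1: "((\<lambda>b. ?g (x + a *\<^sub>R v + b *\<^sub>R w)) has_derivative
      (\<lambda>h. frechet_derivative ?g (at (x + a *\<^sub>R v + b *\<^sub>R w)) (h *\<^sub>R w))) (at b)"
      by (rule has_derivative_compose[of "\<lambda>b. x + a *\<^sub>R v + b *\<^sub>R w" "\<lambda>h. h *\<^sub>R w" _ _ ?g])
         (use f2(1) S that a in \<open>auto intro!: derivative_eq_intros\<close>)
    have "linear (frechet_derivative ?g (at (x + a *\<^sub>R v + b *\<^sub>R w)))"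
      using f2(1) S that a has_derivative_linear by (metis less_eq_real_def)
    then have "frechet_derivative ?g (at (x + a *\<^sub>R v + b *\<^sub>R w)) (h *\<^sub>R w) = frechet_derivative ?g (at (x + a *\<^sub>R v + b *\<^sub>R w)) w * h" for h
      by (simp add: linear_cmul)
    then show ?thesis unfolding has_field_derivative_def \<psi>_def using 1 by (simp only:)
  qed
  obtain b where b: "0 < b" "b < t" and eb: "\<psi> t - \<psi> 0 = (t - 0) * frechet_derivative (\<lambda>y. frechet_derivative f (at y) v) (at (x + a *\<^sub>R v + b *\<^sub>R w)) w"
    using MVT2[OF \<open>0 < t\<close> d\<psi>] by blast
  show ?thesis
    by (rule that[OF a b]) (use ea eb in \<open>simp add: \<phi>_def \<psi>_def algebra_simps\<close>)
qed

text \<open>The second difference over a small parallelogram does not change when \<open>v\<close> and \<open>w\<close> are exchanged, while by the mean value theorem and continuity it approximates either mixed derivative at \<open>x\<close>.\<close>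

lemma symmetric_second_derivative_real:
  fixes f :: "'a::euclidean_space \<Rightarrow> real"
  assumes "open S" "Ck_on 2 S f" "x \<in> S"
  shows "frechet_derivative (\<lambda>y. frechet_derivative f (at y) v) (at x) w
       = frechet_derivative (\<lambda>y. frechet_derivative f (at y) w) (at x) v"
proof -
  define P where "P y = frechet_derivative (\<lambda>y. frechet_derivative f (at y) v) (at y) w" for y
  define Q where "Q y = frechet_derivative (\<lambda>y. frechet_derivative f (at y) w) (at y) v" for y
  have f: "Ck_on (Suc (Suc 0)) S f" using assms(2) by (simp add: numeral_2_eq_2 del: Ck_on.simps)
  have c: "continuous_on S P" "continuous_on S Q"
    using f by (auto simp: P_def Q_def Ck_on.simps(2))
  have "\<bar>P x - Q x\<bar> \<le> e" if "e > 0" for e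
  proof -
    have "(P \<longlongrightarrow> P x) (at x)" "(Q \<longlongrightarrow> Q x) (at x)"
      using c assms by (auto simp: continuous_on_eq_continuous_at isCont_def)
    then have "\<forall>\<^sub>F y in at x. dist (P y) (P x) < e/2" "\<forall>\<^sub>F y in at x. dist (Q y) (Q x) < e/2"
      using that tendstoD[of P "P x" "at x" "e/2"] tendstoD[of Q "Q x" "at x" "e/2"] by simp_all
    moreover have "\<forall>\<^sub>F y in at x. y \<in> S" using assms by (intro eventually_at_in_open') auto
    ultimately have "\<forall>\<^sub>F y in at x. dist (P y) (P x) < e/2 \<and> dist (Q y) (Q x) < e/2 \<and> y \<in> S"
      by eventually_elim auto
    then obtain d where d: "d > 0" and dd: "\<And>y. y \<noteq> x \<Longrightarrow> dist y x < d \<Longrightarrow> dist (P y) (P x) < e/2 \<and> dist (Q y) (Q x) < e/2 \<and> y \<in> S"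
      by (auto simp: eventually_at)
    then have dd: "dist (P y) (P x) < e/2 \<and> dist (Q y) (Q x) < e/2 \<and> y \<in> S" if "dist y x < d" for y
      using that assms(3) \<open>e > 0\<close> by (cases "y = x") auto
    define s where "s = d / (2 * (norm v + norm w + 1))"
    have nn: "norm v + norm w + 1 > 0" using norm_ge_zero[of v] norm_ge_zero[of w] by linarith
    have s: "s > 0" using d nn by (simp add: s_def)
    have near: "dist (x + a *\<^sub>R v + b *\<^sub>R w) x < d" if "0 \<le> a" "a \<le> s" "0 \<le> b" "b \<le> s" for a b
    proof -
      have "dist (x + a *\<^sub>R v + b *\<^sub>R w) x \<le> a * norm v + b * norm w"
        using that norm_triangle_ineq[of "a *\<^sub>R v" "b *\<^sub>R w"] by (simp add: dist_norm)
      also have "\<dots> \<le> s * norm v + s * norm w" using that by (intro add_mono mult_right_mono) auto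
      also have "\<dots> < s * (norm v + norm w + 1)" using s by (simp add: algebra_simps)
      also have "\<dots> = d / 2" using nn by (simp add: s_def field_simps)
      finally show ?thesis using d by simp
    qed
    obtain a b where ab: "0 < a" "a < s" "0 < b" "b < s"
      and e1: "f (x + s *\<^sub>R v + s *\<^sub>R w) - f (x + s *\<^sub>R v) - f (x + s *\<^sub>R w) + f x = s * s * P (x + a *\<^sub>R v + b *\<^sub>R w)"
      using mixed_difference_mean_value[OF assms(2) s s, of x v w] near dd unfolding P_def by (metis (no_types, lifting))
    obtain a' b' where ab': "0 < a'" "a' < s" "0 < b'" "b' < s"
      and e2: "f (x + s *\<^sub>R w + s *\<^sub>R v) - f (x + s *\<^sub>R w) - f (x + s *\<^sub>R v) + f x = s * s * Q (x + a' *\<^sub>R w + b' *\<^sub>R v)"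
    proof (rule mixed_difference_mean_value[OF assms(2) s s, of x w v])
      fix a b assume ab: "0 \<le> a" "a \<le> s" "0 \<le> b" "b \<le> s"
      have "x + a *\<^sub>R w + b *\<^sub>R v = x + b *\<^sub>R v + a *\<^sub>R w" by (simp add: algebra_simps)
      then show "x + a *\<^sub>R w + b *\<^sub>R v \<in> S" using near[of b a] dd ab by metis
    qed (simp add: Q_def)
    have eq: "x + s *\<^sub>R w + s *\<^sub>R v = x + s *\<^sub>R v + s *\<^sub>R w" by (simp add: algebra_simps)
    have "s * s * P (x + a *\<^sub>R v + b *\<^sub>R w) = s * s * Q (x + a' *\<^sub>R w + b' *\<^sub>R v)"
      using e1 e2 unfolding eq by linarith
    then have "P (x + a *\<^sub>R v + b *\<^sub>R w) = Q (x + a' *\<^sub>R w + b' *\<^sub>R v)" using s by simp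
    moreover have "dist (P (x + a *\<^sub>R v + b *\<^sub>R w)) (P x) < e/2" using near[of a b] dd ab by simp
    moreover have "dist (Q (x + a' *\<^sub>R w + b' *\<^sub>R v)) (Q x) < e/2"
    proof -
      have "x + a' *\<^sub>R w + b' *\<^sub>R v = x + b' *\<^sub>R v + a' *\<^sub>R w" by (simp add: algebra_simps)
      moreover have "dist (x + b' *\<^sub>R v + a' *\<^sub>R w) x < d" using near[of b' a'] ab' by simp
      ultimately have "dist (x + a' *\<^sub>R w + b' *\<^sub>R v) x < d" by metis
      then show ?thesis using dd by blast
    qed
    ultimately show ?thesis unfolding dist_real_def by linarith
  qed
  then have "\<bar>P x - Q x\<bar> \<le> 0" using field_le_epsilon[of "\<bar>P x - Q x\<bar>" 0] by simp
  then have "P x = Q x" by simp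
  then show ?thesis by (simp add: P_def Q_def)
qed

section \<open>Derivatives along vector fields and the strong minimum principle\<close>

text \<open>The field \<open>W\<close> varies with the point, so a second derivative along fields also differentiates the inner field.\<close>

definition dirderiv :: "('a::euclidean_space \<Rightarrow> 'a) \<Rightarrow> ('a \<Rightarrow> 'b::euclidean_space) \<Rightarrow> 'a \<Rightarrow> 'b" where
  "dirderiv W f x = frechet_derivative f (at x) (W x)"

lemma dirderiv_eqI: "(f has_derivative D) (at x) \<Longrightarrow> dirderiv W f x = D (W x)"
  by (metis dirderiv_def frechet_derivative_at)

lemma dirderiv_cong:
  "open S \<Longrightarrow> x \<in> S \<Longrightarrow> (\<And>y. y \<in> S \<Longrightarrow> f y = g y) \<Longrightarrow> dirderiv W f x = dirderiv W g x"
  unfolding dirderiv_def using frechet_derivative_cong_open[of S x f g] by simp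

lemma dirderiv_const [simp]: "dirderiv W (\<lambda>x. c) = (\<lambda>x. 0)"
  by (simp add: dirderiv_def frechet_derivative_const fun_eq_iff)

context
  fixes S :: "'a::euclidean_space set" and x :: 'a
  assumes S: "open S" "x \<in> S"
begin

lemma dirderiv_add:
  assumes f: "smooth_on S f" and g: "smooth_on S g"
  shows "dirderiv W (\<lambda>x. f x + g x) x = dirderiv W f x + dirderiv W g x"
  using dirderiv_eqI[OF has_derivative_add[OF smooth_on_has_derivative[OF f S(2)] smooth_on_has_derivative[OF g S(2)]], of W]
  by (simp add: dirderiv_def)

lemma dirderiv_diff:
  assumes f: "smooth_on S f" and g: "smooth_on S g"
  shows "dirderiv W (\<lambda>x. f x - g x) x = dirderiv W f x - dirderiv W g x"
  using dirderiv_eqI[OF has_derivative_diff[OF smooth_on_has_derivative[OF f S(2)] smooth_on_has_derivative[OF g S(2)]], of W]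
  by (simp add: dirderiv_def)

lemma dirderiv_uminus:
  assumes f: "smooth_on S f"
  shows "dirderiv W (\<lambda>x. - f x) x = - dirderiv W f x"
  using dirderiv_eqI[OF has_derivative_minus[OF smooth_on_has_derivative[OF f S(2)]], of W]
  by (simp add: dirderiv_def)

lemma dirderiv_mult:
  fixes f g :: "'a \<Rightarrow> real"
  assumes f: "smooth_on S f" and g: "smooth_on S g"
  shows "dirderiv W (\<lambda>x. f x * g x) x = dirderiv W f x * g x + f x * dirderiv W g x"
  using dirderiv_eqI[OF has_derivative_mult[OF smooth_on_has_derivative[OF f S(2)] smooth_on_has_derivative[OF g S(2)]], of W]
  by (simp add: dirderiv_def)

lemma dirderiv_cmult:
  fixes f :: "'a \<Rightarrow> real"
  assumes f: "smooth_on S f"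
  shows "dirderiv W (\<lambda>x. c * f x) x = c * dirderiv W f x"
  using dirderiv_mult[OF smooth_on_const[of S c] f, of W] by simp

lemma dirderiv_sum:
  assumes "\<And>i. i \<in> I \<Longrightarrow> smooth_on S (f i)"
  shows "dirderiv W (\<lambda>x. \<Sum>i\<in>I. f i x) x = (\<Sum>i\<in>I. dirderiv W (f i) x)"
proof -
  have "((\<lambda>x. \<Sum>i\<in>I. f i x) has_derivative (\<lambda>v. \<Sum>i\<in>I. frechet_derivative (f i) (at x) v)) (at x)"
    using assms S(2) by (intro has_derivative_sum smooth_on_has_derivative)
  from dirderiv_eqI[OF this, of W] show ?thesis by (simp add: dirderiv_def)
qed

lemma dirderiv_linear:
  assumes f: "smooth_on S f" and L: "bounded_linear L"
  shows "dirderiv W (\<lambda>x. L (f x)) x = L (dirderiv W f x)"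
proof -
  have "((\<lambda>x. L (f x)) has_derivative (\<lambda>v. L (frechet_derivative f (at x) v))) (at x)"
    by (rule bounded_linear.has_derivative[OF L smooth_on_has_derivative[OF f S(2)]])
  from dirderiv_eqI[OF this, of W] show ?thesis by (simp add: dirderiv_def)
qed

end

lemma dirderiv_expansion:
  assumes "smooth_on S f" "x \<in> S"
  shows "dirderiv W f x = (\<Sum>b\<in>Basis. (W x \<bullet> b) *\<^sub>R frechet_derivative f (at x) b)"
  unfolding dirderiv_def
  using linear_euclidean_expansion has_derivative_linear smooth_on_has_derivative[OF assms] by blast

lemma smooth_on_dirderiv:
  assumes "open S" "smooth_on S W" "smooth_on S f"
  shows "smooth_on S (dirderiv W f)"
proof -
  have "smooth_on S (\<lambda>x. \<Sum>b\<in>Basis. (W x \<bullet> b) *\<^sub>R frechet_derivative f (at x) b)"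
    by (intro smooth_on_sum smooth_on_scaleR smooth_on_inner assms smooth_on_const smooth_on_frechet_derivative)
  then show ?thesis
    using smooth_on_cong[OF assms(1) dirderiv_expansion[OF assms(3)]] by simp
qed

text \<open>The first term comes from the variation of the inner field, the second is the Hessian of \<open>f\<close>.  Since the Hessian is symmetric, only the first term survives in a commutator.\<close>

lemma dirderiv_dirderiv:
  fixes f :: "'a::euclidean_space \<Rightarrow> real"
  assumes S: "open S" "x \<in> S" and W: "smooth_on S W" and f: "smooth_on S f"
  shows "dirderiv U (dirderiv W f) x = frechet_derivative f (at x) (dirderiv U W x)
     + frechet_derivative (\<lambda>y. frechet_derivative f (at y) (W x)) (at x) (U x)"
proof -
  have Df: "smooth_on S (\<lambda>y. frechet_derivative f (at y) b)" for b
    using f by (rule smooth_on_frechet_derivative)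
  have Wb: "smooth_on S (\<lambda>y. W y \<bullet> b)" for b
    using S W by (intro smooth_on_inner smooth_on_const)
  have lin: "linear (frechet_derivative f (at y))" if "y \<in> S" for y
    using smooth_on_has_derivative[OF f that] has_derivative_linear by blast
  have "dirderiv U (dirderiv W f) x = dirderiv U (\<lambda>y. \<Sum>b\<in>Basis. (W y \<bullet> b) * frechet_derivative f (at y) b) x"
    by (rule dirderiv_cong[OF S]) (use dirderiv_expansion[OF f] in auto)
  also have "\<dots> = (\<Sum>b\<in>Basis. dirderiv U (\<lambda>y. (W y \<bullet> b) * frechet_derivative f (at y) b) x)"
    by (intro dirderiv_sum[OF S] smooth_on_mult S Wb Df)
  also have "\<dots> = (\<Sum>b\<in>Basis. dirderiv U (\<lambda>y. W y \<bullet> b) x * frechet_derivative f (at x) b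
       + (W x \<bullet> b) * dirderiv U (\<lambda>y. frechet_derivative f (at y) b) x)"
    by (intro sum.cong refl dirderiv_mult[OF S] Wb Df)
  also have "\<dots> = (\<Sum>b\<in>Basis. (dirderiv U W x \<bullet> b) * frechet_derivative f (at x) b)
     + (\<Sum>b\<in>Basis. (W x \<bullet> b) * dirderiv U (\<lambda>y. frechet_derivative f (at y) b) x)"
    using dirderiv_linear[OF S W bounded_linear_inner_left] by (simp add: sum.distrib)
  also have "(\<Sum>b\<in>Basis. (dirderiv U W x \<bullet> b) * frechet_derivative f (at x) b) = frechet_derivative f (at x) (dirderiv U W x)"
    using linear_euclidean_expansion[OF lin[OF S(2)], of "dirderiv U W x"] by simp
  also have "(\<Sum>b\<in>Basis. (W x \<bullet> b) * dirderiv U (\<lambda>y. frechet_derivative f (at y) b) x)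
      = dirderiv U (\<lambda>y. \<Sum>b\<in>Basis. (W x \<bullet> b) * frechet_derivative f (at y) b) x"
    using S Df by (subst dirderiv_sum[OF S]) (auto intro!: smooth_on_mult sum.cong simp: dirderiv_cmult[OF S])
  also have "\<dots> = dirderiv U (\<lambda>y. frechet_derivative f (at y) (W x)) x"
    by (rule dirderiv_cong[OF S]) (use linear_euclidean_expansion[OF lin, of _ "W x"] in simp)
  also have "\<dots> = frechet_derivative (\<lambda>y. frechet_derivative f (at y) (W x)) (at x) (U x)"
    by (simp only: dirderiv_def)
  finally show ?thesis .
qed

lemma second_derivative_nonneg_at_min:
  fixes \<phi> \<phi>' :: "real \<Rightarrow> real"
  assumes "e > 0" "\<And>t. \<bar>t\<bar> < e \<Longrightarrow> (\<phi> has_real_derivative \<phi>' t) (at t)"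
    "(\<phi>' has_real_derivative l) (at 0)" "\<phi>' 0 = 0" "\<And>t. \<bar>t\<bar> < e \<Longrightarrow> \<phi> 0 \<le> \<phi> t"
  shows "l \<ge> 0"
proof (rule ccontr)
  assume "\<not> l \<ge> 0"
  then obtain d where d: "d > 0" "\<And>h. h > 0 \<Longrightarrow> h < d \<Longrightarrow> \<phi>' h < 0"
    using has_real_derivative_neg_dec_right[OF assms(3)] assms(4) by force
  define t where "t = min d e / 2"
  have t: "0 < t" "t < d" "t < e" using d(1) assms(1) by (auto simp: t_def)
  obtain s where s: "0 < s" "s < t" "\<phi> t - \<phi> 0 = (t - 0) * \<phi>' s"
    using MVT2[OF t(1), of \<phi> \<phi>'] assms(2) t by force
  have "\<phi>' s < 0" using d(2)[of s] s t by simp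
  then have "\<phi> t - \<phi> 0 < 0" using s t by (simp add: mult_pos_neg)
  then show False using assms(5)[of t] t by simp
qed

lemma frechet_derivative_eq_0_at_min:
  fixes f :: "'a::euclidean_space \<Rightarrow> real"
  assumes "open S" "x \<in> S" "smooth_on S f" "\<And>y. y \<in> S \<Longrightarrow> f x \<le> f y"
  shows "frechet_derivative f (at x) v = 0"
  using differential_zero_maxmin[OF assms(2,1) smooth_on_has_derivative[OF assms(3,2)]] assms(4) by metis

text \<open>At a minimum \<open>Df\<close> vanishes, so the term that differentiates \<open>W\<close> drops out of \<open>dirderiv_dirderiv\<close> and the ordinary second derivative along the line in direction \<open>W x\<close> remains.\<close>

lemma dirderiv2_nonneg_at_min:
  fixes f :: "'a::euclidean_space \<Rightarrow> real"
  assumes S: "open S" "x \<in> S" and f: "smooth_on S f" and W: "smooth_on S W"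
    and min: "\<And>y. y \<in> S \<Longrightarrow> f x \<le> f y"
  shows "dirderiv W f x = 0" "dirderiv W (dirderiv W f) x \<ge> 0"
proof -
  have D0: "frechet_derivative f (at x) v = 0" for v
    using frechet_derivative_eq_0_at_min[OF S f] min by blast
  show "dirderiv W f x = 0" by (simp add: dirderiv_def D0)
  define w where "w = W x"
  let ?g = "\<lambda>y. frechet_derivative f (at y) w"
  have g: "smooth_on S ?g" using f by (rule smooth_on_frechet_derivative)
  obtain r where r: "r > 0" "ball x r \<subseteq> S" using S open_contains_ball by blast
  define e where "e = r / (norm w + 1)"
  have e: "e > 0" using r by (simp add: e_def add_nonneg_pos)
  have inS: "x + t *\<^sub>R w \<in> S" if "\<bar>t\<bar> < e" for t
  proof -
    have "\<bar>t\<bar> * (norm w + 1) < r" using that by (simp add: e_def pos_less_divide_eq add_nonneg_pos)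
    moreover have "\<bar>t\<bar> * norm w \<le> \<bar>t\<bar> * (norm w + 1)" by (simp add: mult_left_mono)
    ultimately show ?thesis using r(2) by (auto simp: dist_norm)
  qed
  have der: "((\<lambda>t. h (x + t *\<^sub>R w)) has_real_derivative frechet_derivative h (at (x + t *\<^sub>R w)) w) (at t)"
    if "smooth_on S h" "\<bar>t\<bar> < e" for h :: "'a \<Rightarrow> real" and t
  proof -
    have h: "(h has_derivative frechet_derivative h (at (x + t *\<^sub>R w))) (at (x + t *\<^sub>R w))"
      using smooth_on_has_derivative[OF that(1) inS[OF that(2)]] .
    have "((\<lambda>t. h (x + t *\<^sub>R w)) has_derivative (\<lambda>s. frechet_derivative h (at (x + t *\<^sub>R w)) (s *\<^sub>R w))) (at t)"
      by (rule has_derivative_compose[of "\<lambda>t. x + t *\<^sub>R w" "\<lambda>s. s *\<^sub>R w", OF _ h]) (auto intro!: derivative_eq_intros)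
    moreover have "frechet_derivative h (at (x + t *\<^sub>R w)) (s *\<^sub>R w) = frechet_derivative h (at (x + t *\<^sub>R w)) w * s" for s
      using has_derivative_linear[OF h] by (simp add: linear_cmul)
    ultimately show ?thesis by (simp add: has_field_derivative_def)
  qed
  have "frechet_derivative ?g (at x) w \<ge> 0"
  proof (rule second_derivative_nonneg_at_min[OF e])
    show "((\<lambda>t. f (x + t *\<^sub>R w)) has_real_derivative ?g (x + t *\<^sub>R w)) (at t)" if "\<bar>t\<bar> < e" for t
      using der[OF f that] .
    show "((\<lambda>t. ?g (x + t *\<^sub>R w)) has_real_derivative frechet_derivative ?g (at x) w) (at 0)"
      using der[OF g, of 0] e by simp
    show "?g (x + 0 *\<^sub>R w) = 0" by (simp add: D0)
    show "f (x + 0 *\<^sub>R w) \<le> f (x + t *\<^sub>R w)" if "\<bar>t\<bar> < e" for t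
      using min inS[OF that] by simp
  qed
  then show "dirderiv W (dirderiv W f) x \<ge> 0"
    using dirderiv_dirderiv[OF S W f, of W] by (simp add: D0 w_def)
qed

text \<open>A second-order operator written as a sum of squares of vector fields plus first-order terms.  It is elliptic as soon as the fields span at every point, and the Laplacian of a hypersurface is such a sum for the tangential projections of the standard basis vectors.\<close>

definition sumsq_op :: "('m::finite \<Rightarrow> 'a::euclidean_space \<Rightarrow> 'a) \<Rightarrow> ('m \<Rightarrow> 'a \<Rightarrow> real) \<Rightarrow> ('a \<Rightarrow> real) \<Rightarrow> 'a \<Rightarrow> real" where
  "sumsq_op V b f x = (\<Sum>a. dirderiv (V a) (dirderiv (V a) f) x) + (\<Sum>a. b a x * dirderiv (V a) f x)"

context
  fixes S :: "'a::euclidean_space set" and V :: "'m::finite \<Rightarrow> 'a \<Rightarrow> 'a" and b :: "'m \<Rightarrow> 'a \<Rightarrow> real"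
  assumes S: "open S" and V: "\<And>a. smooth_on S (V a)" and b: "\<And>a. continuous_on S (b a)"
    and span: "\<And>x \<xi>. x \<in> S \<Longrightarrow> (\<And>a. V a x \<bullet> \<xi> = 0) \<Longrightarrow> \<xi> = 0"
begin

lemma sumsq_op_diff_cmult:
  assumes "x \<in> S" "smooth_on S f" "smooth_on S g"
  shows "sumsq_op V b (\<lambda>x. f x - c * g x) x = sumsq_op V b f x - c * sumsq_op V b g x"
proof -
  have 1: "dirderiv (V a) (\<lambda>x. f x - c * g x) y = dirderiv (V a) f y - c * dirderiv (V a) g y" if "y \<in> S" for a y
    using S that assms by (simp add: dirderiv_diff[OF S that] dirderiv_cmult[OF S that] smooth_on_mult)
  have 2: "dirderiv (V a) (dirderiv (V a) (\<lambda>x. f x - c * g x)) x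
      = dirderiv (V a) (\<lambda>y. dirderiv (V a) f y - c * dirderiv (V a) g y) x" for a
    by (rule dirderiv_cong[OF S assms(1) 1])
  have sm: "smooth_on S (dirderiv (V a) f)" "smooth_on S (dirderiv (V a) g)" for a
    using smooth_on_dirderiv S V assms by auto
  show ?thesis
    unfolding sumsq_op_def 2 1[OF assms(1)]
    using S sm by (simp add: dirderiv_diff[OF S assms(1)] dirderiv_cmult[OF S assms(1)] smooth_on_mult
       sum_subtractf sum.distrib sum_distrib_left algebra_simps)
qed

text \<open>Two derivatives of the exponential produce \<open>4 \<alpha>^2\<close> times the sum of the squares \<open>((x - y) \<bullet> V a x)^2\<close>, all other terms being \<open>O(\<alpha>)\<close>.  The sum is positive on \<open>K\<close> because the fields span and \<open>x \<noteq> y\<close>, and is bounded below by compactness.\<close>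

lemma hopf_barrier:
  fixes y :: 'a and K :: "'a set"
  assumes K: "compact K" "K \<subseteq> S" "y \<notin> K" "K \<noteq> {}" and c: "c \<ge> 0"
  obtains \<alpha> where "\<alpha> > 0" "\<And>x. x \<in> K \<Longrightarrow> sumsq_op V b (\<lambda>x. exp (- \<alpha> * ((x - y) \<bullet> (x - y)))) x > c * exp (- \<alpha> * ((x - y) \<bullet> (x - y)))"
proof -
  define h where "h a x = (x - y) \<bullet> V a x" for a x
  have id: "smooth_on S (\<lambda>x. x - y)"
    by (intro smooth_on_diff S smooth_on_id smooth_on_const)
  have h: "smooth_on S (h a)" for a
    unfolding h_def by (intro smooth_on_inner S id V)
  define q where "q x = (\<Sum>a. dirderiv (V a) (h a) x) + (\<Sum>a. b a x * h a x)" for x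
  define p where "p x = (\<Sum>a. (h a x)\<^sup>2)" for x
  have hc: "continuous_on K (h a)" "continuous_on K (dirderiv (V a) (h a))" "continuous_on K (b a)" for a
    by (rule continuous_on_subset[OF _ K(2)], rule smooth_on_imp_continuous_on[OF h]
        smooth_on_imp_continuous_on[OF smooth_on_dirderiv[OF S V h]] b)+
  have "continuous_on K q" unfolding q_def by (intro continuous_intros hc)
  then obtain Q where Q: "\<And>x. x \<in> K \<Longrightarrow> q x \<le> Q"
    using continuous_attains_sup[OF K(1,4)] by blast
  have "continuous_on K p" unfolding p_def by (intro continuous_intros hc)
  then obtain x1 where x1: "x1 \<in> K" "\<And>x. x \<in> K \<Longrightarrow> p x1 \<le> p x"
    using continuous_attains_inf[OF K(1,4)] by blast
  have "p x1 > 0"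
  proof -
    have "p x1 \<ge> 0" by (simp add: p_def sum_nonneg)
    moreover have "p x1 \<noteq> 0"
    proof
      assume "p x1 = 0"
      then have "V a x1 \<bullet> (x1 - y) = 0" for a
        by (simp add: p_def sum_nonneg_eq_0_iff h_def inner_commute)
      then have "x1 - y = 0" using span K(2) x1(1) by blast
      then show False using x1(1) K(3) by auto
    qed
    ultimately show ?thesis by simp
  qed
  define \<theta> where "\<theta> = p x1"
  have \<theta>: "\<theta> > 0" "\<And>x. x \<in> K \<Longrightarrow> \<theta> \<le> p x" using x1 \<open>p x1 > 0\<close> by (auto simp: \<theta>_def)
  \<comment> \<open>Chosen so that \<open>4 \<theta> \<alpha> - 2 |Q| > c\<close>; multiplying by \<open>\<alpha> \<ge> 1\<close> can only help as \<open>c \<ge> 0\<close>.\<close>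
  define \<alpha> where "\<alpha> = 1 + (c + 2 * \<bar>Q\<bar>) / (4 * \<theta>)"
  have \<alpha>: "\<alpha> \<ge> 1" "4 * \<theta> * \<alpha> - 2 * \<bar>Q\<bar> > c"
    using \<theta>(1) c by (auto simp: \<alpha>_def field_simps)
  define E where "E x = exp (- \<alpha> * ((x - y) \<bullet> (x - y)))" for x
  have E: "smooth_on S E" unfolding E_def
    by (intro smooth_on_exp smooth_on_mult smooth_on_inner S id smooth_on_const)
  have E1: "dirderiv (V a) E x = - 2 * \<alpha> * (E x * h a x)" for a x
    unfolding E_def
    by (rule trans[OF dirderiv_eqI]) (auto intro!: derivative_eq_intros simp: h_def inner_commute algebra_simps)
  have E2: "dirderiv (V a) (dirderiv (V a) E) x = E x * (4 * \<alpha>\<^sup>2 * (h a x)\<^sup>2 - 2 * \<alpha> * dirderiv (V a) (h a) x)" if "x \<in> S" for a x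
  proof -
    have "dirderiv (V a) E = (\<lambda>x. - 2 * \<alpha> * (E x * h a x))" by (rule ext) (rule E1)
    then have "dirderiv (V a) (dirderiv (V a) E) x = - 2 * \<alpha> * (dirderiv (V a) E x * h a x + E x * dirderiv (V a) (h a) x)"
      using dirderiv_cmult[OF S that smooth_on_mult[OF S E h[of a]]] dirderiv_mult[OF S that E h[of a]] by metis
    then show ?thesis by (simp only: E1) (simp add: algebra_simps power2_eq_square)
  qed
  have op: "sumsq_op V b E x = E x * (4 * \<alpha>\<^sup>2 * p x - 2 * \<alpha> * q x)" if "x \<in> S" for x
    unfolding sumsq_op_def p_def q_def E2[OF that] E1
    by (simp add: sum_distrib_left sum_subtractf algebra_simps sum.distrib sum_negf)
  show ?thesis
  proof (rule that)
    show "\<alpha> > 0" using \<alpha> by simp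
    fix x assume x: "x \<in> K"
    have "c < \<alpha> * (4 * \<theta> * \<alpha> - 2 * \<bar>Q\<bar>)"
      using \<alpha> c by (smt (verit) mult_le_cancel_right1)
    also have "\<dots> = 4 * \<alpha>\<^sup>2 * \<theta> - 2 * \<alpha> * \<bar>Q\<bar>" by (simp add: algebra_simps power2_eq_square)
    also have "\<dots> \<le> 4 * \<alpha>\<^sup>2 * p x - 2 * \<alpha> * q x"
      using \<theta>(2)[OF x] Q[OF x] \<alpha>(1) by (intro diff_mono mult_left_mono) auto
    finally have "c * E x < E x * (4 * \<alpha>\<^sup>2 * p x - 2 * \<alpha> * q x)"
      by (simp add: E_def)
    then have "c * E x < sumsq_op V b (\<lambda>x. E x) x" using op x K(2) by auto
    then show "sumsq_op V b (\<lambda>x. exp (- \<alpha> * ((x - y) \<bullet> (x - y)))) x > c * exp (- \<alpha> * ((x - y) \<bullet> (x - y)))"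
      by (simp add: E_def)
  qed
qed

text \<open>The Hopf boundary point argument.  On the annulus \<open>d/2 \<le> |x - y| \<le> d\<close> the function \<open>f\<close> dominates a small multiple of the barrier \<open>w\<close>: a negative interior minimum of the difference would contradict the two differential inequalities.  Both functions vanish at \<open>z\<close>, and \<open>w\<close> increases linearly towards \<open>y\<close>; but \<open>z\<close> is an interior minimum of \<open>f\<close>, where \<open>Df\<close> is zero.\<close>

lemma hopf_boundary_contradiction:
  assumes f: "smooth_on S f" and pos: "\<And>x. x \<in> S \<Longrightarrow> f x \<ge> 0"
    and C: "continuous_on S C" and ineq: "\<And>x. x \<in> S \<Longrightarrow> sumsq_op V b f x \<le> C x * f x"
    and d: "d > 0" "cball y d \<subseteq> S" and z: "dist y z = d" "f z = 0"
    and int: "\<And>x. dist y x < d \<Longrightarrow> f x > 0"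
  shows False
proof -
  define K where "K = {x. d/2 \<le> dist y x \<and> dist y x \<le> d}"
  have Keq: "K = cball y d - ball y (d/2)" by (auto simp: K_def)
  have K: "compact K" unfolding Keq by (rule compact_diff) auto
  have KS: "K \<subseteq> S" using d by (auto simp: Keq)
  have zK: "z \<in> K" using z d by (auto simp: K_def)
  have yK: "y \<notin> K" using d by (auto simp: K_def)
  obtain c0 where "\<And>x. x \<in> K \<Longrightarrow> C x \<le> c0"
    using continuous_attains_sup[OF K _ continuous_on_subset[OF C KS]] zK by blast
  then obtain c where c: "c \<ge> 0" "\<And>x. x \<in> K \<Longrightarrow> C x \<le> c"
    by (metis abs_ge_self abs_ge_zero order_trans)
  have "K \<noteq> {}" using zK by auto
  obtain m where m: "m > 0" "\<And>x. dist y x = d/2 \<Longrightarrow> m \<le> f x"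
  proof -
    have "sphere y (d/2) \<noteq> {}"
      using d(1) by simp
    moreover have "continuous_on (sphere y (d/2)) f"
      using d(1) by (intro continuous_on_subset[OF smooth_on_imp_continuous_on[OF f] subset_trans[OF _ d(2)]]) auto
    ultimately obtain x1 where "x1 \<in> sphere y (d/2)" "\<And>x. x \<in> sphere y (d/2) \<Longrightarrow> f x1 \<le> f x"
      using continuous_attains_inf[of "sphere y (d/2)" f] by auto
    then show ?thesis using that[of "f x1"] int[of x1] d(1) by auto
  qed
  obtain \<alpha> where \<alpha>: "\<alpha> > 0" and bar: "\<And>x. x \<in> K \<Longrightarrow> sumsq_op V b (\<lambda>x. exp (- \<alpha> * ((x - y) \<bullet> (x - y)))) x
      > c * exp (- \<alpha> * ((x - y) \<bullet> (x - y)))"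
    using hopf_barrier[OF K KS yK \<open>K \<noteq> {}\<close> c(1)] by metis
  define E where "E x = exp (- \<alpha> * ((x - y) \<bullet> (x - y)))" for x
  have Ed: "E x = exp (- \<alpha> * (dist y x)\<^sup>2)" for x
    by (simp add: E_def dist_norm norm_minus_commute power2_norm_eq_inner)
  have E: "smooth_on S E" unfolding E_def
    by (intro smooth_on_exp smooth_on_mult smooth_on_inner smooth_on_diff S smooth_on_id smooth_on_const)
  define w where "w x = E x - exp (- \<alpha> * d\<^sup>2)" for x
  have w: "smooth_on S w" unfolding w_def by (intro smooth_on_diff S E smooth_on_const)
  have opw: "sumsq_op V b w x = sumsq_op V b E x" if "x \<in> S" for x
    using sumsq_op_diff_cmult[OF that E smooth_on_const[of S 1], of "exp (- \<alpha> * d\<^sup>2)"]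
    by (simp add: sumsq_op_def w_def[abs_def])
  define g where "g x = f x - m * w x" for x
  have g: "smooth_on S g" unfolding g_def by (intro smooth_on_diff smooth_on_mult S f w smooth_on_const)
  have gK: "g x \<ge> 0" if "x \<in> K" for x
  proof (rule ccontr)
    assume neg: "\<not> g x \<ge> 0"
    obtain x1 where x1: "x1 \<in> K" "\<And>x. x \<in> K \<Longrightarrow> g x1 \<le> g x"
      using continuous_attains_inf[OF K \<open>K \<noteq> {}\<close> continuous_on_subset[OF smooth_on_imp_continuous_on[OF g] KS]] by blast
    have neg1: "g x1 < 0" using neg x1(2)[OF that] by simp
    have "dist y x1 \<noteq> d/2"
    proof
      assume eq: "dist y x1 = d/2"
      have "E x1 \<le> 1" unfolding Ed using \<alpha> by simp
      then have "w x1 \<le> 1" unfolding w_def by (smt (verit) exp_gt_zero)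
      then have "m * w x1 \<le> m" using m(1) by simp
      then show False using m(2)[OF eq] neg1 by (simp add: g_def)
    qed
    moreover have "dist y x1 \<noteq> d"
    proof
      assume eq: "dist y x1 = d"
      then have "w x1 = 0" by (simp add: w_def Ed)
      then show False using neg1 pos[of x1] x1(1) KS by (auto simp: g_def)
    qed
    ultimately have x1o: "x1 \<in> ball y d - cball y (d/2)" using x1(1) by (auto simp: K_def)
    define O' where "O' = ball y d - cball y (d/2)"
    have O': "open O'" "O' \<subseteq> K" "x1 \<in> O'" "O' \<subseteq> S"
      using x1o KS by (auto simp: O'_def K_def)
    have "sumsq_op V b g x1 \<ge> 0"
    proof -
      have "g x1 \<le> g y" if "y \<in> O'" for y using x1(2) O'(2) that by blast
      then have "dirderiv (V a) g x1 = 0" "dirderiv (V a) (dirderiv (V a) g) x1 \<ge> 0" for a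
        using dirderiv2_nonneg_at_min[OF O'(1,3) smooth_on_subset[OF g O'(4)] smooth_on_subset[OF V[of a] O'(4)]]
        by blast+
      then show ?thesis by (simp add: sumsq_op_def sum_nonneg)
    qed
    moreover have "sumsq_op V b g x1 = sumsq_op V b f x1 - m * sumsq_op V b w x1"
      unfolding g_def using sumsq_op_diff_cmult f w x1(1) KS by blast
    moreover have x1S: "x1 \<in> S" using x1(1) KS by auto
    moreover have "sumsq_op V b w x1 > c * E x1" using bar[OF x1(1)] opw[OF x1S] by (simp add: E_def[abs_def])
    moreover have "c * E x1 \<ge> c * w x1" using c(1) by (simp add: w_def mult_left_mono)
    moreover have "sumsq_op V b f x1 \<le> c * f x1"
      using ineq[OF x1S] c(2)[OF x1(1)] pos[OF x1S] by (meson mult_right_mono order_trans)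
    moreover have "c * f x1 \<le> c * (m * w x1)" using neg1 c(1) by (intro mult_left_mono) (auto simp: g_def)
    ultimately show False using m(1)
      by (smt (verit, ccfv_threshold) mult.left_commute mult_less_cancel_left_pos)
  qed
  have zS: "z \<in> S" using zK KS by auto
  have gz: "g z = 0" using z by (simp add: g_def w_def Ed)
  have "frechet_derivative f (at z) v = 0" for v
    by (rule frechet_derivative_eq_0_at_min[OF S zS f]) (use pos z in auto)
  moreover have "(f has_derivative frechet_derivative f (at z)) (at z)" using smooth_on_has_derivative[OF f zS] .
  ultimately have fz: "(f has_derivative (\<lambda>v. 0)) (at z)" by (metis (no_types, lifting) ext)
  define \<phi> where "\<phi> t = g (z + t *\<^sub>R (y - z))" for t
  have gd: "(g has_derivative (\<lambda>v. m * (2 * \<alpha> * E z * ((z - y) \<bullet> v)))) (at z)"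
    unfolding g_def w_def E_def
    by (rule derivative_eq_intros fz refl)+ (auto simp: algebra_simps inner_commute)
  have gd': "(g has_derivative (\<lambda>v. m * (2 * \<alpha> * E z * ((z - y) \<bullet> v)))) (at (z + 0 *\<^sub>R (y - z)))" using gd by simp
  have "(\<phi> has_derivative (\<lambda>s. m * (2 * \<alpha> * E z * ((z - y) \<bullet> (s *\<^sub>R (y - z)))))) (at 0)"
    unfolding \<phi>_def by (rule has_derivative_compose[of "\<lambda>t. z + t *\<^sub>R (y - z)" "\<lambda>s. s *\<^sub>R (y - z)", OF _ gd'])
      (auto intro!: derivative_eq_intros)
  moreover have "m * (2 * \<alpha> * E z * ((z - y) \<bullet> (s *\<^sub>R (y - z)))) = - (m * (2 * \<alpha> * E z * d\<^sup>2)) * s" for s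
  proof -
    have "(z - y) \<bullet> (y - z) = - d\<^sup>2"
      using z(1) inner_minus_left[of "y - z" "y - z"] by (metis dist_norm minus_diff_eq power2_norm_eq_inner)
    then show ?thesis by simp
  qed
  ultimately have "(\<phi> has_real_derivative - (m * (2 * \<alpha> * E z * d\<^sup>2))) (at 0)"
    unfolding has_field_derivative_def by (simp only:)
  moreover have "- (m * (2 * \<alpha> * E z * d\<^sup>2)) < 0" using m(1) \<alpha> d(1) by (simp add: E_def)
  ultimately obtain e where e: "e > 0" "\<And>h. h > 0 \<Longrightarrow> h < e \<Longrightarrow> \<phi> h < \<phi> 0"
    using has_real_derivative_neg_dec_right[of \<phi> _ 0] by force
  define t where "t = min (e/2) (1/2)"
  have t: "0 < t" "t < e" "t \<le> 1/2" using e(1) by (auto simp: t_def)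
  have "dist y (z + t *\<^sub>R (y - z)) = (1 - t) * d"
  proof -
    have "y - (z + t *\<^sub>R (y - z)) = (1 - t) *\<^sub>R (y - z)" by (simp add: algebra_simps)
    then show ?thesis using z(1) t by (simp add: dist_norm)
  qed
  moreover have "t * d \<le> 1/2 * d" "0 \<le> t * d" using t d(1) by (intro mult_right_mono, auto)
  then have "d/2 \<le> (1 - t) * d" "(1 - t) * d \<le> d" by (auto simp: left_diff_distrib)
  ultimately have "z + t *\<^sub>R (y - z) \<in> K" by (simp add: K_def)
  then have "\<phi> t \<ge> 0" unfolding \<phi>_def by (rule gK)
  then show False using e(2)[OF t(1,2)] gz by (simp add: \<phi>_def)
qed

text \<open>If \<open>f\<close> were positive at some \<open>y\<close> near a zero, the largest ball around \<open>y\<close> without zeros would touch the zero set inside \<open>S\<close>, which the boundary point argument excludes.\<close>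

theorem strong_minimum_principle:
  assumes f: "smooth_on S f" and pos: "\<And>x. x \<in> S \<Longrightarrow> f x \<ge> 0"
    and C: "continuous_on S C" and ineq: "\<And>x. x \<in> S \<Longrightarrow> sumsq_op V b f x \<le> C x * f x"
  shows "open {x \<in> S. f x = 0}"
proof (rule openI)
  fix x0 assume "x0 \<in> {x \<in> S. f x = 0}"
  then have x0: "x0 \<in> S" "f x0 = 0" by auto
  obtain r0 where r0: "r0 > 0" "cball x0 r0 \<subseteq> S" using S x0(1) open_contains_cball by blast
  \<comment> \<open>A point within distance \<open>R\<close> of \<open>x0\<close> has its nearest zero, and the ball up to it, within distance \<open>2 R\<close>.\<close>
  define R where "R = r0 / 2"
  have R: "R > 0" "cball x0 (2 * R) \<subseteq> S" using r0 by (auto simp: R_def)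
  have "f y = 0" if y: "y \<in> ball x0 R" for y
  proof (rule ccontr)
    assume "f y \<noteq> 0"
    define Z where "Z = {x \<in> cball x0 (2 * R). f x = 0}"
    have cf: "continuous_on (cball x0 (2 * R)) f"
      using smooth_on_imp_continuous_on[OF f] R(2) continuous_on_subset by blast
    have "closed Z" unfolding Z_def
      using continuous_closed_preimage_constant[OF cf closed_cball] by simp
    moreover have "x0 \<in> Z" using x0 R by (auto simp: Z_def)
    ultimately obtain z where z: "z \<in> Z" "\<And>x. x \<in> Z \<Longrightarrow> dist y z \<le> dist y x"
      using distance_attains_inf[of Z y] by blast
    define d where "d = dist y z"
    have dR: "d < R" using z(2)[OF \<open>x0 \<in> Z\<close>] y by (simp add: d_def dist_commute)
    have "d > 0" using \<open>f y \<noteq> 0\<close> z(1) by (auto simp: d_def Z_def)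
    have sub: "x \<in> cball x0 (2*R)" if "dist y x \<le> d" for x
      using that y dR dist_triangle[of x0 x y] by simp
    show False
    proof (rule hopf_boundary_contradiction[where f = f and C = C and y = y and d = d and z = z])
      show "smooth_on S f" "continuous_on S C" "d > 0" by fact+
      show "f x \<ge> 0" "sumsq_op V b f x \<le> C x * f x" if "x \<in> S" for x
        using pos ineq that by auto
      show "cball y d \<subseteq> S" using sub R(2) by auto
      show "dist y z = d" by (simp add: d_def)
      show "f z = 0" using z(1) by (simp add: Z_def)
      fix x assume x: "dist y x < d"
      then have "x \<notin> Z" using z(2)[of x] by (auto simp: d_def)
      then have "f x \<noteq> 0" using sub[of x] x by (auto simp: Z_def)
      then show "f x > 0" using pos[of x] sub[of x] x R(2) by force
    qed
  qed
  moreover have "ball x0 R \<subseteq> S" using R by auto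
  ultimately have "ball x0 R \<subseteq> {x \<in> S. f x = 0}" by auto
  then show "\<exists>e>0. ball x0 e \<subseteq> {x \<in> S. f x = 0}" using R(1) by blast
qed

end

section \<open>The tangential calculus of a hypersurface\<close>

abbreviation kd :: "'i \<Rightarrow> 'i \<Rightarrow> real" where "kd a b \<equiv> (if a = b then 1 else 0)"

lemma sum_kd [simp]:
  fixes f :: "'i::finite \<Rightarrow> real"
  shows "(\<Sum>a. kd a b * f a) = f b" "(\<Sum>a. kd b a * f a) = f b"
    "(\<Sum>a. f a * kd a b) = f b" "(\<Sum>a. f a * kd b a) = f b"
  by (simp_all add: if_distrib[of "\<lambda>t. t * _"] if_distrib[of "\<lambda>t. _ * t"] cong: if_cong)

text \<open>A hypersurface seen in the coordinates of one chart: \<open>S\<close> is the image of the chart, and \<open>X\<close> and \<open>N\<close> are composed with its inverse.\<close>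

locale hypersurface_patch =
  fixes S :: "(real^'n::finite) set" and X N :: "real^'n \<Rightarrow> real^'m::finite"
  assumes open_S: "open S" and smooth_X: "smooth_on S X" and smooth_N: "smooth_on S N"
    and inj_dX: "\<And>x. x \<in> S \<Longrightarrow> inj (frechet_derivative X (at x))"
    and norm_N: "\<And>x. x \<in> S \<Longrightarrow> norm (N x) = 1"
    and N_orth: "\<And>x v. x \<in> S \<Longrightarrow> N x \<bullet> frechet_derivative X (at x) v = 0"
    and card_m: "CARD('m) = CARD('n) + 1"
begin

definition dX :: "real^'n \<Rightarrow> 'n \<Rightarrow> real^'m" where
  "dX x i = frechet_derivative X (at x) (axis i 1)"

definition gram :: "real^'n \<Rightarrow> real^'n^'n" where
  "gram x = (\<chi> i j. dX x i \<bullet> dX x j)"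

text \<open>The tangent vector whose image under \<open>dX\<close> is the tangential projection of the standard basis vector \<open>a\<close> (see \<open>dX_V\<close>): the solution of a linear system with the Gram matrix.  Solving it by the Cramer rule makes smoothness in \<open>x\<close> evident.\<close>

definition V :: "'m \<Rightarrow> real^'n \<Rightarrow> real^'n" where
  "V a x = (\<chi> k. det (\<chi> i j. if j = k then dX x i $ a else gram x $ i $ j) / det (gram x))"

lemma has_derivative_X: "x \<in> S \<Longrightarrow> (X has_derivative frechet_derivative X (at x)) (at x)"
  by (rule smooth_on_has_derivative[OF smooth_X])

lemma linear_dX: "x \<in> S \<Longrightarrow> linear (frechet_derivative X (at x))"
  using has_derivative_X has_derivative_linear by blast

lemma frechet_X_expansion:
  assumes "x \<in> S" shows "frechet_derivative X (at x) v = (\<Sum>i. v $ i *\<^sub>R dX x i)"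
proof -
  have "frechet_derivative X (at x) v = frechet_derivative X (at x) (\<Sum>i. v $ i *s axis i 1)"
    by (simp add: basis_expansion)
  also have "\<dots> = (\<Sum>i. v $ i *\<^sub>R dX x i)"
    by (simp add: linear_sum[OF linear_dX[OF assms]] linear_cmul[OF linear_dX[OF assms]] dX_def scalar_mult_eq_scaleR)
  finally show ?thesis .
qed

lemma gram_mult:
  assumes "x \<in> S" shows "(gram x *v v) $ i = dX x i \<bullet> frechet_derivative X (at x) v"
  by (simp add: matrix_vector_mult_def gram_def frechet_X_expansion[OF assms] inner_sum_right mult.commute)

lemma det_gram_nz: assumes "x \<in> S" shows "det (gram x) \<noteq> 0"
proof -
  have "v = 0" if "gram x *v v = 0" for v
  proof -
    let ?D = "frechet_derivative X (at x)"
    have z: "dX x i \<bullet> ?D v = 0" for i using gram_mult[OF assms, of v i] that by simp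
    have "?D v \<bullet> ?D v = (\<Sum>i. v $ i * (dX x i \<bullet> ?D v))"
      by (subst (1) frechet_X_expansion[OF assms]) (simp add: inner_sum_left)
    then have "?D v = 0" by (simp add: z)
    moreover have "?D 0 = 0" using linear_0[OF linear_dX[OF assms]] .
    ultimately show "v = 0" using inj_dX[OF assms] by (metis injD)
  qed
  then have "invertible (gram x)"
    using matrix_left_invertible_ker[of "gram x"] invertible_left_inverse by blast
  then show ?thesis using invertible_det_nz by blast
qed

lemma gram_V:
  assumes "x \<in> S" shows "gram x *v V a x = (\<chi> i. dX x i $ a)"
proof -
  have "V a x = (\<chi> k. det (\<chi> i j. if j = k then (\<chi> i. dX x i $ a) $ i else gram x $ i $ j) / det (gram x))"
    by (simp add: V_def cong: if_cong)
  then show ?thesis using cramer[OF det_gram_nz[OF assms]] by blast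
qed

text \<open>The difference of the two sides is orthogonal to \<open>N\<close> and to the range of \<open>dX\<close>, which together span the ambient space because the codimension is one.\<close>

lemma dX_V:
  assumes x: "x \<in> S" shows "frechet_derivative X (at x) (V a x) = axis a 1 - N x $ a *\<^sub>R N x"
proof -
  let ?D = "frechet_derivative X (at x)"
  define y where "y = axis a 1 - N x $ a *\<^sub>R N x - ?D (V a x)"
  have NN: "N x \<bullet> N x = 1" using norm_N[OF x] by (simp add: norm_eq_1)
  have yN: "N x \<bullet> y = 0"
    by (simp add: y_def inner_diff_right NN N_orth[OF x] inner_axis)
  have yD: "?D v \<bullet> y = 0" for v
  proof -
    have "dX x i \<bullet> y = 0" for i
    proof -
      have "dX x i \<bullet> N x = 0" using N_orth[OF x] by (simp add: dX_def inner_commute)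
      moreover have "dX x i \<bullet> ?D (V a x) = dX x i $ a"
        using gram_mult[OF x, of "V a x" i] gram_V[OF x, of a] by simp
      ultimately show ?thesis by (simp add: y_def inner_diff_right inner_axis)
    qed
    then show ?thesis by (simp add: frechet_X_expansion[OF x] inner_sum_left)
  qed
  have sub: "subspace (range ?D)" by (rule linear_subspace_image[OF linear_dX[OF x] subspace_UNIV])
  have dimR: "dim (range ?D) = CARD('n)"
    using dim_image_eq[OF linear_dX[OF x], of UNIV] inj_dX[OF x] by (simp add: inj_on_def inj_def)
  have "N x \<notin> span (range ?D)"
  proof
    assume "N x \<in> span (range ?D)"
    then obtain v where "N x = ?D v" using sub by (metis span_eq_iff imageE)
    then show False using N_orth[OF x, of v] NN by simp
  qed
  then have "dim (insert (N x) (range ?D)) = CARD('m)"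
    using dim_insert[of "N x" "range ?D"] dimR card_m by simp
  then have "span (insert (N x) (range ?D)) = UNIV"
    using dim_eq_full[of "insert (N x) (range ?D)"] by simp
  then have "y \<in> span (insert (N x) (range ?D))" by simp
  moreover have "orthogonal y z" if "z \<in> insert (N x) (range ?D)" for z
    using that yN yD by (auto simp: orthogonal_def inner_commute)
  ultimately have "orthogonal y y" using orthogonal_to_span by blast
  then have "y = 0" by (simp add: orthogonal_self)
  then show ?thesis by (simp add: y_def)
qed

lemma dX_inject: "x \<in> S \<Longrightarrow> frechet_derivative X (at x) v = frechet_derivative X (at x) w \<Longrightarrow> v = w"
  using inj_dX by (auto dest: injD)

lemma frechet_X_eq_sum:
  assumes x: "x \<in> S" and w: "N x \<bullet> w = 0"
  shows "frechet_derivative X (at x) (\<Sum>a. w $ a *\<^sub>R V a x) = w"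
proof -
  have "frechet_derivative X (at x) (\<Sum>a. w $ a *\<^sub>R V a x) = (\<Sum>a. w $ a *\<^sub>R (axis a 1 - N x $ a *\<^sub>R N x))"
    by (simp add: linear_sum[OF linear_dX[OF x]] linear_cmul[OF linear_dX[OF x]] dX_V[OF x])
  also have "\<dots> = (\<Sum>a. w $ a *s axis a 1) - (\<Sum>a. N x $ a * w $ a) *\<^sub>R N x"
    by (simp add: scaleR_diff_right sum_subtractf scaleR_left.sum scalar_mult_eq_scaleR mult.commute)
  also have "(\<Sum>a. N x $ a * w $ a) = 0" using w by (simp add: inner_vec_def)
  finally show ?thesis by (simp add: basis_expansion)
qed

lemma tangent_expansion:
  assumes x: "x \<in> S" shows "v = (\<Sum>a. frechet_derivative X (at x) v $ a *\<^sub>R V a x)"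
  by (rule dX_inject[OF x]) (simp add: frechet_X_eq_sum[OF x N_orth[OF x]])

lemma V_span: assumes x: "x \<in> S" and "\<And>a. V a x \<bullet> \<xi> = 0" shows "\<xi> = 0"
proof -
  have "\<xi> \<bullet> \<xi> = (\<Sum>a. frechet_derivative X (at x) \<xi> $ a *\<^sub>R V a x) \<bullet> \<xi>"
    using tangent_expansion[OF x, of \<xi>] by simp
  also have "\<dots> = 0" by (simp add: inner_sum_left assms(2))
  finally show ?thesis by simp
qed

lemma smooth_dX: "smooth_on S (\<lambda>x. dX x i)"
  unfolding dX_def by (rule smooth_on_frechet_derivative[OF smooth_X])

lemma smooth_V: "smooth_on S (V a)"
proof -
  have g: "smooth_on S (\<lambda>x. gram x $ i $ j)" for i j
    by (simp add: gram_def smooth_on_inner[OF open_S smooth_dX smooth_dX])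
  have d: "smooth_on S (\<lambda>x. det (\<chi> i j. if j = k then dX x i $ a else gram x $ i $ j))" for k
  proof (rule smooth_on_det[OF open_S])
    fix i j show "smooth_on S (\<lambda>x. (\<chi> i j. if j = k then dX x i $ a else gram x $ i $ j) $ i $ j)"
      using g[of i j] smooth_on_vec_nth[OF open_S smooth_dX[of i], of a] by (cases "j = k") simp_all
  qed
  have "smooth_on S (\<lambda>x. det (gram x))" by (rule smooth_on_det[OF open_S g])
  then show ?thesis unfolding V_def
    by (intro smooth_on_vec_lambda open_S smooth_on_divide d det_gram_nz)
qed

text \<open>The coordinates of \<open>X\<close> and \<open>N\<close> as scalar functions.  With them the shape operator, set to zero on the normal, becomes a matrix \<open>A\<close> of scalar functions, and \<open>A2\<close> is its square.\<close>

definition Xc :: "'m \<Rightarrow> real^'n \<Rightarrow> real" where "Xc a x = X x $ a"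
definition Nc :: "'m \<Rightarrow> real^'n \<Rightarrow> real" where "Nc a x = N x $ a"
abbreviation \<delta> :: "'m \<Rightarrow> (real^'n \<Rightarrow> real) \<Rightarrow> real^'n \<Rightarrow> real" where "\<delta> a \<equiv> dirderiv (V a)"
definition A :: "'m \<Rightarrow> 'm \<Rightarrow> real^'n \<Rightarrow> real" where "A a b x = - \<delta> a (Nc b) x"
definition A2 :: "'m \<Rightarrow> 'm \<Rightarrow> real^'n \<Rightarrow> real" where "A2 a b x = (\<Sum>c. A a c x * A c b x)"

lemma A_fun: "A a b = (\<lambda>x. - \<delta> a (Nc b) x)" by (simp add: A_def fun_eq_iff)

lemma smooth_Xc: "smooth_on S (Xc a)"
  unfolding Xc_def[abs_def] by (rule smooth_on_vec_nth[OF open_S smooth_X])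
lemma smooth_Nc: "smooth_on S (Nc a)"
  unfolding Nc_def[abs_def] by (rule smooth_on_vec_nth[OF open_S smooth_N])
lemma smooth_delta: "smooth_on S f \<Longrightarrow> smooth_on S (\<delta> a f)"
  by (rule smooth_on_dirderiv[OF open_S smooth_V])
lemma smooth_A: "smooth_on S (A a b)"
  unfolding A_def[abs_def] by (intro smooth_on_uminus open_S smooth_delta smooth_Nc)
lemma smooth_A2: "smooth_on S (A2 a b)"
  unfolding A2_def[abs_def] by (intro smooth_on_sum smooth_on_mult open_S smooth_A)

lemmas smooths = smooth_Xc smooth_Nc smooth_delta smooth_A smooth_A2 smooth_on_const
  smooth_on_sum[OF open_S] smooth_on_mult[OF open_S] smooth_on_add[OF open_S] smooth_on_diff[OF open_S]
  smooth_on_uminus[OF open_S] smooth_on_power[OF open_S]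

context fixes x assumes x: "x \<in> S" begin

lemmas d_mult = dirderiv_mult[OF open_S x]
lemmas d_add = dirderiv_add[OF open_S x]
lemmas d_diff = dirderiv_diff[OF open_S x]
lemmas d_uminus = dirderiv_uminus[OF open_S x]
lemmas d_cmult = dirderiv_cmult[OF open_S x]
lemmas d_sum = dirderiv_sum[OF open_S x]
lemmas d_cong = dirderiv_cong[OF open_S x]

lemma delta_linear: "smooth_on S f \<Longrightarrow> linear (frechet_derivative f (at x))"
  using smooth_on_has_derivative[OF _ x] has_derivative_linear by blast

lemma frechet_Xc: "frechet_derivative (Xc b) (at x) v = frechet_derivative X (at x) v $ b"
proof -
  have "((\<lambda>y. X y $ b) has_derivative (\<lambda>v. frechet_derivative X (at x) v $ b)) (at x)"
    by (rule bounded_linear.has_derivative[OF bounded_linear_vec_nth has_derivative_X[OF x]])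
  then have "(Xc b has_derivative (\<lambda>v. frechet_derivative X (at x) v $ b)) (at x)"
    by (simp add: Xc_def[abs_def])
  from frechet_derivative_at[OF this] show ?thesis by metis
qed

lemma delta_X: "\<delta> a (Xc b) x = kd a b - Nc a x * Nc b x"
  by (simp add: dirderiv_def frechet_Xc dX_V[OF x] axis_def Nc_def eq_commute)

lemma delta_N: "\<delta> a (Nc b) x = - A a b x"
  by (simp add: A_def)

lemma NN: "(\<Sum>a. Nc a x * Nc a x) = 1"
  using norm_N[OF x] by (simp add: Nc_def norm_eq_1 inner_vec_def)

lemma sum_N_V: "(\<Sum>a. N x $ a *\<^sub>R V a x) = 0"
proof -
  have "frechet_derivative X (at x) (\<Sum>a. N x $ a *\<^sub>R V a x)
     = (\<Sum>a. N x $ a *\<^sub>R axis a 1) - (\<Sum>a. N x $ a * N x $ a) *\<^sub>R N x"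
    by (simp add: linear_sum[OF linear_dX[OF x]] linear_cmul[OF linear_dX[OF x]] dX_V[OF x]
        scaleR_diff_right sum_subtractf scaleR_left.sum)
  also have "\<dots> = 0" using NN basis_expansion[of "N x"] by (simp add: Nc_def scalar_mult_eq_scaleR)
  finally show ?thesis using dX_inject[OF x, of _ 0] linear_0[OF linear_dX[OF x]] by simp
qed

lemma sum_N_delta: assumes "smooth_on S f" shows "(\<Sum>a. Nc a x * \<delta> a f x) = 0"
proof -
  have "frechet_derivative f (at x) (\<Sum>a. N x $ a *\<^sub>R V a x) = 0"
    using linear_0[OF delta_linear[OF assms]] sum_N_V by simp
  then show ?thesis
    by (simp add: linear_sum[OF delta_linear[OF assms]] linear_cmul[OF delta_linear[OF assms]] dirderiv_def Nc_def)
qed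

lemma sum_N_A: "(\<Sum>a. Nc a x * A a b x) = 0"
  using sum_N_delta[OF smooth_Nc, of b] by (simp add: A_def sum_negf)

lemma sum_A_N: "(\<Sum>b. A a b x * Nc b x) = 0"
proof -
  have "\<delta> a (\<lambda>y. \<Sum>b. Nc b y * Nc b y) x = \<delta> a (\<lambda>y. 1) x"
    by (rule d_cong) (use norm_N in \<open>simp add: Nc_def norm_eq_1 inner_vec_def\<close>)
  moreover have "\<delta> a (\<lambda>y. \<Sum>b. Nc b y * Nc b y) x = - 2 * (\<Sum>b. A a b x * Nc b x)"
    by (subst d_sum) (auto intro!: smooths simp: d_mult smooth_Nc delta_N sum_distrib_left algebra_simps simp flip: sum_negf)
  ultimately show ?thesis by simp
qed

lemma delta_delta_X: "\<delta> a (\<delta> b (Xc c)) x = A a b x * Nc c x + Nc b x * A a c x"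
proof -
  have "\<delta> a (\<delta> b (Xc c)) x = \<delta> a (\<lambda>y. kd b c - Nc b y * Nc c y) x"
  proof (rule d_cong)
    fix y assume y: "y \<in> S"
    show "\<delta> b (Xc c) y = kd b c - Nc b y * Nc c y"
      using y by (simp add: dirderiv_def hypersurface_patch.frechet_Xc[OF hypersurface_patch_axioms y]
        dX_V[OF y] axis_def Nc_def eq_commute)
  qed
  then show ?thesis
    by (subst (asm) d_diff) (auto intro!: smooths simp: d_mult smooth_Nc delta_N)
qed

text \<open>The Hessian terms cancel, so the commutator is the derivative along a vector field.\<close>

lemma commutator_frechet:
  assumes f: "smooth_on S f"
  shows "\<delta> a (\<delta> b f) x - \<delta> b (\<delta> a f) x = frechet_derivative f (at x) (dirderiv (V a) (V b) x - dirderiv (V b) (V a) x)"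
proof -
  have "Ck_on 2 S f" using f by (simp add: smooth_on_def)
  from symmetric_second_derivative_real[OF open_S this x] show ?thesis
    using dirderiv_dirderiv[OF open_S x smooth_V f] linear_diff[OF delta_linear[OF f]] by simp
qed

text \<open>The commutator of \<open>\<delta> a\<close> and \<open>\<delta> b\<close> applied to \<open>X\<close> is the image of a tangent vector, hence orthogonal to \<open>N\<close>; its normal component is \<open>A a b - A b a\<close>.\<close>

lemma A_sym: "A a b x = A b a x"
proof -
  let ?W = "dirderiv (V a) (V b) x - dirderiv (V b) (V a) x"
  have W: "frechet_derivative X (at x) ?W $ c = A a b x * Nc c x + Nc b x * A a c x - A b a x * Nc c x - Nc a x * A b c x" for c
    using commutator_frechet[OF smooth_Xc, of a b c] by (simp add: delta_delta_X frechet_Xc)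
  have "0 = (\<Sum>c. Nc c x * frechet_derivative X (at x) ?W $ c)"
    using N_orth[OF x, of ?W] by (simp add: inner_vec_def Nc_def)
  also have "\<dots> = (A a b x - A b a x) * (\<Sum>c. Nc c x * Nc c x) + Nc b x * (\<Sum>c. A a c x * Nc c x) - Nc a x * (\<Sum>c. A b c x * Nc c x)"
    by (simp add: W algebra_simps sum.distrib sum_subtractf sum_distrib_left)
  finally show ?thesis by (simp add: NN sum_A_N)
qed

text \<open>A tangent vector is determined by its action on the coordinates of \<open>X\<close>, where the commutator is known from \<open>delta_delta_X\<close>.\<close>

lemma commutator:
  assumes f: "smooth_on S f"
  shows "\<delta> a (\<delta> b f) x = \<delta> b (\<delta> a f) x + (\<Sum>c. (Nc b x * A a c x - Nc a x * A b c x) * \<delta> c f x)"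
proof -
  let ?W = "dirderiv (V a) (V b) x - dirderiv (V b) (V a) x"
  have W: "frechet_derivative X (at x) ?W $ c = Nc b x * A a c x - Nc a x * A b c x" for c
    using commutator_frechet[OF smooth_Xc, of a b c] A_sym[of a b] by (simp add: delta_delta_X frechet_Xc)
  have "?W = (\<Sum>c. (Nc b x * A a c x - Nc a x * A b c x) *\<^sub>R V c x)"
    using tangent_expansion[OF x, of ?W] by (simp only: W)
  then have "frechet_derivative f (at x) ?W = (\<Sum>c. (Nc b x * A a c x - Nc a x * A b c x) * \<delta> c f x)"
    by (simp add: linear_sum[OF delta_linear[OF f]] linear_cmul[OF delta_linear[OF f]] dirderiv_def)
  then show ?thesis using commutator_frechet[OF f, of a b] by simp
qed

lemma A2_sym: "A2 a b x = A2 b a x"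
  unfolding A2_def by (rule sum.cong[OF refl]) (metis A_sym mult.commute)

lemma sum_N_A2: "(\<Sum>a. Nc a x * A2 a b x) = 0" "(\<Sum>a. Nc a x * A2 b a x) = 0"
proof -
  have "(\<Sum>a. Nc a x * A2 a b x) = (\<Sum>c. \<Sum>a. Nc a x * (A a c x * A c b x))"
    unfolding A2_def sum_distrib_left by (rule sum.swap)
  also have "\<dots> = (\<Sum>c. (\<Sum>a. Nc a x * A a c x) * A c b x)"
    by (simp add: sum_distrib_right mult.assoc)
  finally show "(\<Sum>a. Nc a x * A2 a b x) = 0" by (simp add: sum_N_A)
  then show "(\<Sum>a. Nc a x * A2 b a x) = 0" by (simp add: A2_sym[of b])
qed

text \<open>The commutator applied to \<open>N b\<close>.  The terms with \<open>A2\<close> are the normal components that ordinary derivatives of the extended matrix have.\<close>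

lemma codazzi: "\<delta> c (A a b) x = \<delta> a (A c b) x + Nc a x * A2 c b x - Nc c x * A2 a b x"
proof -
  have dA: "\<delta> c (A a b) x = - \<delta> c (\<delta> a (Nc b)) x" for a b c
    unfolding A_fun[of a b] by (rule d_uminus[OF smooth_delta[OF smooth_Nc]])
  have "\<delta> c (A a b) x = \<delta> a (A c b) x - (\<Sum>d. (Nc a x * A c d x - Nc c x * A a d x) * \<delta> d (Nc b) x)"
    unfolding dA using commutator[OF smooth_Nc, of c a b] by simp
  also have "(\<Sum>d. (Nc a x * A c d x - Nc c x * A a d x) * \<delta> d (Nc b) x)
    = - Nc a x * A2 c b x + Nc c x * A2 a b x"
    by (simp add: delta_N A2_def sum_distrib_left sum_negf sum_subtractf algebra_simps flip: sum.distrib)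
  finally show ?thesis by simp
qed

end

definition H :: "real^'n \<Rightarrow> real" where "H x = (\<Sum>a. A a a x)"
definition sq :: "real^'n \<Rightarrow> real" where "sq x = (\<Sum>a. \<Sum>b. (A a b x)\<^sup>2)"
definition F3 :: "real^'n \<Rightarrow> real" where "F3 x = (\<Sum>a. \<Sum>b. \<Sum>c. A a b x * A b c x * A c a x)"
definition u :: "real^'n \<Rightarrow> real" where "u x = - (\<Sum>a. Xc a x * Nc a x)"
text \<open>\<open>T\<close> is the covariant derivative of the second fundamental form: removing the normal components of \<open>\<delta> c (A a b)\<close> makes it totally symmetric and annihilated by \<open>N\<close>.\<close>

definition T :: "'m \<Rightarrow> 'm \<Rightarrow> 'm \<Rightarrow> real^'n \<Rightarrow> real" where
  "T c a b x = \<delta> c (A a b) x - Nc a x * A2 c b x - Nc b x * A2 c a x"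
definition Lap :: "(real^'n \<Rightarrow> real) \<Rightarrow> real^'n \<Rightarrow> real" where "Lap f x = (\<Sum>c. \<delta> c (\<delta> c f) x)"
definition drift :: "(real^'n \<Rightarrow> real) \<Rightarrow> real^'n \<Rightarrow> real" where "drift f x = (\<Sum>c. Xc c x * \<delta> c f x)"
definition L :: "(real^'n \<Rightarrow> real) \<Rightarrow> real^'n \<Rightarrow> real" where "L f x = Lap f x - drift f x"

lemma smooth_sq: "smooth_on S sq" unfolding sq_def[abs_def] by (intro smooths)
lemma smooth_u: "smooth_on S u" unfolding u_def[abs_def] by (intro smooths)
lemma smooth_drift: "smooth_on S f \<Longrightarrow> smooth_on S (drift f)" unfolding drift_def[abs_def] by (intro smooths)
lemma smooth_Lap: "smooth_on S f \<Longrightarrow> smooth_on S (Lap f)" unfolding Lap_def[abs_def] by (intro smooths)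

context fixes x assumes x: "x \<in> S" begin

lemma delta_delta_mult:
  assumes "smooth_on S f" "smooth_on S g"
  shows "\<delta> a (\<delta> b (\<lambda>y. f y * g y)) x
    = \<delta> a (\<delta> b f) x * g x + \<delta> b f x * \<delta> a g x + \<delta> a f x * \<delta> b g x + f x * \<delta> a (\<delta> b g) x"
proof -
  have "\<delta> a (\<delta> b (\<lambda>y. f y * g y)) x = \<delta> a (\<lambda>y. \<delta> b f y * g y + f y * \<delta> b g y) x"
    by (rule d_cong[OF x]) (simp add: d_mult assms)
  then show ?thesis
    by (simp add: d_add[OF x] d_mult[OF x] smooths assms)
qed

lemma L_mult:
  assumes "smooth_on S f" "smooth_on S g"
  shows "L (\<lambda>y. f y * g y) x = L f x * g x + f x * L g x + 2 * (\<Sum>c. \<delta> c f x * \<delta> c g x)"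
  unfolding L_def Lap_def drift_def
  by (simp add: delta_delta_mult[OF assms] d_mult[OF x assms] sum.distrib sum_distrib_left sum_distrib_right
      sum_subtractf algebra_simps)

lemma L_sum:
  assumes "\<And>i. i \<in> I \<Longrightarrow> smooth_on S (f i)"
  shows "L (\<lambda>y. \<Sum>i\<in>I. f i y) x = (\<Sum>i\<in>I. L (f i) x)"
proof -
  have "\<delta> a (\<delta> a (\<lambda>y. \<Sum>i\<in>I. f i y)) x = \<delta> a (\<lambda>y. \<Sum>i\<in>I. \<delta> a (f i) y) x" for a
    by (rule d_cong[OF x]) (simp add: d_sum assms)
  then have dd: "\<delta> a (\<delta> a (\<lambda>y. \<Sum>i\<in>I. f i y)) x = (\<Sum>i\<in>I. \<delta> a (\<delta> a (f i)) x)" for a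
    by (simp add: d_sum[OF x] smooths assms)
  have "Lap (\<lambda>y. \<Sum>i\<in>I. f i y) x = (\<Sum>i\<in>I. Lap (f i) x)"
    unfolding Lap_def dd by (rule sum.swap)
  moreover have "drift (\<lambda>y. \<Sum>i\<in>I. f i y) x = (\<Sum>i\<in>I. drift (f i) x)"
    unfolding drift_def by (subst sum.swap) (simp add: d_sum[OF x] assms sum_distrib_left)
  ultimately show ?thesis by (simp add: L_def sum_subtractf)
qed

lemma L_cmult: assumes "smooth_on S f" shows "L (\<lambda>y. k * f y) x = k * L f x"
  using L_mult[OF smooth_on_const assms, of k] by (simp add: L_def Lap_def drift_def)

lemma L_uminus: assumes "smooth_on S f" shows "L (\<lambda>y. - f y) x = - L f x"
  using L_cmult[OF assms, of "-1"] by simp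

lemma L_diff: assumes "smooth_on S f" "smooth_on S g" shows "L (\<lambda>y. f y - g y) x = L f x - L g x"
  using L_sum[of "UNIV::bool set" "\<lambda>i. if i then f else (\<lambda>y. (-1) * g y)"] assms
  by (simp add: UNIV_bool smooths L_uminus)

lemma delta_u: "\<delta> b u x = (\<Sum>a. A b a x * Xc a x)"
proof -
  have "\<delta> b u x = - (\<Sum>a. (kd b a - Nc b x * Nc a x) * Nc a x + Xc a x * (- A b a x))"
    unfolding u_def[abs_def]
    by (simp add: d_uminus[OF x] d_sum[OF x] d_mult[OF x] smooths delta_X[OF x] delta_N[OF x])
  also have "\<dots> = - (\<Sum>a. kd b a * Nc a x) + Nc b x * (\<Sum>a. Nc a x * Nc a x) + (\<Sum>a. A b a x * Xc a x)"
    by (simp add: sum.distrib sum_subtractf sum_distrib_left sum_negf algebra_simps)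
  finally show ?thesis by (simp add: NN[OF x])
qed

text \<open>Differentiate \<open>sum_N_delta\<close>; the indices are in the order in which the sum is not simply zero.\<close>

lemma sum_N_delta2:
  assumes f: "smooth_on S f"
  shows "(\<Sum>c. Nc c x * \<delta> d (\<delta> c f) x) = (\<Sum>c. A d c x * \<delta> c f x)"
proof -
  have "\<delta> d (\<lambda>y. \<Sum>c. Nc c y * \<delta> c f y) x = \<delta> d (\<lambda>y. 0) x"
    by (rule d_cong[OF x]) (simp add: sum_N_delta f)
  then show ?thesis
    by (simp add: d_sum[OF x] d_mult[OF x] smooths f delta_N[OF x] sum.distrib sum_subtractf)
qed

lemma div_A: "(\<Sum>c. \<delta> c (A a c) x) = \<delta> a H x + sq x * Nc a x"
proof -
  have "(\<Sum>c. \<delta> c (A a c) x) = (\<Sum>c. \<delta> a (A c c) x) + Nc a x * (\<Sum>c. A2 c c x) - (\<Sum>c. Nc c x * A2 a c x)"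
    by (simp add: codazzi[OF x, of _ a] sum.distrib sum_subtractf sum_distrib_left)
  moreover have "(\<Sum>c. A2 c c x) = sq x"
    unfolding A2_def sq_def by (intro sum.cong refl) (metis A_sym[OF x] power2_eq_square)
  moreover have "\<delta> a H x = (\<Sum>c. \<delta> a (A c c) x)"
    unfolding H_def[abs_def] by (simp add: d_sum[OF x] smooths)
  ultimately show ?thesis by (simp add: sum_N_A2[OF x])
qed

lemma delta_A_cong: "\<delta> c (A a b) x = \<delta> c (A b a) x"
  by (rule d_cong[OF x]) (rule A_sym)

lemma Lap_N: "Lap (Nc a) x = - \<delta> a H x - sq x * Nc a x"
proof -
  have "\<delta> c (\<delta> c (Nc a)) x = - \<delta> c (A a c) x" for c
    unfolding delta_A_cong[of c a c] A_fun[of c a] by (simp add: d_uminus[OF x] smooths)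
  then show ?thesis using div_A[of a] by (simp add: Lap_def sum_negf)
qed

lemma Lap_X: "Lap (Xc a) x = H x * Nc a x"
  by (simp add: Lap_def delta_delta_X[OF x] H_def sum.distrib sum_distrib_right sum_N_A[OF x])

lemma drift_X: "drift (Xc a) x = Xc a x + u x * Nc a x"
  by (simp add: drift_def delta_X[OF x] right_diff_distrib sum_subtractf u_def sum_distrib_right sum_negf mult.assoc)

text \<open>Commute \<open>\<delta> a\<close> outwards past both derivatives of the Laplacian.  The terms proportional to \<open>Nc a x\<close> are grouped because they disappear when the formula is contracted with \<open>A\<close>.\<close>

lemma Lap_delta:
  assumes f: "smooth_on S f"
  shows "Lap (\<delta> a f) x = \<delta> a (Lap f) x + H x * (\<Sum>d. A a d x * \<delta> d f x) - 2 * (\<Sum>d. A2 a d x * \<delta> d f x)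
    + Nc a x * (2 * (\<Sum>c. \<Sum>d. A c d x * \<delta> c (\<delta> d f) x) + (\<Sum>d. \<delta> d H x * \<delta> d f x))"
proof -
  let ?g = "\<lambda>c d y. Nc a y * A c d y - Nc c y * A a d y"
  have 1: "\<delta> c (\<delta> c (\<delta> a f)) x = \<delta> a (\<delta> c (\<delta> c f)) x + (\<Sum>d. ?g c d x * \<delta> d (\<delta> c f) x)
      + (\<Sum>d. \<delta> c (?g c d) x * \<delta> d f x + ?g c d x * \<delta> c (\<delta> d f) x)" for c
  proof -
    have "\<delta> c (\<delta> c (\<delta> a f)) x = \<delta> c (\<lambda>y. \<delta> a (\<delta> c f) y + (\<Sum>d. ?g c d y * \<delta> d f y)) x"
      by (rule d_cong[OF x]) (rule commutator[OF _ f])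
    also have "\<dots> = \<delta> c (\<delta> a (\<delta> c f)) x + (\<Sum>d. \<delta> c (?g c d) x * \<delta> d f x + ?g c d x * \<delta> c (\<delta> d f) x)"
      by (simp add: d_add[OF x] d_sum[OF x] d_mult[OF x] smooths f)
    also have "\<delta> c (\<delta> a (\<delta> c f)) x = \<delta> a (\<delta> c (\<delta> c f)) x + (\<Sum>d. ?g c d x * \<delta> d (\<delta> c f) x)"
      by (rule commutator[OF x smooth_delta[OF f]])
    finally show ?thesis .
  qed
  have dL: "\<delta> a (Lap f) x = (\<Sum>c. \<delta> a (\<delta> c (\<delta> c f)) x)"
    unfolding Lap_def[abs_def] by (simp add: d_sum[OF x] smooths f)
  have 2: "(\<Sum>c. \<Sum>d. ?g c d x * \<delta> d (\<delta> c f) x)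
     = Nc a x * (\<Sum>c. \<Sum>d. A c d x * \<delta> c (\<delta> d f) x) - (\<Sum>d. A2 a d x * \<delta> d f x)"
  proof -
    have "(\<Sum>c. \<Sum>d. ?g c d x * \<delta> d (\<delta> c f) x)
      = Nc a x * (\<Sum>c. \<Sum>d. A c d x * \<delta> d (\<delta> c f) x) - (\<Sum>c. \<Sum>d. Nc c x * A a d x * \<delta> d (\<delta> c f) x)"
      by (simp add: left_diff_distrib sum_subtractf sum_distrib_left mult.assoc)
    also have "(\<Sum>c. \<Sum>d. A c d x * \<delta> d (\<delta> c f) x) = (\<Sum>d. \<Sum>c. A d c x * \<delta> d (\<delta> c f) x)"
      by (subst sum.swap) (simp add: A_sym[OF x])
    also have "(\<Sum>c. \<Sum>d. Nc c x * A a d x * \<delta> d (\<delta> c f) x) = (\<Sum>d. A a d x * (\<Sum>c. Nc c x * \<delta> d (\<delta> c f) x))"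
      by (subst sum.swap) (simp add: sum_distrib_left algebra_simps)
    also have "\<dots> = (\<Sum>d. \<Sum>c. A a d x * A d c x * \<delta> c f x)"
      by (simp add: sum_N_delta2[OF f] sum_distrib_left mult.assoc)
    also have "\<dots> = (\<Sum>c. A2 a c x * \<delta> c f x)"
      by (subst sum.swap) (simp add: A2_def sum_distrib_right)
    finally show ?thesis .
  qed
  have dg: "\<delta> c (?g c d) x = - A c a x * A c d x + Nc a x * \<delta> c (A c d) x + A c c x * A a d x - Nc c x * \<delta> c (A a d) x" for c d
    by (simp add: d_diff[OF x] d_mult[OF x] smooths delta_N[OF x])
  have sdg: "(\<Sum>c. \<delta> c (?g c d) x) = - A2 a d x + Nc a x * (\<delta> d H x + sq x * Nc d x) + H x * A a d x" for d
  proof -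
    have "(\<Sum>c. \<delta> c (?g c d) x) = - (\<Sum>c. A c a x * A c d x) + Nc a x * (\<Sum>c. \<delta> c (A c d) x)
       + H x * A a d x - (\<Sum>c. Nc c x * \<delta> c (A a d) x)"
      by (simp add: dg sum.distrib sum_subtractf sum_negf sum_distrib_left sum_distrib_right H_def)
    also have "(\<Sum>c. A c a x * A c d x) = A2 a d x" by (simp add: A2_def A_sym[OF x, of _ a])
    also have "(\<Sum>c. \<delta> c (A c d) x) = \<delta> d H x + sq x * Nc d x"
      using div_A[of d] by (simp add: delta_A_cong[of _ _ d])
    also have "(\<Sum>c. Nc c x * \<delta> c (A a d) x) = 0" by (rule sum_N_delta[OF x smooth_A])
    finally show ?thesis by simp
  qed
  have 3: "(\<Sum>c. \<Sum>d. \<delta> c (?g c d) x * \<delta> d f x)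
     = - (\<Sum>d. A2 a d x * \<delta> d f x) + Nc a x * (\<Sum>d. \<delta> d H x * \<delta> d f x) + H x * (\<Sum>d. A a d x * \<delta> d f x)"
  proof -
    have "(\<Sum>c. \<Sum>d. \<delta> c (?g c d) x * \<delta> d f x) = (\<Sum>d. (\<Sum>c. \<delta> c (?g c d) x) * \<delta> d f x)"
      by (subst sum.swap) (simp add: sum_distrib_right)
    also have "\<dots> = - (\<Sum>d. A2 a d x * \<delta> d f x) + Nc a x * (\<Sum>d. \<delta> d H x * \<delta> d f x)
       + Nc a x * sq x * (\<Sum>d. Nc d x * \<delta> d f x) + H x * (\<Sum>d. A a d x * \<delta> d f x)"
      unfolding sdg by (simp add: sum.distrib sum_negf sum_subtractf sum_distrib_left algebra_simps)
    finally show ?thesis by (simp add: sum_N_delta[OF x f])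
  qed
  have 4: "(\<Sum>c. \<Sum>d. ?g c d x * \<delta> c (\<delta> d f) x) = Nc a x * (\<Sum>c. \<Sum>d. A c d x * \<delta> c (\<delta> d f) x)"
  proof -
    have "(\<Sum>c. \<Sum>d. ?g c d x * \<delta> c (\<delta> d f) x) = Nc a x * (\<Sum>c. \<Sum>d. A c d x * \<delta> c (\<delta> d f) x)
       - (\<Sum>c. \<Sum>d. Nc c x * A a d x * \<delta> c (\<delta> d f) x)"
      by (simp add: left_diff_distrib sum_subtractf sum_distrib_left mult.assoc)
    also have "(\<Sum>c. \<Sum>d. Nc c x * A a d x * \<delta> c (\<delta> d f) x) = (\<Sum>d. A a d x * (\<Sum>c. Nc c x * \<delta> c (\<delta> d f) x))"
      by (subst sum.swap) (simp add: sum_distrib_left algebra_simps)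
    also have "\<dots> = 0" by (simp add: sum_N_delta[OF x smooth_delta[OF f]])
    finally show ?thesis by simp
  qed
  have "Lap (\<delta> a f) x = \<delta> a (Lap f) x + (\<Sum>c. \<Sum>d. ?g c d x * \<delta> d (\<delta> c f) x)
     + ((\<Sum>c. \<Sum>d. \<delta> c (?g c d) x * \<delta> d f x) + (\<Sum>c. \<Sum>d. ?g c d x * \<delta> c (\<delta> d f) x))"
    unfolding dL unfolding Lap_def 1 by (simp only: sum.distrib)
  also have "\<dots> = \<delta> a (Lap f) x + H x * (\<Sum>d. A a d x * \<delta> d f x) - 2 * (\<Sum>d. A2 a d x * \<delta> d f x)
    + Nc a x * (2 * (\<Sum>c. \<Sum>d. A c d x * \<delta> c (\<delta> d f) x) + (\<Sum>d. \<delta> d H x * \<delta> d f x))"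
    unfolding 2 3 4 by (simp add: algebra_simps)
  finally show ?thesis .
qed

lemma drift_delta:
  assumes f: "smooth_on S f"
  shows "drift (\<delta> a f) x = \<delta> a (drift f) x - \<delta> a f x + u x * (\<Sum>d. A a d x * \<delta> d f x)
    + Nc a x * (\<Sum>d. \<delta> d u x * \<delta> d f x)"
proof -
  have "drift (\<delta> a f) x = (\<Sum>c. Xc c x * \<delta> a (\<delta> c f) x)
      + (\<Sum>c. Xc c x * (\<Sum>d. (Nc a x * A c d x - Nc c x * A a d x) * \<delta> d f x))"
    unfolding drift_def commutator[OF x f, of _ a] by (simp add: distrib_left sum.distrib)
  also have "(\<Sum>c. Xc c x * (\<Sum>d. (Nc a x * A c d x - Nc c x * A a d x) * \<delta> d f x))
     = Nc a x * (\<Sum>c. \<Sum>d. A c d x * Xc c x * \<delta> d f x) - (\<Sum>c. \<Sum>d. (Xc c x * Nc c x) * (A a d x * \<delta> d f x))"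
    by (simp add: sum_distrib_left sum_subtractf algebra_simps)
  also have "(\<Sum>c. \<Sum>d. A c d x * Xc c x * \<delta> d f x) = (\<Sum>d. \<delta> d u x * \<delta> d f x)"
    by (subst sum.swap) (simp add: delta_u sum_distrib_right A_sym[OF x])
  also have "(\<Sum>c. \<Sum>d. (Xc c x * Nc c x) * (A a d x * \<delta> d f x)) = - u x * (\<Sum>d. A a d x * \<delta> d f x)"
    by (simp add: u_def sum_product)
  finally have 1: "drift (\<delta> a f) x = (\<Sum>c. Xc c x * \<delta> a (\<delta> c f) x)
     + Nc a x * (\<Sum>d. \<delta> d u x * \<delta> d f x) + u x * (\<Sum>d. A a d x * \<delta> d f x)" by simp
  have "\<delta> a (drift f) x = (\<Sum>c. (kd a c - Nc a x * Nc c x) * \<delta> c f x + Xc c x * \<delta> a (\<delta> c f) x)"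
    unfolding drift_def[abs_def] by (simp add: d_sum[OF x] d_mult[OF x] smooths f delta_X[OF x])
  also have "\<dots> = (\<Sum>c. kd a c * \<delta> c f x) - Nc a x * (\<Sum>c. Nc c x * \<delta> c f x) + (\<Sum>c. Xc c x * \<delta> a (\<delta> c f) x)"
    by (simp only: left_diff_distrib sum.distrib sum_subtractf sum_distrib_left mult.assoc)
  finally have 2: "\<delta> a (drift f) x = \<delta> a f x + (\<Sum>c. Xc c x * \<delta> a (\<delta> c f) x)"
    by (simp add: sum_N_delta[OF x f])
  show ?thesis using 1 2 by simp
qed

lemma T_symmetric: "T c a b x = T a c b x" "T c a b x = T c b a x"
  using codazzi[OF x, of c a b] A2_sym[OF x, of a c] delta_A_cong[of c a b]
  by (simp_all add: T_def)

lemma delta_A_N: "(\<Sum>a. Nc a x * \<delta> c (A a b) x) = A2 c b x"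
proof -
  have "\<delta> c (\<lambda>y. \<Sum>a. Nc a y * A a b y) x = \<delta> c (\<lambda>y. 0) x"
    by (rule d_cong[OF x]) (rule sum_N_A)
  then show ?thesis
    by (simp add: d_sum[OF x] d_mult[OF x] smooths delta_N[OF x] sum.distrib sum_subtractf A2_def)
qed

lemma sum_N_T: "(\<Sum>a. Nc a x * T c a b x) = 0"
proof -
  have "(\<Sum>a. Nc a x * T c a b x) = (\<Sum>a. Nc a x * \<delta> c (A a b) x) - (\<Sum>a. Nc a x * Nc a x) * A2 c b x
     - Nc b x * (\<Sum>a. Nc a x * A2 c a x)"
    by (simp add: T_def sum_subtractf sum.distrib sum_distrib_left sum_distrib_right algebra_simps)
  then show ?thesis by (simp add: delta_A_N NN[OF x] sum_N_A2[OF x])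
qed

text \<open>The normal components of \<open>\<delta> c (A a b)\<close> are orthogonal to \<open>T\<close> and to each other, so the squares add up.\<close>

lemma sum_sq_delta_A:
  "(\<Sum>c. \<Sum>a. \<Sum>b. (\<delta> c (A a b) x)\<^sup>2)
    = (\<Sum>c. \<Sum>a. \<Sum>b. (T c a b x)\<^sup>2) + 2 * (\<Sum>a. \<Sum>b. (A2 a b x)\<^sup>2)"
proof -
  have "(\<Sum>a. \<Sum>b. (\<delta> c (A a b) x)\<^sup>2)
     = (\<Sum>a. \<Sum>b. (T c a b x)\<^sup>2) + 2 * (\<Sum>b. (A2 c b x)\<^sup>2)" for c
  proof -
    have "(\<delta> c (A a b) x)\<^sup>2 = (T c a b x)\<^sup>2 + (Nc a x * Nc a x) * (A2 c b x)\<^sup>2 + (Nc b x * Nc b x) * (A2 c a x)\<^sup>2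
       + 2 * A2 c b x * (Nc a x * T c a b x) + 2 * A2 c a x * (Nc b x * T c b a x) + 2 * (Nc a x * A2 c a x) * (Nc b x * A2 c b x)" for a b
      using T_symmetric(2)[of c a b] by (simp add: T_def power2_eq_square algebra_simps)
    then have "(\<Sum>a. \<Sum>b. (\<delta> c (A a b) x)\<^sup>2) = (\<Sum>a. \<Sum>b. (T c a b x)\<^sup>2)
       + (\<Sum>a. \<Sum>b. (Nc a x * Nc a x) * (A2 c b x)\<^sup>2) + (\<Sum>a. \<Sum>b. (Nc b x * Nc b x) * (A2 c a x)\<^sup>2)
       + (\<Sum>a. \<Sum>b. 2 * A2 c b x * (Nc a x * T c a b x)) + (\<Sum>a. \<Sum>b. 2 * A2 c a x * (Nc b x * T c b a x))
       + (\<Sum>a. \<Sum>b. 2 * (Nc a x * A2 c a x) * (Nc b x * A2 c b x))"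
      by (simp only: sum.distrib)
    also have "(\<Sum>a. \<Sum>b. (Nc a x * Nc a x) * (A2 c b x)\<^sup>2) = (\<Sum>b. (A2 c b x)\<^sup>2)"
      by (subst sum_product[symmetric]) (simp add: NN[OF x])
    also have "(\<Sum>a. \<Sum>b. (Nc b x * Nc b x) * (A2 c a x)\<^sup>2) = (\<Sum>b. (A2 c b x)\<^sup>2)"
      by (simp add: NN[OF x] flip: sum_distrib_right)
    also have "(\<Sum>a. \<Sum>b. 2 * A2 c b x * (Nc a x * T c a b x)) = 0"
      by (subst sum.swap) (simp add: sum_N_T flip: sum_distrib_left)
    also have "(\<Sum>a. \<Sum>b. 2 * A2 c a x * (Nc b x * T c b a x)) = 0"
      by (simp add: sum_N_T flip: sum_distrib_left)
    also have "(\<Sum>a. \<Sum>b. 2 * (Nc a x * A2 c a x) * (Nc b x * A2 c b x)) = 0"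
      by (simp add: sum_N_A2[OF x] flip: sum_distrib_left)
    finally show ?thesis by simp
  qed
  then show ?thesis by (simp add: sum.distrib sum_distrib_left)
qed

lemma delta_sq: "\<delta> c sq x = 2 * (\<Sum>a. \<Sum>b. A a b x * T c a b x)"
proof -
  have "\<delta> c sq x = 2 * (\<Sum>a. \<Sum>b. A a b x * \<delta> c (A a b) x)"
    unfolding sq_def[abs_def] power2_eq_square
    by (simp add: d_sum[OF x] d_mult[OF x] smooths sum_distrib_left algebra_simps)
  also have "(\<Sum>a. \<Sum>b. A a b x * \<delta> c (A a b) x) = (\<Sum>a. \<Sum>b. A a b x * T c a b x)
     + (\<Sum>a. \<Sum>b. A2 c b x * (Nc a x * A a b x)) + (\<Sum>a. \<Sum>b. A2 c a x * (A a b x * Nc b x))"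
    by (simp add: T_def sum.distrib[symmetric] algebra_simps)
  also have "(\<Sum>a. \<Sum>b. A2 c b x * (Nc a x * A a b x)) = 0"
    by (subst sum.swap) (simp add: sum_N_A[OF x] flip: sum_distrib_left)
  also have "(\<Sum>a. \<Sum>b. A2 c a x * (A a b x * Nc b x)) = 0"
    by (simp add: sum_A_N[OF x] flip: sum_distrib_left)
  finally show ?thesis by simp
qed

lemma sum_T_trace: "(\<Sum>a. T c a a x) = \<delta> c H x"
proof -
  have "\<delta> c H x = (\<Sum>a. \<delta> c (A a a) x)"
    unfolding H_def[abs_def] by (simp add: d_sum[OF x] smooths)
  then show ?thesis by (simp add: T_def sum_subtractf sum_N_A2[OF x] flip: sum_distrib_left)
qed

end

end

section \<open>Hypersurfaces with constant X.N + H\<close>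

text \<open>Testing the form on combinations of two basis vectors gives \<open>(B i j)^2 \<le> B i i * B j j\<close>; sum over \<open>i\<close> and \<open>j\<close>.\<close>

lemma psd_sum_squares_le_trace:
  fixes B :: "'i::finite \<Rightarrow> 'i \<Rightarrow> real"
  assumes sym: "\<And>a b. B a b = B b a" and psd: "\<And>v. (\<Sum>a. \<Sum>b. v a * v b * B a b) \<ge> 0"
  shows "(\<Sum>a. \<Sum>b. (B a b)\<^sup>2) \<le> (\<Sum>a. B a a)\<^sup>2" "(\<Sum>a. B a a) \<ge> 0"
proof -
  have q: "s\<^sup>2 * B i i + 2 * s * t * B i j + t\<^sup>2 * B j j \<ge> 0" for s t i j
  proof -
    have e: "(\<Sum>b. (s * kd i b + t * kd j b) * g b) = s * g i + t * g j" for g :: "'i \<Rightarrow> real"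
    proof -
      have "(\<Sum>b. (s * kd i b + t * kd j b) * g b) = s * (\<Sum>b. kd i b * g b) + t * (\<Sum>b. kd j b * g b)"
        by (simp only: distrib_right sum.distrib sum_distrib_left mult.assoc)
      then show ?thesis by (simp only: sum_kd)
    qed
    have "(\<Sum>a. \<Sum>b. (s * kd i a + t * kd j a) * (s * kd i b + t * kd j b) * B a b)
       = (\<Sum>a. (s * kd i a + t * kd j a) * (\<Sum>b. (s * kd i b + t * kd j b) * B a b))"
      by (simp only: sum_distrib_left mult.assoc)
    also have "\<dots> = s * (s * B i i + t * B i j) + t * (s * B j i + t * B j j)" by (simp only: e)
    finally show ?thesis using psd[of "\<lambda>a. s * kd i a + t * kd j a"] sym[of j i]
      by (simp add: power2_eq_square algebra_simps)
  qed
  have d: "B i i \<ge> 0" for i using q[of 1 i 0 i] by simp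
  have "(B i j)\<^sup>2 \<le> B i i * B j j" for i j
  proof (cases "B i i = 0")
    case True
    have "B i j = 0"
    proof (rule ccontr)
      assume n: "B i j \<noteq> 0"
      have "2 * (- (B j j + 1) / (2 * B i j)) * B i j + B j j \<ge> 0"
        using q[of "- (B j j + 1) / (2 * B i j)" i 1 j] True by simp
      then show False using n by (simp add: field_simps)
    qed
    then show ?thesis using True by simp
  next
    case False
    have "(B i j)\<^sup>2 * B i i - 2 * B i j * B i i * B i j + (B i i)\<^sup>2 * B j j \<ge> 0"
      using q[of "B i j" i "- B i i" j] by (simp add: mult.assoc)
    then have "B i i * (B i i * B j j - (B i j)\<^sup>2) \<ge> 0" by (simp add: power2_eq_square algebra_simps)
    then show ?thesis using d[of i] False by (simp add: zero_le_mult_iff)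
  qed
  then have "(\<Sum>a. \<Sum>b. (B a b)\<^sup>2) \<le> (\<Sum>a. \<Sum>b. B a a * B b b)"
    by (intro sum_mono)
  also have "\<dots> = (\<Sum>a. B a a)\<^sup>2" by (simp add: power2_eq_square sum_product)
  finally show "(\<Sum>a. \<Sum>b. (B a b)\<^sup>2) \<le> (\<Sum>a. B a a)\<^sup>2" .
  show "(\<Sum>a. B a a) \<ge> 0" using d by (simp add: sum_nonneg)
qed

context hypersurface_patch begin

lemma L_delta:
  assumes x: "x \<in> S" and f: "smooth_on S f"
  shows "L (\<delta> a f) x = \<delta> a (L f) x + \<delta> a f x + (H x - u x) * (\<Sum>d. A a d x * \<delta> d f x) - 2 * (\<Sum>d. A2 a d x * \<delta> d f x)
    + Nc a x * (2 * (\<Sum>c. \<Sum>d. A c d x * \<delta> c (\<delta> d f) x) + (\<Sum>d. \<delta> d H x * \<delta> d f x)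
        - (\<Sum>d. \<delta> d u x * \<delta> d f x))"
proof -
  have "\<delta> a (L f) x = \<delta> a (Lap f) x - \<delta> a (drift f) x"
    unfolding L_def[abs_def] by (simp add: d_diff[OF x] smooth_Lap smooth_drift f)
  then show ?thesis
    unfolding L_def[of "\<delta> a f"] Lap_delta[OF x f] drift_delta[OF x f] by (simp add: algebra_simps)
qed

lemma F3_eq: assumes x: "x \<in> S" shows "F3 x = (\<Sum>a. \<Sum>b. A a b x * A2 a b x)"
  unfolding F3_def A2_def sum_distrib_left
  by (intro sum.cong refl) (simp add: A_sym[OF x, of _ "_"] mult.commute mult.left_commute A_sym[OF x])

lemma L_sq:
  assumes x: "x \<in> S"
  shows "L sq x = 2 * (\<Sum>a. \<Sum>b. A a b x * L (A a b) x)
     + 2 * (\<Sum>c. \<Sum>a. \<Sum>b. (\<delta> c (A a b) x)\<^sup>2)"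
proof -
  have "L sq x = (\<Sum>a. \<Sum>b. 2 * (A a b x * L (A a b) x) + 2 * (\<Sum>c. (\<delta> c (A a b) x)\<^sup>2))"
    unfolding sq_def[abs_def] power2_eq_square
    by (simp add: L_sum[OF x] L_mult[OF x] smooths algebra_simps)
  also have "\<dots> = 2 * (\<Sum>a. \<Sum>b. A a b x * L (A a b) x) + 2 * (\<Sum>a. \<Sum>b. \<Sum>c. (\<delta> c (A a b) x)\<^sup>2)"
    by (simp add: sum.distrib sum_distrib_left)
  also have "(\<Sum>a. \<Sum>b. \<Sum>c. (\<delta> c (A a b) x)\<^sup>2) = (\<Sum>a. \<Sum>c. \<Sum>b. (\<delta> c (A a b) x)\<^sup>2)"
    by (rule sum.cong[OF refl], rule sum.swap)
  also have "\<dots> = (\<Sum>c. \<Sum>a. \<Sum>b. (\<delta> c (A a b) x)\<^sup>2)"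
    by (rule sum.swap)
  finally show ?thesis .
qed

end

locale lambda_patch = hypersurface_patch S X N
  for S :: "(real^'n::finite) set" and X N :: "real^'n \<Rightarrow> real^'m::finite" +
  fixes lam :: real
  assumes lambda_eq: "\<And>x. x \<in> S \<Longrightarrow> H x = u x + lam"
begin

context fixes x assumes x: "x \<in> S" begin

lemma delta_H: "\<delta> a H x = \<delta> a u x"
proof -
  have "\<delta> a H x = \<delta> a (\<lambda>y. u y + lam) x" by (rule d_cong[OF x]) (rule lambda_eq)
  then show ?thesis by (simp add: d_add[OF x] smooth_u)
qed

text \<open>Here the gradients cancel: by constancy of \<open>H - u\<close> the gradient of \<open>H\<close> is that of \<open>u\<close>, which up to sign is also the drift term.\<close>

lemma L_N: "L (Nc a) x = - sq x * Nc a x"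
proof -
  have "drift (Nc a) x = - \<delta> a u x"
    by (simp add: drift_def delta_N[OF x] delta_u[OF x] sum_negf A_sym[OF x, of a] mult.commute)
  then show ?thesis by (simp add: L_def Lap_N[OF x] delta_H)
qed

lemma L_X: "L (Xc a) x = lam * Nc a x - Xc a x"
  by (simp add: L_def Lap_X[OF x] drift_X[OF x] lambda_eq[OF x] algebra_simps)

lemma L_u: "L u x = (1 - sq x) * u x + lam"
proof -
  have XN: "(\<Sum>a. Xc a x * Nc a x) = - u x" by (simp add: u_def)
  have "L u x = - (\<Sum>a. L (\<lambda>y. Xc a y * Nc a y) x)"
    unfolding u_def[abs_def] by (simp add: L_uminus[OF x] L_sum[OF x] smooths)
  also have "(\<Sum>a. L (\<lambda>y. Xc a y * Nc a y) x)
    = (\<Sum>a. lam * (Nc a x * Nc a x) - Xc a x * Nc a x - sq x * (Xc a x * Nc a x) + 2 * (\<Sum>c. \<delta> c (Xc a) x * \<delta> c (Nc a) x))"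
    by (simp add: L_mult[OF x] smooths L_N L_X algebra_simps)
  also have "\<dots> = lam + u x + sq x * u x + 2 * (\<Sum>a. \<Sum>c. \<delta> c (Xc a) x * \<delta> c (Nc a) x)"
    by (simp add: sum.distrib sum_subtractf NN[OF x] XN flip: sum_distrib_left)
  also have "(\<Sum>a. \<Sum>c. \<delta> c (Xc a) x * \<delta> c (Nc a) x)
     = - (\<Sum>a. \<Sum>c. kd c a * A c a x) + (\<Sum>a. \<Sum>c. Nc a x * (Nc c x * A c a x))"
    by (simp only: delta_X[OF x] delta_N[OF x] left_diff_distrib mult_minus_right sum_subtractf sum_negf mult.assoc
        minus_diff_eq sum.distrib mult.left_commute)
  also have "\<dots> = - H x"
    by (simp add: H_def sum_N_A[OF x] flip: sum_distrib_left)
  finally show ?thesis by (simp add: lambda_eq[OF x] algebra_simps)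
qed

text \<open>Apply \<open>L_delta\<close> to the coordinates of \<open>N\<close>, using \<open>L N = - sq N\<close>.  All terms with a factor \<open>N a\<close> or \<open>N b\<close> vanish after contraction.\<close>

lemma sum_A_L_A: "(\<Sum>a. \<Sum>b. A a b x * L (A a b) x)
   = (1 - sq x) * sq x + lam * F3 x - 2 * (\<Sum>a. \<Sum>b. (A2 a b x)\<^sup>2)"
proof -
  define r where "r b = 2 * (\<Sum>c. \<Sum>d. A c d x * \<delta> c (\<delta> d (Nc b)) x) + (\<Sum>d. \<delta> d H x * \<delta> d (Nc b) x)
        - (\<Sum>d. \<delta> d u x * \<delta> d (Nc b) x)" for b
  have LA: "L (A a b) x = \<delta> a sq x * Nc b x - sq x * A a b x + A a b x + lam * A2 a b x
      - 2 * (\<Sum>d. A2 a d x * A d b x) - Nc a x * r b" for a b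
  proof -
    have "\<delta> a (L (Nc b)) x = \<delta> a (\<lambda>y. (- 1) * (sq y * Nc b y)) x"
      by (rule d_cong[OF x]) (use lambda_patch.L_N[OF lambda_patch_axioms] in simp)
    also have "\<dots> = - (\<delta> a sq x * Nc b x - sq x * A a b x)"
      by (simp only: d_cmult[OF x] d_mult[OF x] smooths smooth_sq delta_N[OF x])
        (simp add: algebra_simps)
    finally have 1: "\<delta> a (L (Nc b)) x = - (\<delta> a sq x * Nc b x - sq x * A a b x)" .
    have "L (A a b) x = - L (\<delta> a (Nc b)) x"
      unfolding A_fun[of a b] by (rule L_uminus[OF x smooth_delta[OF smooth_Nc]])
    then show ?thesis
      unfolding L_delta[OF x smooth_Nc] 1 r_def[symmetric] lambda_eq[OF x]
      by (simp add: delta_N[OF x] A2_def sum_negf algebra_simps)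
  qed
  have "(\<Sum>a. \<Sum>b. A a b x * L (A a b) x)
     = (\<Sum>a. \<Sum>b. \<delta> a sq x * (A a b x * Nc b x)) + (1 - sq x) * (\<Sum>a. \<Sum>b. (A a b x)\<^sup>2)
       + lam * (\<Sum>a. \<Sum>b. A a b x * A2 a b x)
       - 2 * (\<Sum>a. \<Sum>b. A a b x * (\<Sum>d. A2 a d x * A d b x))
       - (\<Sum>a. \<Sum>b. r b * (Nc a x * A a b x))"
    unfolding LA sum_distrib_left
    by (simp add: sum.distrib[symmetric] sum_subtractf[symmetric] power2_eq_square algebra_simps sum_distrib_left)
  also have "(\<Sum>a. \<Sum>b. \<delta> a sq x * (A a b x * Nc b x)) = 0"
    by (simp add: sum_A_N[OF x] flip: sum_distrib_left)
  also have "(\<Sum>a. \<Sum>b. r b * (Nc a x * A a b x)) = 0"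
    by (subst sum.swap) (simp add: sum_N_A[OF x] flip: sum_distrib_left)
  also have "(\<Sum>a. \<Sum>b. A a b x * (\<Sum>d. A2 a d x * A d b x)) = (\<Sum>a. \<Sum>b. (A2 a b x)\<^sup>2)"
  proof (rule sum.cong[OF refl])
    fix a
    have "(\<Sum>b. A a b x * (\<Sum>d. A2 a d x * A d b x)) = (\<Sum>d. \<Sum>b. A2 a d x * (A a b x * A d b x))"
      unfolding sum_distrib_left by (subst sum.swap) (simp add: algebra_simps)
    also have "\<dots> = (\<Sum>d. A2 a d x * A2 a d x)"
      by (simp add: A2_def A_sym[OF x, of _ "_"] sum_distrib_left)
    finally show "(\<Sum>b. A a b x * (\<Sum>d. A2 a d x * A d b x)) = (\<Sum>b. (A2 a b x)\<^sup>2)"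
      by (simp add: power2_eq_square)
  qed
  finally show ?thesis by (simp add: F3_eq[OF x] sq_def)
qed

text \<open>The quartic term of \<open>sum_A_L_A\<close> cancels against the normal part of the squared derivative of \<open>A\<close> in \<open>sum_sq_delta_A\<close>.\<close>

lemma simons: "L sq x = 2 * (\<Sum>c. \<Sum>a. \<Sum>b. (T c a b x)\<^sup>2) + 2 * (1 - sq x) * sq x + 2 * lam * F3 x"
  unfolding L_sq[OF x] sum_A_L_A sum_sq_delta_A[OF x] by (simp add: algebra_simps)

lemma kato_square:
  "(\<Sum>c. \<Sum>a. \<Sum>b. (u x * T c a b x - \<delta> c u x * A a b x)\<^sup>2)
   = (u x)\<^sup>2 * (\<Sum>c. \<Sum>a. \<Sum>b. (T c a b x)\<^sup>2) - u x * (\<Sum>c. \<delta> c u x * \<delta> c sq x) + (\<Sum>c. (\<delta> c u x)\<^sup>2) * sq x"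
proof -
  have "(\<Sum>a. \<Sum>b. (u x * T c a b x - \<delta> c u x * A a b x)\<^sup>2)
    = (u x)\<^sup>2 * (\<Sum>a. \<Sum>b. (T c a b x)\<^sup>2) - u x * (\<delta> c u x * \<delta> c sq x) + (\<delta> c u x)\<^sup>2 * sq x" for c
    unfolding delta_sq[OF x] sq_def sum_distrib_left sum.distrib[symmetric] sum_subtractf[symmetric]
    by (intro sum.cong refl) (simp add: power2_eq_square algebra_simps)
  then show ?thesis by (simp add: sum.distrib sum_subtractf sum_distrib_left sum_distrib_right)
qed

end

text \<open>Inserting the equations for \<open>u\<close> and \<open>sq\<close> and completing the square by \<open>kato_square\<close>, the left-hand side becomes \<open>2 (1 - sq - G / u^2) w + 2 lam (K u - F3)\<close> with \<open>G\<close> the squared gradient of \<open>u\<close> and \<open>w = K u^2 - sq\<close>.  The hypothesis enters through \<open>lam (K u - F3) = lam w / u - lam (F3 u - sq) / u\<close>.  Working with \<open>w\<close> instead of the quotient \<open>sq / u^2\<close> avoids differentiating quotients; the drift \<open>- (2/u) grad u\<close> is the one that the quotient would produce.\<close>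

theorem pinching_inequality:
  assumes x: "x \<in> S" and u: "u x > 0" and K: "K * (u x)\<^sup>2 \<ge> sq x"
    and hyp: "lam * (F3 x * u x - sq x) \<ge> 0"
  shows "sumsq_op V (\<lambda>c y. - Xc c y - 2 / u y * \<delta> c u y) (\<lambda>y. K * (u y)\<^sup>2 - sq y) x
     + 2 / (u x)\<^sup>2 * (\<Sum>c. \<Sum>a. \<Sum>b. (u x * T c a b x - \<delta> c u x * A a b x)\<^sup>2)
    \<le> (2 + 2 * \<bar>lam\<bar> / u x) * (K * (u x)\<^sup>2 - sq x)"
proof -
  define w where "w y = K * (u y)\<^sup>2 - sq y" for y
  define G where "G = (\<Sum>c. (\<delta> c u x)\<^sup>2)"
  define D where "D = (\<Sum>c. \<delta> c u x * \<delta> c sq x)"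
  define t where "t = (\<Sum>c. \<Sum>a. \<Sum>b. (T c a b x)\<^sup>2)"
  define E where "E = (\<Sum>c. \<Sum>a. \<Sum>b. (u x * T c a b x - \<delta> c u x * A a b x)\<^sup>2)"
  define U where "U = u x"
  have E: "E = U\<^sup>2 * t - U * D + G * sq x"
    using kato_square[OF x] by (simp add: E_def t_def D_def G_def U_def)
  have U: "U > 0" using u by (simp add: U_def)
  have Lw: "L w x = 2 * K * (U * ((1 - sq x) * U + lam) + G) - (2 * t + 2 * (1 - sq x) * sq x + 2 * lam * F3 x)"
  proof -
    have "L w x = K * L (\<lambda>y. u y * u y) x - L sq x"
      unfolding w_def[abs_def] power2_eq_square
      by (simp add: L_diff[OF x] L_cmult[OF x] smooths smooth_u smooth_sq)
    also have "L (\<lambda>y. u y * u y) x = 2 * (U * ((1 - sq x) * U + lam) + G)"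
      by (simp add: L_mult[OF x smooth_u smooth_u] L_u[OF x] G_def U_def power2_eq_square)
    finally show ?thesis by (simp add: simons[OF x] t_def)
  qed
  have dw: "\<delta> c w x = 2 * K * U * \<delta> c u x - \<delta> c sq x" for c
    unfolding w_def[abs_def] power2_eq_square
    by (simp add: d_diff[OF x] d_cmult[OF x] d_mult[OF x] smooths smooth_u smooth_sq U_def)
  have "sumsq_op V (\<lambda>c y. - Xc c y - 2 / u y * \<delta> c u y) w x = L w x - 2 / U * (\<Sum>c. \<delta> c u x * \<delta> c w x)"
    by (simp add: sumsq_op_def L_def Lap_def drift_def U_def left_diff_distrib sum_subtractf sum_negf sum_distrib_left mult.assoc)
  also have "(\<Sum>c. \<delta> c u x * \<delta> c w x) = 2 * K * U * G - D"
    by (simp add: dw G_def D_def right_diff_distrib sum_subtractf sum_distrib_left power2_eq_square algebra_simps)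
  finally have op: "sumsq_op V (\<lambda>c y. - Xc c y - 2 / u y * \<delta> c u y) w x = L w x - 2 / U * (2 * K * U * G - D)" .
  define W where "W = K * U\<^sup>2 - sq x"
  have W: "W \<ge> 0" using K by (simp add: W_def U_def)
  have t: "t = (E + U * D - G * sq x) / U\<^sup>2" using E U by (simp add: field_simps)
  have "L w x - 2 / U * (2 * K * U * G - D) + 2 / U\<^sup>2 * E = 2 * (1 - sq x) * W - 2 * G / U\<^sup>2 * W + 2 * lam * (K * U - F3 x)"
    unfolding Lw t W_def using U by (simp add: field_simps power2_eq_square)
  also have "2 * lam * (K * U - F3 x) \<le> 2 * \<bar>lam\<bar> / U * W"
  proof -
    have "2 * lam * (K * U - F3 x) = 2 * lam / U * W - 2 / U * (lam * (F3 x * U - sq x))"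
      unfolding W_def using U by (simp add: field_simps power2_eq_square)
    also have "\<dots> \<le> 2 * lam / U * W" using hyp U by (simp add: U_def)
    also have "\<dots> \<le> 2 * \<bar>lam\<bar> / U * W" using U W by (intro mult_right_mono divide_right_mono) auto
    finally show ?thesis .
  qed
  also have "2 * (1 - sq x) * W - 2 * G / U\<^sup>2 * W \<le> 2 * W"
  proof -
    have "sq x \<ge> 0" unfolding sq_def by (simp add: sum_nonneg)
    moreover have "G \<ge> 0" unfolding G_def by (simp add: sum_nonneg)
    ultimately have "sq x * W \<ge> 0" "2 * G / U\<^sup>2 * W \<ge> 0" using W by simp_all
    then show ?thesis by (simp add: algebra_simps)
  qed
  finally have "L w x - 2 / U * (2 * K * U * G - D) + 2 / U\<^sup>2 * E \<le> 2 * W + 2 * \<bar>lam\<bar> / U * W" by simp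
  then show ?thesis unfolding op[unfolded w_def[abs_def]] 
    using op by (simp add: E_def U_def W_def w_def[abs_def] distrib_right)
qed

text \<open>Tracing \<open>u T = grad u \<otimes> A\<close> gives \<open>u grad u = H grad u\<close>.  The symmetry of \<open>T\<close> lets \<open>grad u\<close> change places with an index of \<open>A\<close>: so \<open>grad u\<close> is an eigenvector of \<open>A\<close> with eigenvalue \<open>H\<close>, and \<open>A\<close> has rank one where \<open>grad u\<close> is not zero.\<close>

lemma rigid_gradient:
  assumes x: "x \<in> S" and u: "u x > 0" and rigid: "\<And>a b c. u x * T c a b x = \<delta> c u x * A a b x"
  shows "lam * \<delta> c u x = 0" "(\<Sum>c. (\<delta> c u x)\<^sup>2) * sq x = (\<Sum>c. (\<delta> c u x)\<^sup>2) * (H x)\<^sup>2"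
proof -
  have "u x * \<delta> c u x = \<delta> c u x * H x" for c
  proof -
    have "u x * (\<Sum>a. T c a a x) = \<delta> c u x * (\<Sum>a. A a a x)"
      by (simp add: sum_distrib_left rigid)
    then show ?thesis by (simp add: sum_T_trace[OF x] delta_H[OF x] H_def)
  qed
  then have "u x * \<delta> c u x = \<delta> c u x * (u x + lam)" using lambda_eq[OF x] by metis
  then show "lam * \<delta> c u x = 0" by (simp add: algebra_simps)
  have sym: "\<delta> c u x * A a b x = \<delta> a u x * A c b x" for a b c
    using rigid[of c a b] rigid[of a c b] T_symmetric(1)[OF x, of c a b] by simp
  have tr: "(\<Sum>a. \<delta> a u x * A a c x) = \<delta> c u x * H x" for c
  proof -
    have "(\<Sum>a. \<delta> a u x * A a c x) = (\<Sum>a. \<delta> c u x * A a a x)"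
    proof (rule sum.cong[OF refl])
      fix a show "\<delta> a u x * A a c x = \<delta> c u x * A a a x"
        using sym[of a c a] A_sym[OF x, of a c] by simp
    qed
    then show ?thesis by (simp add: H_def sum_distrib_left)
  qed
  have "(\<Sum>c. (\<delta> c u x)\<^sup>2) * sq x = (\<Sum>c. \<Sum>a. \<Sum>b. (\<delta> c u x * A a b x) * (\<delta> c u x * A a b x))"
    unfolding sq_def by (simp add: sum_distrib_left sum_distrib_right power2_eq_square algebra_simps)
  also have "\<dots> = (\<Sum>c. \<Sum>a. \<Sum>b. (\<delta> c u x * A a b x) * (\<delta> a u x * A c b x))"
    by (rule sum.cong[OF refl] | rule arg_cong2[where f = "(*)", OF refl sym])+
  also have "\<dots> = (\<Sum>c. \<Sum>b. \<Sum>a. (\<delta> c u x * A a b x) * (\<delta> a u x * A c b x))"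
    by (rule sum.cong[OF refl]) (rule sum.swap)
  also have "\<dots> = (\<Sum>b. \<Sum>c. \<Sum>a. (\<delta> c u x * A a b x) * (\<delta> a u x * A c b x))"
    by (rule sum.swap)
  also have "\<dots> = (\<Sum>b. (\<Sum>c. \<delta> c u x * A c b x) * (\<Sum>a. \<delta> a u x * A a b x))"
    by (simp add: sum_product algebra_simps)
  also have "\<dots> = (\<Sum>c. (\<delta> c u x)\<^sup>2) * (H x)\<^sup>2"
    unfolding tr by (simp add: power2_eq_square sum_distrib_right sum_distrib_left algebra_simps)
  finally show "(\<Sum>c. (\<delta> c u x)\<^sup>2) * sq x = (\<Sum>c. (\<delta> c u x)\<^sup>2) * (H x)\<^sup>2" .
qed

end

context hypersurface_patch begin

text \<open>Half the squared distance to the origin; the factor makes \<open>delta_R2\<close> the tangential part of \<open>X\<close>.\<close>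

definition R2 :: "real^'n \<Rightarrow> real" where "R2 x = (\<Sum>a. (Xc a x)\<^sup>2) / 2"

lemma R2_norm: "R2 x = (norm (X x))\<^sup>2 / 2"
  unfolding power2_norm_eq_inner by (simp add: R2_def Xc_def inner_vec_def power2_eq_square)

lemma smooth_R2: "smooth_on S R2"
proof -
  have "smooth_on S (\<lambda>x. (1/2) * (\<Sum>a. (Xc a x)\<^sup>2))" by (intro smooths)
  then show ?thesis by (simp add: R2_def[abs_def])
qed

lemma delta_R2: assumes x: "x \<in> S" shows "\<delta> a R2 x = Xc a x + u x * Nc a x"
proof -
  have "R2 = (\<lambda>x. (1/2) * (\<Sum>b. Xc b x * Xc b x))" by (simp add: R2_def fun_eq_iff power2_eq_square)
  then have "\<delta> a R2 x = (1/2) * \<delta> a (\<lambda>x. \<Sum>b. Xc b x * Xc b x) x"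
    using d_cmult[OF x, of "\<lambda>x. \<Sum>b. Xc b x * Xc b x" "V a" "1/2"] by (simp add: smooths)
  also have "\<dots> = (1/2) * (\<Sum>b. 2 * ((kd a b - Nc a x * Nc b x) * Xc b x))"
    by (simp add: d_sum[OF x] d_mult[OF x] smooths delta_X[OF x] mult.commute)
  also have "\<dots> = (\<Sum>b. (kd a b - Nc a x * Nc b x) * Xc b x)"
    unfolding sum_distrib_left[symmetric] by (simp only: mult.assoc[symmetric])
  also have "\<dots> = (\<Sum>b. kd a b * Xc b x) - Nc a x * (\<Sum>b. Xc b x * Nc b x)"
    by (simp only: left_diff_distrib sum_subtractf sum_distrib_left mult.assoc mult.commute[of "Nc _ _" "Xc _ _"])
  finally show ?thesis by (simp add: u_def)
qed

lemma delta_delta_R2: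
  assumes x: "x \<in> S"
  shows "\<delta> b (\<delta> a R2) x = kd b a - Nc b x * Nc a x + \<delta> b u x * Nc a x - u x * A b a x"
proof -
  have "\<delta> b (\<delta> a R2) x = \<delta> b (\<lambda>y. Xc a y + u y * Nc a y) x"
    by (rule d_cong[OF x]) (rule delta_R2)
  then show ?thesis
    by (simp add: d_add[OF x] d_mult[OF x] smooths smooth_u delta_X[OF x] delta_N[OF x])
qed

lemma sum_P: assumes x: "x \<in> S" shows "(\<Sum>a. 1 - Nc a x * Nc a x) = real CARD('n)"
  using NN[OF x] card_m by (simp add: sum_subtractf)

lemma Lap_R2: assumes x: "x \<in> S" shows "Lap R2 x = real CARD('n) - u x * H x"
proof -
  have "(\<Sum>a. \<delta> a u x * Nc a x) = 0" using sum_N_delta[OF x smooth_u] by (simp add: mult.commute)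
  then show ?thesis using sum_P[OF x]
    by (simp add: Lap_def delta_delta_R2[OF x] sum.distrib sum_subtractf H_def sum_distrib_left)
qed

text \<open>At a maximum \<open>X\<close> is normal, so \<open>grad u = A X\<close> vanishes and the Hessian of \<open>R2\<close> reduces to \<open>P - u A\<close> with \<open>P\<close> the tangential projection.\<close>

lemma at_max_R2:
  assumes x: "x \<in> S" and mx: "\<And>y. y \<in> S \<Longrightarrow> R2 y \<le> R2 x"
  shows "Lap R2 x \<le> 0"
    "(\<Sum>a. \<Sum>b. v a * v b * (u x * A a b x - (kd a b - Nc a x * Nc b x))) \<ge> 0"
proof -
  define f where "f y = - R2 y" for y
  have f: "smooth_on S f" unfolding f_def by (intro smooths smooth_R2)
  have mn: "f x \<le> f y" if "y \<in> S" for y using mx[OF that] by (simp add: f_def)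
  \<comment> \<open>The Hessian is tested along the field with constant coefficients \<open>v\<close>.\<close>
  define W where "W y = (\<Sum>a. v a *\<^sub>R V a y)" for y
  have W: "smooth_on S W" unfolding W_def
    by (intro smooth_on_sum open_S smooth_on_scaleR smooth_V smooth_on_const)
  have df: "\<delta> a f y = - \<delta> a R2 y" if "y \<in> S" for a y
    unfolding f_def[abs_def] by (rule d_uminus[OF that smooth_R2])
  have ddf: "\<delta> b (\<delta> a f) x = - \<delta> b (\<delta> a R2) x" for a b
  proof -
    have "\<delta> b (\<delta> a f) x = \<delta> b (\<lambda>y. - \<delta> a R2 y) x" by (rule d_cong[OF x df])
    then show ?thesis by (simp add: d_uminus[OF x] smooths smooth_R2)
  qed
  have "\<delta> a (\<delta> a f) x \<ge> 0" for a
    using dirderiv2_nonneg_at_min[OF open_S x f smooth_V mn] by blast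
  then show "Lap R2 x \<le> 0" unfolding Lap_def ddf by (simp add: sum_nonpos)
  have X: "Xc a x = - u x * Nc a x" for a
  proof -
    have "\<delta> a f x = 0" using dirderiv2_nonneg_at_min[OF open_S x f smooth_V mn] by blast
    then show ?thesis unfolding df[OF x] delta_R2[OF x] by linarith
  qed
  have du: "\<delta> a u x = 0" for a
  proof -
    have "\<delta> a u x = (\<Sum>b. (- u x) * (A a b x * Nc b x))" by (simp add: delta_u[OF x] X mult.left_commute)
    then show ?thesis by (simp only: sum_distrib_left[symmetric] sum_A_N[OF x] mult_zero_right)
  qed
  have dW: "dirderiv W g y = (\<Sum>a. v a * \<delta> a g y)" if "smooth_on S g" "y \<in> S" for g y
    by (simp add: dirderiv_def W_def linear_sum[OF delta_linear[OF that(2,1)]] linear_cmul[OF delta_linear[OF that(2,1)]])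
  have "dirderiv W (dirderiv W f) x = dirderiv W (\<lambda>y. \<Sum>a. v a * \<delta> a f y) x"
    by (rule dirderiv_cong[OF open_S x dW[OF f]])
  also have "\<dots> = (\<Sum>b. v b * \<delta> b (\<lambda>y. \<Sum>a. v a * \<delta> a f y) x)"
    by (rule dW[OF _ x]) (intro smooths f)
  also have "\<dots> = (\<Sum>b. \<Sum>a. v b * v a * \<delta> b (\<delta> a f) x)"
    by (simp add: d_sum[OF x] d_cmult[OF x] smooths f sum_distrib_left mult.assoc)
  finally have "(\<Sum>b. \<Sum>a. v b * v a * \<delta> b (\<delta> a f) x) \<ge> 0"
    using dirderiv2_nonneg_at_min[OF open_S x f W mn] by simp
  then show "(\<Sum>a. \<Sum>b. v a * v b * (u x * A a b x - (kd a b - Nc a x * Nc b x))) \<ge> 0"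
    unfolding ddf delta_delta_R2[OF x] du by simp
qed

text \<open>At a farthest point \<open>u A = P + B\<close> with \<open>B\<close> positive semidefinite and \<open>P\<close> the projection of rank \<open>n\<close>.  With \<open>|B|^2 \<le> (tr B)^2\<close>, the difference of the two sides is at least \<open>2 (n - 1) tr B + n^2 - n\<close>, positive for \<open>n \<ge> 2\<close>.\<close>

lemma sq_less_H2_at_max_R2:
  assumes x: "x \<in> S" and mx: "\<And>y. y \<in> S \<Longrightarrow> R2 y \<le> R2 x" and n: "CARD('n) \<ge> 2"
  shows "(u x)\<^sup>2 * sq x < (u x)\<^sup>2 * (H x)\<^sup>2"
proof -
  define P where "P a b = kd a b - Nc a x * Nc b x" for a b
  define B where "B a b = u x * A a b x - P a b" for a b
  have Bs: "B a b = B b a" for a b using A_sym[OF x, of a b] by (simp add: B_def P_def)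
  have psd: "(\<Sum>a. \<Sum>b. v a * v b * B a b) \<ge> 0" for v
    using at_max_R2(2)[OF x mx] by (simp add: B_def P_def)
  note ps = psd_sum_squares_le_trace[OF Bs psd]
  define tB where "tB = (\<Sum>a. B a a)"
  have AN: "(\<Sum>b. B a b * Nc b x) = 0" for a
  proof -
    have "(\<Sum>b. B a b * Nc b x) = u x * (\<Sum>b. A a b x * Nc b x) - (\<Sum>b. kd a b * Nc b x) + Nc a x * (\<Sum>b. Nc b x * Nc b x)"
      by (simp only: B_def P_def left_diff_distrib sum_subtractf sum_distrib_left mult.assoc)
    then show ?thesis by (simp add: sum_A_N[OF x] NN[OF x])
  qed
  have BP: "(\<Sum>a. \<Sum>b. B a b * P a b) = tB"
  proof -
    have "(\<Sum>b. B a b * P a b) = B a a" for a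
    proof -
      have "(\<Sum>b. B a b * P a b) = (\<Sum>b. B a b * kd a b) - Nc a x * (\<Sum>b. B a b * Nc b x)"
        by (simp only: P_def right_diff_distrib sum_subtractf sum_distrib_left mult.left_commute)
      then show ?thesis by (simp add: AN)
    qed
    then show ?thesis by (simp add: tB_def)
  qed
  have PP: "(\<Sum>a. \<Sum>b. (P a b)\<^sup>2) = real CARD('n)"
  proof -
    have "(\<Sum>b. (P a b)\<^sup>2) = 1 - Nc a x * Nc a x" for a
    proof -
      have "(\<Sum>b. (P a b)\<^sup>2) = (\<Sum>b. kd a b * kd a b) - 2 * Nc a x * (\<Sum>b. kd a b * Nc b x) + Nc a x * Nc a x * (\<Sum>b. Nc b x * Nc b x)"
        unfolding P_def sum_distrib_left sum_subtractf[symmetric] sum.distrib[symmetric]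
        by (intro sum.cong refl) (simp add: power2_eq_square algebra_simps)
      then show ?thesis by (simp add: NN[OF x])
    qed
    then show ?thesis using sum_P[OF x] by simp
  qed
  have uA: "u x * A a b x = B a b + P a b" for a b by (simp add: B_def)
  have "(u x)\<^sup>2 * sq x = (\<Sum>a. \<Sum>b. (u x * A a b x)\<^sup>2)"
    by (simp add: sq_def sum_distrib_left power_mult_distrib)
  also have "\<dots> = (\<Sum>a. \<Sum>b. (B a b)\<^sup>2) + 2 * (\<Sum>a. \<Sum>b. B a b * P a b) + (\<Sum>a. \<Sum>b. (P a b)\<^sup>2)"
    by (simp add: uA power2_sum sum.distrib sum_distrib_left algebra_simps)
  finally have 1: "(u x)\<^sup>2 * sq x \<le> tB\<^sup>2 + 2 * tB + real CARD('n)" using ps(1) by (simp add: BP PP tB_def)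
  have "u x * H x = tB + real CARD('n)"
    using sum_P[OF x] by (simp add: H_def sum_distrib_left uA tB_def sum.distrib P_def)
  then have 2: "(u x)\<^sup>2 * (H x)\<^sup>2 = (tB + real CARD('n))\<^sup>2" by (metis power_mult_distrib)
  have "tB \<ge> 0" using ps(2) by (simp add: tB_def)
  moreover have "real CARD('n) \<ge> 2" using n by simp
  ultimately have "2 * tB * (real CARD('n) - 1) + (real CARD('n))\<^sup>2 - real CARD('n) > 0"
    by (smt (verit, best) mult_nonneg_nonneg power2_eq_square mult_less_cancel_right1)
  then show ?thesis using 1 2 by (simp add: power2_eq_square algebra_simps)
qed

end

section \<open>Covering maps of compact spaces\<close>

text \<open>Fibres are compact and discrete, hence finite, and their points have disjoint neighbourhoods \<open>W' x\<close> on which \<open>p\<close> is injective.  The image of the compact rest \<open>R\<close> misses \<open>y\<close>, so removing it from the intersection of the images of these neighbourhoods leaves an evenly covered set.\<close>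

lemma covering_space_of_compact_locally_injective:
  fixes p :: "'a::real_normed_vector \<Rightarrow> 'b::real_normed_vector"
  assumes C: "compact C" and cont: "continuous_on C p" and im: "p ` C = S"
    and opn: "\<And>U. openin (top_of_set C) U \<Longrightarrow> openin (top_of_set S) (p ` U)"
    and inj: "\<And>x. x \<in> C \<Longrightarrow> \<exists>W. openin (top_of_set C) W \<and> x \<in> W \<and> inj_on p W"
  shows "covering_space C p S"
proof
  show "continuous_on C p" "p ` C = S" by fact+
  fix y assume y: "y \<in> S"
  obtain W where W: "\<And>x. x \<in> C \<Longrightarrow> openin (top_of_set C) (W x)" "\<And>x. x \<in> C \<Longrightarrow> x \<in> W x"
      "\<And>x. x \<in> C \<Longrightarrow> inj_on p (W x)"
    using inj by metis
  define F where "F = {x \<in> C. p x = y}"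
  have FC: "F \<subseteq> C" by (auto simp: F_def)
  have "closedin (top_of_set C) F"
    unfolding F_def by (rule continuous_closedin_preimage_constant[OF cont])
  then have cF: "compact F" using C closedin_compact by blast
  have finF: "finite F"
  proof -
    have "\<exists>T. open T \<and> W x = C \<inter> T" if "x \<in> C" for x using W(1)[OF that] by (simp add: openin_open)
    then obtain T where T: "\<And>x. x \<in> C \<Longrightarrow> open (T x) \<and> W x = C \<inter> T x" by metis
    have "F \<subseteq> \<Union>(T ` F)" using T W(2) FC by fastforce
    then obtain F' where F': "F' \<subseteq> F" "finite F'" "F \<subseteq> \<Union>(T ` F')"
      using compactE_image[OF cF, of F T] T FC by (metis subsetD)
    have "x = x'" if "x \<in> F" "x' \<in> F'" "x \<in> T x'" for x x'
    proof -
      have "x \<in> C" "x' \<in> C" using that F' FC by auto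
      then have "x \<in> W x'" "x' \<in> W x'" using that T[of x'] W(2) by blast+
      moreover have "p x = p x'" using that F' by (auto simp: F_def)
      ultimately show ?thesis using W(3)[of x'] that F' FC by (meson inj_onD subsetD)
    qed
    then have "F \<subseteq> F'" using F' by blast
    then show ?thesis using F'(2) finite_subset by blast
  qed
  have "\<exists>A B. open A \<and> open B \<and> x \<in> A \<and> x' \<in> B \<and> A \<inter> B = {}" if "x \<noteq> x'" for x x' :: 'a
    using that hausdorff by metis
  then obtain A B where AB: "\<And>x x'::'a. x \<noteq> x' \<Longrightarrow> open (A x x') \<and> open (B x x') \<and> x \<in> A x x' \<and> x' \<in> B x x' \<and> A x x' \<inter> B x x' = {}"
    by metis
  define W' where "W' x = W x \<inter> (\<Inter>x'\<in>F-{x}. A x x' \<inter> B x' x)" for x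
  have W'o: "openin (top_of_set C) (W' x)" if "x \<in> F" for x
  proof -
    have "open (\<Inter>x'\<in>F-{x}. A x x' \<inter> B x' x)" using finF AB by (intro open_INT) auto
    then show ?thesis unfolding W'_def using W(1) that FC by (meson openin_Int_open subsetD)
  qed
  have W'x: "x \<in> W' x" if "x \<in> F" for x 
  proof -
    have "x \<in> A x x' \<inter> B x' x" if "x' \<in> F - {x}" for x'
      using AB[of x x'] AB[of x' x] that by auto
    then show ?thesis using that W(2) FC unfolding W'_def by blast
  qed
  have W'd: "W' x \<inter> W' x' = {}" if "x \<in> F" "x' \<in> F" "x \<noteq> x'" for x x'
    using that AB[of x x'] by (fastforce simp: W'_def)
  have W'i: "inj_on p (W' x)" if "x \<in> F" for x
    using W(3) that FC by (metis W'_def inf_le1 inj_on_subset subsetD)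
  define R where "R = C - (\<Union>x\<in>F. W' x)"
  have "closedin (top_of_set C) R"
    unfolding R_def using W'o by (intro closedin_diff openin_Union) auto
  then have "compact R" using C closedin_compact by blast
  moreover have "continuous_on R p" using cont by (rule continuous_on_subset) (auto simp: R_def)
  ultimately have cpR: "closed (p ` R)" using compact_continuous_image compact_imp_closed by blast
  define T where "T = (S \<inter> (\<Inter>x\<in>F. p ` W' x)) - p ` R"
  have yT: "y \<in> T"
  proof -
    have "y \<in> p ` W' x" if "x \<in> F" for x using W'x[OF that] that by (force simp: F_def)
    moreover have "y \<notin> p ` R" using W'x by (force simp: R_def F_def)
    ultimately show ?thesis using y by (auto simp: T_def)
  qed
  have To: "openin (top_of_set S) T"
  proof -
    have "openin (top_of_set S) (S \<inter> (\<Inter>x\<in>F. p ` W' x))"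
    proof (cases "F = {}")
      case False
      then have "openin (top_of_set S) (\<Inter>x\<in>F. p ` W' x)"
        using finF opn W'o by (intro openin_INT2) auto
      then show ?thesis by (simp add: openin_Int)
    qed simp
    then show ?thesis unfolding T_def using cpR
      by (metis (no_types, lifting) Diff_eq open_Compl openin_Int_open)
  qed
  define v where "v = (\<lambda>x. W' x \<inter> p -` T) ` F"
  have Un: "\<Union>v = C \<inter> p -` T"
  proof
    show "\<Union>v \<subseteq> C \<inter> p -` T" using W'o by (force simp: v_def dest: openin_imp_subset)
    show "C \<inter> p -` T \<subseteq> \<Union>v" by (auto simp: v_def T_def R_def)
  qed
  have op: "openin (top_of_set C) u" if "u \<in> v" for u
  proof -
    obtain x where x: "x \<in> F" "u = W' x \<inter> p -` T" using \<open>u \<in> v\<close> by (auto simp: v_def)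
    have "openin (top_of_set C) (C \<inter> p -` T)"
      using continuous_openin_preimage[OF cont _ To] im by blast
    moreover have "u = W' x \<inter> (C \<inter> p -` T)" using x W'o[OF x(1)] openin_imp_subset by blast
    ultimately show ?thesis using W'o[OF x(1)] by auto
  qed
  have hom: "\<exists>q. homeomorphism u T p q" if "u \<in> v" for u
  proof -
    obtain x where x: "x \<in> F" "u = W' x \<inter> p -` T" using \<open>u \<in> v\<close> by (auto simp: v_def)
    have uC: "u \<subseteq> C" using op[OF that] openin_imp_subset by blast
    have pu: "p ` u = T"
    proof
      show "p ` u \<subseteq> T" using x by auto
      have "T \<subseteq> p ` W' x" using x(1) by (auto simp: T_def)
      then show "T \<subseteq> p ` u" using x(2) by blast
    qed
    have inju: "inj_on p u" using W'i[OF x(1)] x(2) by (meson inf_le1 inj_on_subset)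
    have "openin (top_of_set T) (p ` U)" if "openin (top_of_set u) U" for U
    proof -
      have "openin (top_of_set C) U" using that op[OF \<open>u \<in> v\<close>] openin_trans by blast
      moreover have "p ` U \<subseteq> T" using that pu openin_imp_subset by blast
      ultimately show ?thesis using opn To by (meson openin_imp_subset openin_subset_trans)
    qed
    then show ?thesis
      using homeomorphism_injective_open_map[OF continuous_on_subset[OF cont uC] pu inju] by metis
  qed
  have dis: "pairwise disjnt v"
  proof (rule pairwiseI)
    fix a b assume "a \<in> v" "b \<in> v" "a \<noteq> b"
    then obtain x x' where x: "x \<in> F" "x' \<in> F" "a = W' x \<inter> p -` T" "b = W' x' \<inter> p -` T" "x \<noteq> x'"
      unfolding v_def by blast
    then show "disjnt a b" using W'd[of x x'] by (auto simp: disjnt_def)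
  qed
  show "\<exists>T. y \<in> T \<and> openin (top_of_set S) T \<and>
            (\<exists>v. \<Union>v = C \<inter> p -` T \<and> (\<forall>u\<in>v. openin (top_of_set C) u) \<and>
                 pairwise disjnt v \<and> (\<forall>u\<in>v. \<exists>q. homeomorphism u T p q))"
    by (intro exI[of _ T] exI[of _ v] conjI ballI yT To Un op dis hom)
qed

text \<open>Simple connectivity lifts the identity to a section \<open>g\<close>.  Its image is closed by compactness, and open because \<open>p\<close> is a local homeomorphism; so it is all of \<open>C\<close>, and \<open>p\<close> has an inverse.\<close>

lemma covering_of_simply_connected_inj:
  fixes p :: "'a::real_normed_vector \<Rightarrow> 'b::real_normed_vector"
  assumes cov: "covering_space C p S" and C: "connected C" and S: "simply_connected S" "locally path_connected S"
    "compact S"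
  shows "inj_on p C"
proof (cases "C = {}")
  case False
  obtain g where g: "continuous_on S g" "g \<in> S \<rightarrow> C" "\<And>y. y \<in> S \<Longrightarrow> p (g y) = y"
    using covering_space_lift[OF cov S(1,2), of id] by (auto simp: continuous_on_id)
  have pC: "p ` C = S" using cov covering_space_imp_surjective by blast
  have cont: "continuous_on C p" using cov covering_space_imp_continuous by blast
  have "closedin (top_of_set C) (g ` S)"
    using g(1,2) S(3) by (intro closed_subset) (auto intro: compact_imp_closed compact_continuous_image)
  moreover have "openin (top_of_set C) (g ` S)"
  proof (subst openin_subopen, intro ballI)
    fix x assume x: "x \<in> g ` S"
    then have xC: "x \<in> C" using g(2) by auto
    obtain y where y: "y \<in> S" "x = g y" using x by auto
    obtain T u q where T: "x \<in> T" "openin (top_of_set C) T" "p x \<in> u" "openin (top_of_set S) u" "homeomorphism T u p q"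
      using covering_space_local_homeomorphism[OF cov xC] by metis
    define O' where "O' = T \<inter> (C \<inter> p -` (S \<inter> g -` T))"
    have "openin (top_of_set S) (S \<inter> g -` T)"
      using continuous_openin_preimage[OF g(1,2) T(2)] .
    then have "openin (top_of_set C) (C \<inter> p -` (S \<inter> g -` T))"
      using continuous_openin_preimage[OF cont] pC by blast
    then have "openin (top_of_set C) O'" using T(2) by (simp add: O'_def openin_Int)
    moreover have "x \<in> O'" using T(1) xC y g(3) by (auto simp: O'_def)
    moreover have "O' \<subseteq> g ` S"
    proof
      fix z assume z: "z \<in> O'"
      then have "z \<in> T" "g (p z) \<in> T" "p z \<in> S" by (auto simp: O'_def)
      moreover have "p (g (p z)) = p z" using g(3) \<open>p z \<in> S\<close> by auto
      ultimately have "z = g (p z)" using T(5) by (metis homeomorphism_def)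
      then show "z \<in> g ` S" using \<open>p z \<in> S\<close> by blast
    qed
    ultimately show "\<exists>T. openin (top_of_set C) T \<and> x \<in> T \<and> T \<subseteq> g ` S" by blast
  qed
  ultimately have "g ` S = C"
    using C False pC unfolding connected_clopen by (metis image_is_empty)
  then show ?thesis using g(3) by (metis inj_onI imageE)
qed simp

section \<open>Immersions into the sphere\<close>

lemma Ck_on_Pair:
  assumes "open S" "Ck_on k S f" "Ck_on k S g" shows "Ck_on k S (\<lambda>x. (f x, g x))"
proof -
  have "Ck_on k S (\<lambda>x. (f x, 0) + (0, g x))"
    by (intro Ck_on_add[OF assms(1)] Ck_on_linear[OF assms(1), of "\<lambda>a. (a, 0)"] Ck_on_linear[OF assms(1), of "\<lambda>b. (0, b)"]
        bounded_linear_Pair bounded_linear_ident bounded_linear_zero assms)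
  then show ?thesis by simp
qed

context hypersurface_patch begin

text \<open>The linear map \<open>w \<mapsto> \<Sum> w a V a\<close> is a left inverse of \<open>dX\<close>, so local injectivity follows from continuity of \<open>dX\<close>.\<close>

lemma locally_injective:
  assumes x0: "x0 \<in> S"
  obtains \<rho> where "\<rho> > 0" "ball x0 \<rho> \<subseteq> S" "inj_on X (ball x0 \<rho>)"
proof -
  let ?D = "\<lambda>x. frechet_derivative X (at x)"
  define g where "g w = (\<Sum>a. w $ a *\<^sub>R V a x0)" for w :: "real^'m"
  have bg: "bounded_linear g"
    unfolding g_def by (intro bounded_linear_sum bounded_linear_scaleR_const bounded_linear_vec_nth)
  have gD: "g \<circ> ?D x0 = id"
    using tangent_expansion[OF x0] by (auto simp: g_def fun_eq_iff)
  have con: "\<exists>d>0. \<forall>x. dist x0 x < d \<longrightarrow> onorm (\<lambda>v. ?D x v - ?D x0 v) < e" if e: "e > 0" for e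
  proof -
    define h where "h x = (\<Sum>i. norm (dX x i - dX x0 i))" for x
    have "continuous_on S h" unfolding h_def
      by (intro continuous_intros smooth_on_imp_continuous_on[OF smooth_dX])
    then have "isCont h x0" using open_S x0 by (simp add: continuous_on_eq_continuous_at)
    moreover have "h x0 = 0" by (simp add: h_def)
    ultimately obtain d1 where d1: "d1 > 0" "\<And>x. dist x x0 < d1 \<Longrightarrow> dist (h x) 0 < e"
      using e by (metis continuous_at_eps_delta)
    obtain d2 where d2: "d2 > 0" "ball x0 d2 \<subseteq> S" using open_S x0 open_contains_ball by blast
    have "onorm (\<lambda>v. ?D x v - ?D x0 v) < e" if x: "dist x0 x < min d1 d2" for x
    proof -
      have xS: "x \<in> S" using d2 x by auto
      have "norm (?D x v - ?D x0 v) \<le> h x * norm v" for v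
      proof -
        have "?D x v - ?D x0 v = (\<Sum>i. v $ i *\<^sub>R (dX x i - dX x0 i))"
          by (simp add: frechet_X_expansion[OF xS] frechet_X_expansion[OF x0] scaleR_diff_right sum_subtractf)
        also have "norm \<dots> \<le> (\<Sum>i. \<bar>v $ i\<bar> * norm (dX x i - dX x0 i))"
          by (rule order_trans[OF norm_sum]) simp
        also have "\<dots> \<le> (\<Sum>i. norm v * norm (dX x i - dX x0 i))"
          by (intro sum_mono mult_right_mono component_le_norm_cart) auto
        also have "\<dots> = h x * norm v" by (simp add: h_def sum_distrib_left mult.commute)
        finally show ?thesis .
      qed
      then have "onorm (\<lambda>v. ?D x v - ?D x0 v) \<le> h x" by (rule onorm_le)
      also have "h x < e" using d1(2)[of x] x by (simp add: dist_commute)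
      finally show ?thesis .
    qed
    then show ?thesis using d1(1) d2(1) by (intro exI[of _ "min d1 d2"]) auto
  qed
  obtain \<rho> where "\<rho> > 0" "ball x0 \<rho> \<subseteq> S" "inj_on X (ball x0 \<rho>)"
    using has_derivative_locally_injective[OF x0 open_S bg, of ?D X, OF gD has_derivative_X con] by blast
  then show ?thesis using that by blast
qed

text \<open>The map \<open>G (x, t) = t X(x)\<close> extends the parametrisation of the sphere to a map between spaces of equal dimension.  It is injective near \<open>x0\<close>, so by invariance of domain it has an open image and a continuous inverse \<open>F\<close>, which is differentiable because \<open>dG\<close> has an explicit left inverse built from the fields \<open>V a\<close>.  Since \<open>DF\<close> is a smooth expression in \<open>F\<close> itself, \<open>F\<close> is smooth by induction on the order.\<close>

lemma sphere_chart_inverse: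
  assumes r: "r > 0" and XN: "\<And>x. x \<in> S \<Longrightarrow> X x = - r *\<^sub>R N x" and O: "open O'" "O' \<subseteq> S" and x0: "x0 \<in> O'"
  obtains W T F where "open W" "x0 \<in> W" "W \<subseteq> O'" "inj_on X W" "open T" "T \<inter> sphere 0 r = X ` W"
    "smooth_on T F" "\<And>x. x \<in> W \<Longrightarrow> F (X x) = x"
proof -
  have x0S: "x0 \<in> S" using x0 O by auto
  obtain \<rho>1 where \<rho>1: "\<rho>1 > 0" "ball x0 \<rho>1 \<subseteq> S" "inj_on X (ball x0 \<rho>1)" using locally_injective[OF x0S] .
  obtain \<rho>2 where \<rho>2: "\<rho>2 > 0" "ball x0 \<rho>2 \<subseteq> O'" using O(1) x0 open_contains_ball by blast
  define W where "W = ball x0 (min \<rho>1 \<rho>2)"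
  have W: "open W" "x0 \<in> W" "W \<subseteq> O'" "W \<subseteq> S" "inj_on X W"
    using \<rho>1 \<rho>2 O by (auto simp: W_def intro: inj_on_subset)
  have nX: "norm (X x) = r" if "x \<in> S" for x using XN[OF that] norm_N[OF that] r by simp
  define G where "G z = snd z *\<^sub>R X (fst z)" for z :: "(real^'n) \<times> real"
  define Q where "Q = W \<times> {0::real<..}"
  have Q: "open Q" using W by (simp add: Q_def open_Times)
  have contG: "continuous_on Q G"
  proof -
    have "continuous_on Q (\<lambda>z. X (fst z))"
      by (rule continuous_on_compose2[OF smooth_on_imp_continuous_on[OF smooth_X] continuous_on_fst[OF continuous_on_id]])
        (use W(4) in \<open>auto simp: Q_def\<close>)
    then show ?thesis unfolding G_def by (intro continuous_on_scaleR continuous_on_snd continuous_on_id)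
  qed
  have injG: "inj_on G Q"
  proof (rule inj_onI)
    fix z z' assume z: "z \<in> Q" "z' \<in> Q" and eq: "G z = G z'"
    have S: "fst z \<in> S" "fst z' \<in> S" "fst z \<in> W" "fst z' \<in> W" "snd z > 0" "snd z' > 0" using z W(4) by (auto simp: Q_def)
    have "snd z * r = snd z' * r" using arg_cong[OF eq, of norm] S nX by (simp add: G_def)
    then have s: "snd z = snd z'" using r by simp
    then have "X (fst z) = X (fst z')" using eq S by (simp add: G_def)
    then have "fst z = fst z'" using W(5) S by (auto dest: inj_onD)
    then show "z = z'" using s by (simp add: prod_eq_iff)
  qed
  define T where "T = G ` Q"
  define F where "F = inv_into Q G"
  have FG: "F (G z) = z" if "z \<in> Q" for z using that injG by (simp add: F_def)
  have dim: "DIM(real^'m) \<le> DIM((real^'n) \<times> real)" using card_m by simp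
  have T: "open T" unfolding T_def by (rule invariance_of_domain_gen[OF Q contG injG dim])
  have contF: "continuous_on T F"
    unfolding T_def by (rule continuous_on_inverse_open[OF Q contG dim]) (rule FG)
  have FT: "F y \<in> Q" "G (F y) = y" if "y \<in> T" for y
    using that by (auto simp: F_def T_def inv_into_into f_inv_into_f)
  have FS: "fst (F y) \<in> S" "snd (F y) > 0" if "y \<in> T" for y
    using FT(1)[OF that] W(4) by (auto simp: Q_def)
  define DF where "DF y w = (inverse (snd (F y)) *\<^sub>R (\<Sum>a. w $ a *\<^sub>R V a (fst (F y))), (w \<bullet> X (fst (F y))) / r\<^sup>2)" for y and w :: "real^'m"
  have dF: "(F has_derivative DF y) (at y)" if y: "y \<in> T" for y
  proof (rule has_derivative_inverse_basic[where f = G and T = T])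
    define x t where "x = fst (F y)" and "t = snd (F y)"
    have x: "x \<in> S" and t: "t > 0" using FS[OF y] by (auto simp: x_def t_def)
    let ?D = "\<lambda>z. t *\<^sub>R frechet_derivative X (at x) (fst z) + snd z *\<^sub>R X x"
    have "(X has_derivative frechet_derivative X (at x)) (at (fst (F y)))"
      using has_derivative_X[OF x] by (simp add: x_def)
    then have dX: "((\<lambda>z. X (fst z)) has_derivative (\<lambda>z. frechet_derivative X (at x) (fst z))) (at (F y))"
      by (intro has_derivative_compose[of fst fst "F y" UNIV X]) (auto intro!: derivative_eq_intros)
    show "(G has_derivative ?D) (at (F y))"
      unfolding G_def by (rule has_derivative_eq_rhs[OF has_derivative_scaleR[OF has_derivative_snd[OF has_derivative_ident] dX]])
        (simp add: x_def t_def fun_eq_iff)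
    show "bounded_linear (DF y)"
      unfolding DF_def divide_inverse
      by (intro bounded_linear_Pair bounded_linear_const_scaleR bounded_linear_sum bounded_linear_scaleR_const
          bounded_linear_vec_nth bounded_linear_mult_const bounded_linear_inner_left)
    show "DF y \<circ> ?D = id"
    proof
      fix z :: "(real^'n) \<times> real"
      let ?v = "fst z" and ?s = "snd z"
      have "(\<Sum>a. ?D z $ a *\<^sub>R V a x) = t *\<^sub>R (\<Sum>a. frechet_derivative X (at x) ?v $ a *\<^sub>R V a x) - (?s * r) *\<^sub>R (\<Sum>a. N x $ a *\<^sub>R V a x)"
        by (simp add: XN[OF x] scaleR_sum_right scaleR_add_left scaleR_diff_left sum.distrib sum_subtractf mult.assoc)
      also have "\<dots> = t *\<^sub>R ?v" using tangent_expansion[OF x, of ?v] sum_N_V[OF x] by simp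
      finally have 1: "(\<Sum>a. ?D z $ a *\<^sub>R V a x) = t *\<^sub>R ?v" .
      have "frechet_derivative X (at x) ?v \<bullet> X x = 0" using N_orth[OF x, of ?v] by (simp add: XN[OF x] inner_commute)
      moreover have "X x \<bullet> X x = r\<^sup>2" using nX[OF x] by (metis power2_norm_eq_inner)
      ultimately have 2: "?D z \<bullet> X x = ?s * r\<^sup>2" by (simp add: inner_add_left)
      have "DF y (?D z) = (inverse t *\<^sub>R (\<Sum>a. ?D z $ a *\<^sub>R V a x), (?D z \<bullet> X x) / r\<^sup>2)"
        by (simp add: DF_def x_def t_def)
      also have "\<dots> = z" unfolding 1 2 using t r by (simp add: prod_eq_iff)
      finally show "(DF y \<circ> ?D) z = id z" by simp
    qed
    show "continuous (at y) F" using contF T y by (simp add: continuous_on_eq_continuous_at)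
  qed (use T y FT in auto)
  have CF: "Ck_on k T F" for k
  proof (induction k)
    case 0 show ?case using contF by simp
  next
    case (Suc k)
    have 1: "Ck_on k T (\<lambda>y. fst (F y))" "Ck_on k T (\<lambda>y. snd (F y))"
      using Suc Ck_on_linear[OF T bounded_linear_fst] Ck_on_linear[OF T bounded_linear_snd] by auto
    have sub: "(\<lambda>y. fst (F y)) ` T \<subseteq> S" using FS by auto
    have 2: "Ck_on k T (\<lambda>y. V a (fst (F y)))" "Ck_on k T (\<lambda>y. X (fst (F y)))" for a
      using Ck_on_compose[OF T open_S sub 1(1)] smooth_V smooth_X by (auto simp: smooth_on_def)
    have 3: "Ck_on k T (\<lambda>y. inverse (snd (F y)))"
      by (rule Ck_on_inverse[OF T _ 1(2)]) (use FS(2) in force)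
    show ?case
    proof (rule Ck_on_SucI[OF T dF])
      fix w show "Ck_on k T (\<lambda>y. DF y w)"
        unfolding DF_def divide_inverse
        by (intro Ck_on_Pair T Ck_on_scaleR[OF T] 3 Ck_on_sum[OF T] 2 Ck_on_const Ck_on_mult[OF T] Ck_on_inner[OF T])
    qed
  qed
  show ?thesis
  proof (rule that[OF W(1,2,3,5) T])
    show "T \<inter> sphere 0 r = X ` W"
    proof (intro equalityI subsetI)
      fix y assume y: "y \<in> T \<inter> sphere 0 r"
      then obtain z where z: "z \<in> Q" "y = G z" by (auto simp: T_def)
      then have z1: "fst z \<in> W" "fst z \<in> S" "snd z > 0" using W(4) by (auto simp: Q_def)
      have "norm y = snd z * r" using z z1 nX by (simp add: G_def)
      then have "snd z = 1" using y r by simp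
      then show "y \<in> X ` W" using z z1 by (auto simp: G_def)
    next
      fix y assume "y \<in> X ` W"
      then obtain x where x: "x \<in> W" "y = X x" by auto
      then have "y = G (x, 1)" "(x, 1) \<in> Q" by (auto simp: G_def Q_def)
      then have "y \<in> T" unfolding T_def by blast
      moreover have "norm y = r" using nX[of x] x W(4) by auto
      ultimately show "y \<in> T \<inter> sphere 0 r" by simp
    qed
    show "smooth_on T (\<lambda>y. fst (F y))"
      unfolding smooth_on_def using Ck_on_linear[OF T bounded_linear_fst] CF by blast
    fix x assume "x \<in> W"
    then have "(x, 1) \<in> Q" "X x = G (x, 1)" by (auto simp: G_def Q_def)
    then show "fst (F (X x)) = x" using FG by simp
  qed
qed

end

text \<open>The bounded functions on the natural numbers form one normed space with linearly independent families of every finite size, whatever the number of functions used for the embedding below.\<close>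

lemma unit_bcontfun: "\<exists>b :: nat \<Rightarrow>\<^sub>C real. \<forall>n. apply_bcontfun b n = (if n = i then 1 else 0)"
proof -
  have "(\<lambda>n::nat. if n = i then 1 else 0::real) \<in> bcontfun"
    by (auto simp: bcontfun_def bounded_iff intro!: exI[of _ 1])
  from Bcontfun_inverse[OF this] show ?thesis by (intro exI[of _ "Bcontfun (\<lambda>n. if n = i then 1 else 0)"]) simp
qed

lemma continuous_on_apply_bcontfun_snd:
  "continuous_on A (\<lambda>z. apply_bcontfun (snd z :: 'a::topological_space \<Rightarrow>\<^sub>C real) i)"
proof -
  have "bounded_linear (\<lambda>f :: 'a \<Rightarrow>\<^sub>C real. apply_bcontfun f i)"
  proof (rule bounded_linear_intro[of _ 1])
    show "norm (apply_bcontfun f i) \<le> norm f * 1" for f :: "'a \<Rightarrow>\<^sub>C real" using norm_bounded[of f i] by simp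
  qed (simp_all add: plus_bcontfun.rep_eq scaleR_bcontfun.rep_eq)
  from bounded_linear.continuous_on[OF this continuous_on_snd[OF continuous_on_id]] show ?thesis .
qed

text \<open>The lifting theorem for covering maps is applied after embedding \<open>M\<close> in a normed space.  Finitely many Urysohn functions, each supported in an open set where \<open>f\<close> is injective, separate the points of every fibre; together with \<open>f\<close> they give an injective continuous map \<open>j\<close>, under which \<open>f\<close> becomes the first projection.\<close>

lemma local_homeo_to_simply_connected_inj:
  fixes f :: "'a \<Rightarrow> 'b::real_normed_vector"
  assumes M: "compact_space M" "Hausdorff_space M" "connected_space M"
    and f: "continuous_map M euclidean f" and im: "f ` topspace M = S"
    and opn: "\<And>U. openin M U \<Longrightarrow> openin (top_of_set S) (f ` U)"
    and inj: "\<And>p. p \<in> topspace M \<Longrightarrow> \<exists>W. openin M W \<and> p \<in> W \<and> inj_on f W"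
    and S: "simply_connected S" "locally path_connected S"
  shows "inj_on f (topspace M)"
proof -
  obtain W where W: "\<And>p. p \<in> topspace M \<Longrightarrow> openin M (W p) \<and> p \<in> W p \<and> inj_on f (W p)"
    using inj by metis
  have norm: "normal_space M" using M compact_Hausdorff_or_regular_imp_normal_space by blast
  have "\<exists>g. continuous_map M euclideanreal g \<and> g p = 1 \<and> (\<forall>q\<in>topspace M - W p. g q = 0)" if p: "p \<in> topspace M" for p
  proof -
    have "closedin M {p}" using closedin_Hausdorff_sing_eq[OF M(2)] p by simp
    moreover have "closedin M (topspace M - W p)" using W[OF p] by blast
    moreover have "disjnt {p} (topspace M - W p)" using W[OF p] by simp
    ultimately obtain g where "continuous_map M euclideanreal g" "g ` {p} \<subseteq> {1}" "g ` (topspace M - W p) \<subseteq> {0}"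
      using Urysohn_lemma_alt[OF norm] by metis
    then show ?thesis by (intro exI[of _ g]) auto
  qed
  then obtain g where g: "\<And>p. p \<in> topspace M \<Longrightarrow> continuous_map M euclideanreal (g p) \<and> g p p = 1 \<and> (\<forall>q\<in>topspace M - W p. g p q = 0)"
    by metis
  define O' where "O' p = {q \<in> topspace M. g p q \<in> {0<..}}" for p
  have "openin M (O' p)" if "p \<in> topspace M" for p
    unfolding O'_def by (rule openin_continuous_map_preimage[of _ euclideanreal]) (use g[OF that] in auto)
  moreover have "topspace M \<subseteq> \<Union>(O' ` topspace M)" using g by (force simp: O'_def)
  ultimately obtain \<F> where \<F>: "finite \<F>" "\<F> \<subseteq> O' ` topspace M" "topspace M \<subseteq> \<Union>\<F>"
    using M(1) unfolding compact_space_alt by (metis (no_types, lifting) imageE)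
  then obtain P where P: "P \<subseteq> topspace M" "finite P" "\<F> = O' ` P"
    by (meson finite_subset_image)
  obtain h where h: "bij_betw h {0..<card P} P" using ex_bij_betw_nat_finite[OF P(2)] by blast
  obtain b :: "nat \<Rightarrow> nat \<Rightarrow>\<^sub>C real" where b: "\<And>i n. apply_bcontfun (b i) n = (if n = i then 1 else 0)"
    using unit_bcontfun by metis
  define e where "e q = (\<Sum>i\<in>{0..<card P}. g (h i) q *\<^sub>R b i)" for q
  have hP: "h i \<in> topspace M" if "i < card P" for i using h P(1) that by (auto simp: bij_betw_def)
  have apsum: "apply_bcontfun (sum F I) n = (\<Sum>i\<in>I. apply_bcontfun (F i) n)" for F :: "nat \<Rightarrow> nat \<Rightarrow>\<^sub>C real" and I n
    by (induction I rule: infinite_finite_induct) (auto simp: plus_bcontfun.rep_eq zero_bcontfun.rep_eq)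
  have e: "apply_bcontfun (e q) i = g (h i) q" if "i < card P" for q i
    using that by (simp add: e_def apsum scaleR_bcontfun.rep_eq b if_distrib[of "\<lambda>t. _ * t"] cong: if_cong)
  have conte: "continuous_map M euclidean e"
    unfolding e_def
  proof (rule continuous_map_sum)
    fix i assume "i \<in> {0..<card P}"
    then have "continuous_map M euclideanreal (g (h i))" using g hP by simp
    moreover have "continuous_map euclideanreal euclidean (\<lambda>t. t *\<^sub>R b i)" by (simp add: continuous_intros)
    ultimately have "continuous_map M euclidean ((\<lambda>t. t *\<^sub>R b i) \<circ> g (h i))" by (rule continuous_map_compose)
    then show "continuous_map M euclidean (\<lambda>q. g (h i) q *\<^sub>R b i)" by (simp add: o_def)
  qed simp
  define j where "j q = (f q, e q)" for q
  have contj: "continuous_map M euclidean j"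
    unfolding j_def using continuous_map_pairedI[OF f conte] by (simp add: euclidean_product_topology)
  define C where "C = j ` topspace M"
  have key: "f q = f q' \<Longrightarrow> q = q'" if "i < card P" "q \<in> topspace M" "q' \<in> topspace M" "apply_bcontfun (e q) i > 0" "apply_bcontfun (e q') i > 0" for q q' i
  proof -
    assume fq: "f q = f q'"
    have "q \<in> W (h i)" "q' \<in> W (h i)" using that g[OF hP[OF that(1)]] e[OF that(1)] by force+
    then show "q = q'" using W[OF hP[OF that(1)]] fq by (meson inj_onD)
  qed
  have cover: "\<exists>i<card P. apply_bcontfun (e q) i > 0" if q: "q \<in> topspace M" for q
  proof -
    obtain p where p: "p \<in> P" "q \<in> O' p" using \<F>(3) q P(3) by blast
    then obtain i where "i < card P" "h i = p"
      using h unfolding bij_betw_def by (metis atLeastLessThan_iff imageE)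
    then show ?thesis using p(2) e by (auto simp: O'_def)
  qed
  have injj: "inj_on j (topspace M)"
    using key cover by (intro inj_onI) (metis j_def prod.inject)
  have compC: "compact C"
    using image_compactin[of M "topspace M" euclidean j] M(1) contj by (simp add: C_def compact_space_def)
  have connC: "connected C"
    using connectedin_continuous_map_image[of M euclidean j "topspace M"] M(3) contj by (simp add: C_def connectedin_topspace)
  have cov: "covering_space C fst S"
  proof (rule covering_space_of_compact_locally_injective[OF compC])
    show "continuous_on C fst" by (intro continuous_intros)
    show "fst ` C = S" using im by (auto simp: C_def j_def image_image)
    fix U assume U: "openin (top_of_set C) U"
    then obtain V where V: "open V" "U = C \<inter> V" by (auto simp: openin_open)
    have "openin M {q \<in> topspace M. j q \<in> V}"
      by (rule openin_continuous_map_preimage[OF contj]) (use V in auto)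
    moreover have "U = j ` {q \<in> topspace M. j q \<in> V}" by (auto simp: V(2) C_def)
    then have "fst ` U = f ` {q \<in> topspace M. j q \<in> V}" by (simp add: image_image j_def)
    ultimately show "openin (top_of_set S) (fst ` U)" using opn by simp
  next
    fix z assume "z \<in> C"
    then obtain q where q: "q \<in> topspace M" "z = j q" by (auto simp: C_def)
    obtain i where i: "i < card P" "apply_bcontfun (e q) i > 0" using cover[OF q(1)] by blast
    define V where "V = {z::'b \<times> (nat \<Rightarrow>\<^sub>C real). apply_bcontfun (snd z) i > 0}"
    have "continuous_on UNIV (\<lambda>z::'b \<times> (nat \<Rightarrow>\<^sub>C real). apply_bcontfun (snd z) i)"
      by (rule continuous_on_apply_bcontfun_snd)
    then have "open V" unfolding V_def using open_Collect_less[OF continuous_on_const] by blast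
    then have "openin (top_of_set C) (C \<inter> V)" by blast
    moreover have "z \<in> C \<inter> V" using \<open>z \<in> C\<close> q i by (simp add: V_def j_def)
    moreover have "inj_on fst (C \<inter> V)"
    proof (rule inj_onI)
      fix z z' assume z: "z \<in> C \<inter> V" "z' \<in> C \<inter> V" "fst z = fst z'"
      then obtain q q' where q: "q \<in> topspace M" "q' \<in> topspace M" "z = j q" "z' = j q'" by (auto simp: C_def)
      then have "q = q'" using key[OF i(1) q(1,2)] z by (simp add: V_def j_def)
      then show "z = z'" using q by simp
    qed
    ultimately show "\<exists>W. openin (top_of_set C) W \<and> z \<in> W \<and> inj_on fst W" by blast
  qed
  have "compact S"
    using image_compactin[of M "topspace M" euclidean f] M(1) f im by (simp add: compact_space_def)
  then have "inj_on fst C" using covering_of_simply_connected_inj[OF cov connC S] by blast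
  then have "inj_on (fst \<circ> j) (topspace M)" using injj by (simp add: C_def comp_inj_on)
  then show ?thesis by (simp add: j_def o_def)
qed

section \<open>Frames and charts\<close>

text \<open>Adding the unit normal completes the \<open>n\<close> vectors to an orthonormal basis of the ambient space.\<close>

lemma parseval_hyperplane:
  fixes E :: "'n::finite \<Rightarrow> real^'m::finite"
  assumes on: "\<And>i j. E i \<bullet> E j = (if i = j then 1 else 0)" and nN: "nu \<bullet> nu = 1" and EN: "\<And>i. nu \<bullet> E i = 0"
    and card: "CARD('m) = CARD('n) + 1"
  shows "(\<Sum>i. (E i \<bullet> y) * (E i \<bullet> z)) = y \<bullet> z - (nu \<bullet> y) * (nu \<bullet> z)"
proof -
  have EN': "E i \<bullet> nu = 0" for i using EN[of i] by (simp add: inner_commute)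
  have "inj E" by (rule injI) (metis on zero_neq_one)
  have "nu \<notin> range E" using EN' nN by (metis imageE inner_eq_zero_iff inner_zero_left zero_neq_one)
  define B where "B = insert nu (range E)"
  have cB: "card B = CARD('m)"
    using \<open>nu \<notin> range E\<close> card_image[OF \<open>inj E\<close>] card by (simp add: B_def)
  have "pairwise orthogonal B"
    unfolding B_def pairwise_insert orthogonal_def using EN EN' on by (auto simp: pairwise_def orthogonal_def)
  moreover have "0 \<notin> B" unfolding B_def using nN on by (metis imageE insert_iff inner_zero_left zero_neq_one)
  ultimately have "independent B" by (rule pairwise_orthogonal_independent)
  then have "dim B = CARD('m)" using cB dim_eq_card_independent by metis
  then have sB: "span B = UNIV" using dim_eq_full[of B] by simp
  define q where "q = y - (nu \<bullet> y) *\<^sub>R nu - (\<Sum>i. (E i \<bullet> y) *\<^sub>R E i)"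
  have "orthogonal q b" if "b \<in> B" for b
  proof -
    have "nu \<bullet> q = 0"
      by (simp add: q_def inner_diff_right inner_sum_right nN EN)
    then have "q \<bullet> nu = 0" by (simp add: inner_commute)
    moreover have "q \<bullet> E j = 0" for j
      by (simp add: q_def inner_diff_left inner_sum_left EN on if_distrib[of "\<lambda>t. _ * t"] inner_commute[of y] cong: if_cong)
    ultimately show ?thesis using that by (auto simp: B_def orthogonal_def)
  qed
  then have "orthogonal q q" using orthogonal_to_span[of q B q] sB by blast
  then have "y = (nu \<bullet> y) *\<^sub>R nu + (\<Sum>i. (E i \<bullet> y) *\<^sub>R E i)"
    by (simp add: orthogonal_self q_def algebra_simps)
  then have "y \<bullet> z = ((nu \<bullet> y) *\<^sub>R nu + (\<Sum>i. (E i \<bullet> y) *\<^sub>R E i)) \<bullet> z" by metis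
  then show ?thesis by (simp add: inner_add_left inner_sum_left)
qed

text \<open>The Parseval identity for the basis vectors and the rows of \<open>C\<close>; the correction term is a component of \<open>C *v nu = 0\<close>.\<close>

lemma trace_by_frame:
  fixes E :: "'n::finite \<Rightarrow> real^'m::finite" and C :: "real^'m^'m"
  assumes P: "\<And>y z. (\<Sum>i. (E i \<bullet> y) * (E i \<bullet> z)) = y \<bullet> z - (nu \<bullet> y) * (nu \<bullet> z)"
    and CN: "C *v nu = 0"
  shows "(\<Sum>i. E i \<bullet> (C *v E i)) = trace C"
proof -
  have "E i \<bullet> (C *v E i) = (\<Sum>a. (E i \<bullet> axis a 1) * (E i \<bullet> row a C))" for i
    by (simp add: inner_vec_def matrix_vector_mult_def row_def axis_def mult.commute if_distrib[of "\<lambda>t. t * _"] cong: if_cong)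
  then have "(\<Sum>i. E i \<bullet> (C *v E i)) = (\<Sum>a. \<Sum>i. (E i \<bullet> axis a 1) * (E i \<bullet> row a C))"
    by (simp only:) (rule sum.swap)
  also have "\<dots> = (\<Sum>a. axis a 1 \<bullet> row a C)"
  proof (rule sum.cong[OF refl])
    fix a
    have "nu \<bullet> row a C = (C *v nu) $ a" by (simp add: matrix_vector_mult_def inner_vec_def row_def mult.commute)
    then show "(\<Sum>i. (E i \<bullet> axis a 1) * (E i \<bullet> row a C)) = axis a 1 \<bullet> row a C"
      using P[of "axis a 1" "row a C"] CN by simp
  qed
  also have "\<dots> = trace C" by (simp add: trace_def inner_axis' row_def)
  finally show ?thesis .
qed

context hypersurface_patch begin

lemma frechet_N:
  assumes x: "x \<in> S"
  shows "frechet_derivative N (at x) w $ b = - (\<Sum>a. frechet_derivative X (at x) w $ a * A a b x)"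
proof -
  let ?v = "frechet_derivative X (at x) w"
  have "((\<lambda>y. N y $ b) has_derivative (\<lambda>v. frechet_derivative N (at x) v $ b)) (at x)"
    by (rule bounded_linear.has_derivative[OF bounded_linear_vec_nth smooth_on_has_derivative[OF smooth_N x]])
  then have "(Nc b has_derivative (\<lambda>v. frechet_derivative N (at x) v $ b)) (at x)"
    by (simp add: Nc_def[abs_def])
  then have 1: "frechet_derivative N (at x) w $ b = frechet_derivative (Nc b) (at x) w"
    using frechet_derivative_at by metis
  have "frechet_derivative (Nc b) (at x) w = frechet_derivative (Nc b) (at x) (\<Sum>a. ?v $ a *\<^sub>R V a x)"
    using tangent_expansion[OF x, of w] by simp
  also have "\<dots> = (\<Sum>a. ?v $ a * \<delta> a (Nc b) x)"
    by (simp add: linear_sum[OF delta_linear[OF x smooth_Nc]] linear_cmul[OF delta_linear[OF x smooth_Nc]] dirderiv_def)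
  finally show ?thesis unfolding 1 by (simp add: delta_N[OF x] sum_negf)
qed

text \<open>In an orthonormal frame \<open>h\<close> is the matrix of the extended shape operator restricted to the tangent space.  As that operator vanishes on the normal, its power traces can be computed in the standard basis as well.\<close>

lemma frame_invariants:
  fixes w :: "'n \<Rightarrow> real^'n"
  assumes x: "x \<in> S" and E: "\<And>i. E i = frechet_derivative X (at x) (w i)"
    and on: "\<And>i j. E i \<bullet> E j = (if i = j then 1 else 0)"
    and h: "\<And>i j. h i j = - (frechet_derivative N (at x) (w i) \<bullet> E j)"
  shows "(\<Sum>i. h i i) = H x" "(\<Sum>i. \<Sum>j. (h i j)\<^sup>2) = sq x"
    "(\<Sum>i. \<Sum>j. \<Sum>k. h i j * h j k * h k i) = F3 x"
proof -
  define B where "B = (\<chi> a b. A a b x)"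
  have NN': "N x \<bullet> N x = 1" using norm_N[OF x] by (simp add: norm_eq_1)
  have NE: "N x \<bullet> E i = 0" for i using N_orth[OF x] by (simp add: E)
  note P = parseval_hyperplane[OF on NN' NE card_m]
  have hB: "h i j = E i \<bullet> (B *v E j)" for i j
    unfolding h inner_vec_def frechet_N[OF x] B_def matrix_vector_mult_def
    by (simp add: E[symmetric] sum_distrib_left sum_distrib_right sum_negf) (subst sum.swap, simp add: mult.assoc)
  have BN: "B *v N x = 0"
    using sum_A_N[OF x] by (simp add: B_def matrix_vector_mult_def vec_eq_iff Nc_def)
  have Bs: "(B *v y) \<bullet> z = y \<bullet> (B *v z)" for y z
    unfolding inner_vec_def B_def matrix_vector_mult_def
    by (simp add: sum_distrib_left sum_distrib_right) (subst sum.swap, simp add: A_sym[OF x] mult.commute mult.left_commute)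
  have NB: "N x \<bullet> (B *v y) = 0" for y using Bs[of "N x" y] BN by simp
  have "(\<Sum>i. h i i) = trace B" unfolding hB by (rule trace_by_frame[OF P BN])
  then show "(\<Sum>i. h i i) = H x" by (simp add: trace_def B_def H_def)
  have hh: "(\<Sum>i. (E i \<bullet> (B *v y)) * (E i \<bullet> z)) = y \<bullet> (B *v z)" for y z
    using P[of "B *v y" z] NB[of y] Bs[of y z] by simp
  have h_sym: "h i j = h j i" for i j unfolding hB using Bs[of "E j" "E i"] by (simp add: inner_commute)
  have "(\<Sum>i. \<Sum>j. (h i j)\<^sup>2) = (\<Sum>j. \<Sum>i. (E i \<bullet> (B *v E j)) * (E i \<bullet> (B *v E j)))"
    by (subst sum.swap) (simp add: hB power2_eq_square)
  also have "\<dots> = (\<Sum>j. E j \<bullet> ((B ** B) *v E j))" unfolding hh by (simp add: matrix_vector_mul_assoc)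
  also have "\<dots> = trace (B ** B)"
    by (rule trace_by_frame[OF P]) (simp add: BN flip: matrix_vector_mul_assoc)
  also have "\<dots> = sq x"
    unfolding trace_def B_def matrix_matrix_mult_def sq_def power2_eq_square
    by (simp add: A_sym[OF x, of _ "_"])
  finally show "(\<Sum>i. \<Sum>j. (h i j)\<^sup>2) = sq x" .
  have "(\<Sum>j. \<Sum>k. h i j * h j k * h k i) = E i \<bullet> ((B ** B ** B) *v E i)" for i
  proof -
    have "(\<Sum>j. \<Sum>k. h i j * h j k * h k i) = (\<Sum>j. h j i * (\<Sum>k. h k j * h k i))"
      by (simp add: sum_distrib_left h_sym[of i] h_sym[of _ j for j] mult.assoc)
    also have "\<dots> = (\<Sum>j. (E j \<bullet> (B *v E i)) * (E j \<bullet> (B *v (B *v E i))))"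
      unfolding hB hh ..
    also have "\<dots> = E i \<bullet> (B *v (B *v (B *v E i)))" by (rule hh)
    finally show ?thesis by (simp add: matrix_vector_mul_assoc matrix_mul_assoc)
  qed
  then have "(\<Sum>i. \<Sum>j. \<Sum>k. h i j * h j k * h k i) = (\<Sum>i. E i \<bullet> ((B ** B ** B) *v E i))"
    by simp
  also have "\<dots> = trace (B ** B ** B)"
    by (rule trace_by_frame[OF P]) (simp add: BN flip: matrix_vector_mul_assoc)
  also have "\<dots> = F3 x"
    unfolding trace_def B_def matrix_matrix_mult_def F3_def
    by (simp add: sum_distrib_right) (subst sum.swap, simp)
  finally show "(\<Sum>i. \<Sum>j. \<Sum>k. h i j * h j k * h k i) = F3 x" .
qed

end

abbreviation coords :: "('a \<Rightarrow> 'b) \<Rightarrow> 'a set \<Rightarrow> ('a \<Rightarrow> 'c) \<Rightarrow> 'c \<Rightarrow> 'b" where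
  "coords f U c \<equiv> f \<circ> inv_into U c"

lemma chart_facts:
  fixes c :: "'a \<Rightarrow> real^'n::finite"
  assumes "is_chart M (U, c)"
  shows "openin M U" "U \<subseteq> topspace M" "open (c ` U)" "inj_on c U" "\<And>q. q \<in> U \<Longrightarrow> inv_into U c (c q) = q"
    "\<And>x. x \<in> c ` U \<Longrightarrow> inv_into U c x \<in> U" "\<And>x. x \<in> c ` U \<Longrightarrow> c (inv_into U c x) = x"
proof -
  have hm: "homeomorphic_map (subtopology M U) (top_of_set (c ` U)) c" and o: "openin M U" "open (c ` U)"
    using assms by (auto simp: is_chart_def)
  show "openin M U" "open (c ` U)" by fact+
  show sub: "U \<subseteq> topspace M" using o openin_subset by blast
  then have "topspace (subtopology M U) = U" by auto
  then show i: "inj_on c U" using hm by (metis homeomorphic_imp_injective_map)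
  show "inv_into U c (c q) = q" if "q \<in> U" for q using i that by simp
  show "inv_into U c x \<in> U" if "x \<in> c ` U" for x using that by (rule inv_into_into)
  show "c (inv_into U c x) = x" if "x \<in> c ` U" for x using that by (rule f_inv_into_f)
qed

lemma chart_preimage_open:
  fixes c :: "'a \<Rightarrow> real^'n::finite"
  assumes C: "is_chart M (U, c)" and "open O'"
  shows "openin M {q \<in> U. c q \<in> O'}"
proof -
  have hm: "homeomorphic_map (subtopology M U) (top_of_set (c ` U)) c"
    using assms by (auto simp: is_chart_def)
  have "continuous_map (subtopology M U) euclidean c"
    using homeomorphic_imp_continuous_map[OF hm] continuous_map_in_subtopology by blast
  then have "openin (subtopology M U) {q \<in> topspace (subtopology M U). c q \<in> O'}"
    by (rule openin_continuous_map_preimage) (use assms(2) in simp)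
  then have "openin M {q \<in> topspace (subtopology M U). c q \<in> O'}"
    using chart_facts(1)[OF C] openin_trans_full by blast
  moreover have "{q \<in> topspace (subtopology M U). c q \<in> O'} = {q \<in> U. c q \<in> O'}"
    using chart_facts(2)[OF C] by auto
  ultimately show ?thesis by simp
qed

lemma chart_image_open:
  fixes c :: "'a \<Rightarrow> real^'n::finite"
  assumes C: "is_chart M (U, c)" and O: "openin M O'"
  shows "open (c ` (U \<inter> O'))"
proof -
  have hm: "homeomorphic_map (subtopology M U) (top_of_set (c ` U)) c"
    using C by (auto simp: is_chart_def)
  have "openin (subtopology M U) (U \<inter> O')"
    using O by (metis inf_commute openin_subtopology)
  then have "openin (top_of_set (c ` U)) (c ` (U \<inter> O'))"
    using homeomorphic_imp_open_map[OF hm] by (simp add: open_map_def)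
  then show ?thesis using chart_facts(3)[OF C] openin_open_eq by blast
qed

text \<open>The chain rule for the transition map, valid on the open set of coordinates of the overlap.\<close>

lemma tangent_map_chart_change:
  fixes f :: "'a \<Rightarrow> real^'m::finite" and A :: "('a, 'n::finite) chart set"
  assumes A: "smooth_atlas M A" and f: "smooth_map A f" and C: "(U, c) \<in> A" "(U0, c0) \<in> A"
    and p: "p \<in> U" "p \<in> U0"
  shows "tangent_map (U0, c0) f p v = tangent_map (U, c) f p (frechet_derivative (coords c U0 c0) (at (c0 p)) v)"
proof -
  have ch: "is_chart M (U, c)" "is_chart M (U0, c0)" using A C by (auto simp: smooth_atlas_def)
  define O' where "O' = c0 ` (U0 \<inter> U)"
  have O': "open O'" unfolding O'_def by (rule chart_image_open[OF ch(2) chart_facts(1)[OF ch(1)]])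
  have c0p: "c0 p \<in> O'" using p by (auto simp: O'_def)
  have inv0: "inv_into U0 c0 (c0 p) = p" using chart_facts(5)[OF ch(2) p(2)] .
  have "smooth_on O' (coords c U0 c0)"
    using A C unfolding smooth_atlas_def O'_def by (metis (no_types, lifting) case_prodD)
  then have 1: "((coords c U0 c0) has_derivative frechet_derivative (coords c U0 c0) (at (c0 p))) (at (c0 p))"
    using smooth_on_has_derivative c0p by blast
  have "smooth_on (c ` U) (coords f U c)" using f C by (auto simp: smooth_map_def)
  then have 2: "((coords f U c) has_derivative frechet_derivative (coords f U c) (at (c p))) (at (c p))"
    using smooth_on_has_derivative p by blast
  have eq0: "(coords c U0 c0) (c0 p) = c p" using inv0 by simp
  have d: "((\<lambda>x. (coords f U c) ((coords c U0 c0) x)) has_derivative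
     (\<lambda>v. frechet_derivative (coords f U c) (at (c p)) (frechet_derivative (coords c U0 c0) (at (c0 p)) v))) (at (c0 p))"
    by (rule has_derivative_compose[OF 1 2[folded eq0], unfolded eq0])
  have eq: "(coords f U c) ((coords c U0 c0) x) = (coords f U0 c0) x" if x: "x \<in> O'" for x
  proof -
    obtain q where q: "q \<in> U0" "q \<in> U" "x = c0 q" using x by (auto simp: O'_def)
    then show ?thesis using chart_facts(5)[OF ch(1)] chart_facts(5)[OF ch(2)] by simp
  qed
  have D: "((coords f U0 c0) has_derivative
     (\<lambda>v. frechet_derivative (coords f U c) (at (c p)) (frechet_derivative (coords c U0 c0) (at (c0 p)) v))) (at (c0 p))"
    by (rule iffD1[OF has_derivative_cong_open[OF O' c0p eq] d])
  show ?thesis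
    using fun_cong[OF frechet_derivative_at[OF D], of v] by (simp only: tangent_map_def prod.case)
qed

lemma exists_orthonormal_frame:
  fixes X :: "'a \<Rightarrow> real^'m::finite" and C :: "('a, 'n::finite) chart"
  assumes lin: "linear (tangent_map C X p)" and inj: "inj (tangent_map C X p)"
  shows "\<exists>e. orthonormal_frame_at C X p e"
proof -
  let ?D = "tangent_map C X p"
  have sub: "subspace (range ?D)" by (rule linear_subspace_image[OF lin subspace_UNIV])
  have dimR: "dim (range ?D) = CARD('n)"
    using dim_image_eq[OF lin, of UNIV] inj by (simp add: inj_on_def inj_def)
  obtain B where B: "B \<subseteq> range ?D" "pairwise orthogonal B" "\<And>x. x \<in> B \<Longrightarrow> norm x = 1" "independent B" "card B = dim (range ?D)"
    using orthonormal_basis_subspace[OF sub] by metis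
  have "finite B" using B(4) independent_bound by blast
  then obtain f :: "'n \<Rightarrow> real^'m" where f: "bij_betw f UNIV B"
    using finite_same_card_bij[of "UNIV :: 'n set" B] B(5) dimR by auto
  have fB: "f i \<in> B" for i using f by (auto simp: bij_betw_def)
  have "\<exists>v. ?D v = f i" for i using fB[of i] B(1) by (metis imageE subsetD)
  then obtain e where e: "\<And>i. ?D (e i) = f i" by metis
  have "f i \<bullet> f j = (if i = j then 1 else 0)" for i j
  proof (cases "i = j")
    case True then show ?thesis using B(3)[OF fB[of i]] by (simp add: norm_eq_1)
  next
    case False
    then have "f i \<noteq> f j" using f by (auto simp: bij_betw_def inj_def)
    then show ?thesis using B(2) fB False by (auto simp: pairwise_def orthogonal_def)
  qed
  then show ?thesis unfolding orthonormal_frame_at_def by (intro exI[of _ e] allI) (simp only: e)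
qed

section \<open>Compact immersed hypersurfaces\<close>

lemma sumsq_op_cong:
  assumes "open S" "x \<in> S" "\<And>y. y \<in> S \<Longrightarrow> f y = g y"
  shows "sumsq_op V b f x = sumsq_op V b g x"
proof -
  have d: "dirderiv W f y = dirderiv W g y" if "y \<in> S" for W y
    by (rule dirderiv_cong[OF assms(1) that assms(3)])
  have "dirderiv W (dirderiv W f) x = dirderiv W (dirderiv W g) x" for W
    by (rule dirderiv_cong[OF assms(1,2) d])
  then show ?thesis by (simp add: sumsq_op_def d[OF assms(2)])
qed

lemma (in hypersurface_patch) sumsq_op_const_minus:
  assumes x: "x \<in> S" and f: "smooth_on S f"
  shows "sumsq_op V (\<lambda>_ _. 0) (\<lambda>y. k - f y) x = - Lap f x"
proof -
  have d: "\<delta> a (\<lambda>y. k - f y) y = - \<delta> a f y" if "y \<in> S" for a y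
    by (simp add: d_diff[OF that] f)
  have "\<delta> a (\<delta> a (\<lambda>y. k - f y)) x = - \<delta> a (\<delta> a f) x" for a
  proof -
    have "\<delta> a (\<delta> a (\<lambda>y. k - f y)) x = \<delta> a (\<lambda>y. - \<delta> a f y) x" by (rule d_cong[OF x d])
    then show ?thesis by (simp add: d_uminus[OF x] smooth_delta f)
  qed
  then show ?thesis by (simp add: sumsq_op_def Lap_def sum_negf)
qed

locale immersed_hypersurface =
  fixes M :: "'a topology" and A :: "('a, 'n::finite) chart set" and X N :: "'a \<Rightarrow> real ^ 'm::finite"
  assumes card_m: "CARD('m) = CARD('n) + 1" and manifold: "smooth_manifold M A" and connected: "connected_space M"
    and immersion: "smooth_immersion A X" and normal: "unit_normal_field A X N" and compact: "compact_space M"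
begin

lemma atlas: "smooth_atlas M A" and nonempty: "topspace M \<noteq> {}" and Hausdorff: "Hausdorff_space M"
  using manifold unfolding smooth_manifold_def by blast+

lemma chart: "(U, c) \<in> A \<Longrightarrow> is_chart M (U, c)"
  using atlas by (auto simp: smooth_atlas_def)

lemma chart_cover: assumes "p \<in> topspace M" obtains U c where "(U, c) \<in> A" "p \<in> U"
proof -
  have "p \<in> (\<Union>C\<in>A. fst C)" using atlas assms unfolding smooth_atlas_def by blast
  then obtain C where "C \<in> A" "p \<in> fst C" by blast
  then show ?thesis using that[of "fst C" "snd C"] by simp
qed

lemma smooth_X: "smooth_map A X" and smooth_N: "smooth_map A N"
  using immersion normal by (auto simp: smooth_immersion_def unit_normal_field_def)

lemma patch:
  assumes C: "(U, c) \<in> A"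
  shows "hypersurface_patch (c ` U) (coords X U c) (coords N U c)"
proof
  show "open (c ` U)" using chart_facts(3)[OF chart[OF C]] .
  show "smooth_on (c ` U) (coords X U c)" "smooth_on (c ` U) (coords N U c)"
    using smooth_X smooth_N C by (auto simp: smooth_map_def)
  show "CARD('m) = CARD('n) + 1" by (rule card_m)
  fix x assume x: "x \<in> c ` U"
  define p where "p = inv_into U c x"
  have p: "p \<in> U" "c p = x" using chart_facts(6,7)[OF chart[OF C] x] by (auto simp: p_def)
  have t: "tangent_map (U, c) f p = frechet_derivative (coords f U c) (at x)" for f :: "'a \<Rightarrow> real^'m"
    using p by (simp add: tangent_map_def)
  show "inj (frechet_derivative (coords X U c) (at x))"
  proof -
    have "\<forall>p\<in>fst (U, c). inj (tangent_map (U, c) X p)"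
      using immersion C unfolding smooth_immersion_def by blast
    then show ?thesis using p(1) t[of X] by (metis fst_conv)
  qed
  have nf: "norm (N p) = 1 \<and> (\<forall>v. N p \<bullet> tangent_map (U, c) X p v = 0)"
  proof -
    have "\<forall>p\<in>fst (U, c). norm (N p) = 1 \<and> (\<forall>v. N p \<bullet> tangent_map (U, c) X p v = 0)"
      using normal C unfolding unit_normal_field_def by blast
    then show ?thesis using p(1) by simp
  qed
  show "norm ((coords N U c) x) = 1" using nf by (simp add: p_def)
  show "(coords N U c) x \<bullet> frechet_derivative (coords X U c) (at x) v = 0" for v
    using nf t[of X] by (simp add: p_def)
qed

text \<open>The frame chosen at each point may belong to another chart.  Expressing it in the chart at hand shows that the invariants agree with the smooth functions of the tangential calculus.\<close>

lemma curvatures_in_chart: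
  assumes C: "(U, c) \<in> A" and p: "p \<in> U"
  shows "mean_curvature A X N p = hypersurface_patch.H (coords X U c) (coords N U c) (c p)"
    "sq_norm_sff A X N p = hypersurface_patch.sq (coords X U c) (coords N U c) (c p)"
    "f3 A X N p = hypersurface_patch.F3 (coords X U c) (coords N U c) (c p)"
proof -
  interpret P: hypersurface_patch "c ` U" "coords X U c" "coords N U c" by (rule patch[OF C])
  have x: "c p \<in> c ` U" using p by simp
  have "linear (tangent_map (U, c) X p)" using P.linear_dX[OF x] by (simp add: tangent_map_def)
  moreover have "inj (tangent_map (U, c) X p)" using P.inj_dX[OF x] by (simp add: tangent_map_def)
  ultimately obtain e' where "orthonormal_frame_at (U, c) X p e'" using exists_orthonormal_frame[of "(U, c)" X p] by blast
  then have ex: "\<exists>y. case y of (C, e) \<Rightarrow> C \<in> A \<and> p \<in> fst C \<and> orthonormal_frame_at C X p e"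
    using C p by (intro exI[of _ "((U, c), e')"]) simp
  obtain U0 c0 e where cf: "chosen_frame A X p = ((U0, c0), e)" by (metis surj_pair)
  have C0: "(U0, c0) \<in> A" "p \<in> U0" and on: "orthonormal_frame_at (U0, c0) X p e"
    using someI_ex[OF ex] cf by (auto simp: chosen_frame_def)
  define w where "w i = frechet_derivative (coords c U0 c0) (at (c0 p)) (e i)" for i
  define E where "E i = tangent_map (U0, c0) X p (e i)" for i
  have t: "tangent_map (U, c) f p = frechet_derivative (coords f U c) (at (c p))" for f :: "'a \<Rightarrow> real^'m"
    by (simp add: tangent_map_def)
  have E: "E i = frechet_derivative (coords X U c) (at (c p)) (w i)" for i
    unfolding E_def w_def using tangent_map_chart_change[OF atlas smooth_X C C0(1) p C0(2)] by (simp add: t)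
  have on': "E i \<bullet> E j = (if i = j then 1 else 0)" for i j
    using on by (simp add: orthonormal_frame_at_def E_def)
  have h: "second_fundamental_form A X N p i j = - (frechet_derivative (coords N U c) (at (c p)) (w i) \<bullet> E j)" for i j
    unfolding second_fundamental_form_def cf w_def
    using tangent_map_chart_change[OF atlas smooth_N C C0(1) p C0(2)] by (simp add: t E_def)
  note fi = P.frame_invariants[OF x E on' h]
  show "mean_curvature A X N p = P.H (c p)" "sq_norm_sff A X N p = P.sq (c p)" "f3 A X N p = P.F3 (c p)"
    using fi by (simp_all add: mean_curvature_def sq_norm_sff_def f3_def)
qed

lemma clopen_in_charts:
  assumes "Z \<subseteq> topspace M" "Z \<noteq> {}"
    and o: "\<And>U c. (U, c) \<in> A \<Longrightarrow> open (c ` (U \<inter> Z))" "\<And>U c. (U, c) \<in> A \<Longrightarrow> open (c ` (U - Z))"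
  shows "Z = topspace M"
proof -
  have op: "openin M Y" if Y: "Y \<subseteq> topspace M" "\<And>U c. (U, c) \<in> A \<Longrightarrow> open (c ` (U \<inter> Y))" for Y
  proof (subst openin_subopen, intro ballI)
    fix p assume p: "p \<in> Y"
    obtain U c where C: "(U, c) \<in> A" "p \<in> U" using chart_cover Y(1) p by blast
    have "openin M {q \<in> U. c q \<in> c ` (U \<inter> Y)}"
      by (rule chart_preimage_open[OF chart[OF C(1)] Y(2)[OF C(1)]])
    moreover have "{q \<in> U. c q \<in> c ` (U \<inter> Y)} = U \<inter> Y"
      using chart_facts(4)[OF chart[OF C(1)]] by (auto dest: inj_onD)
    ultimately show "\<exists>T. openin M T \<and> p \<in> T \<and> T \<subseteq> Y" using p C by auto
  qed
  have "openin M Z" by (rule op[OF assms(1) o(1)])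
  moreover have "openin M (topspace M - Z)"
  proof (rule op)
    fix U c assume C: "(U, c) \<in> A"
    have "U \<inter> (topspace M - Z) = U - Z" using chart_facts(2)[OF chart[OF C]] by auto
    then show "open (c ` (U \<inter> (topspace M - Z)))" using o(2)[OF C] by simp
  qed auto
  ultimately show ?thesis
    using connected assms(1,2) unfolding connected_space_clopen_in closedin_def by blast
qed

lemma continuous_map_from_charts:
  fixes f :: "'a \<Rightarrow> 'b::topological_space"
  assumes "\<And>U c. (U, c) \<in> A \<Longrightarrow> continuous_on (c ` U) (coords f U c)"
  shows "continuous_map M euclidean f"
  unfolding continuous_map_def
proof (intro conjI allI impI)
  show "f \<in> topspace M \<rightarrow> topspace euclidean" by simp
  fix W :: "'b set" assume "openin euclidean W"
  then have W: "open W" by simp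
  show "openin M {p \<in> topspace M. f p \<in> W}"
  proof (subst openin_subopen, intro ballI)
    fix p assume p: "p \<in> {p \<in> topspace M. f p \<in> W}"
    then obtain U c where C: "(U, c) \<in> A" "p \<in> U" using chart_cover by blast
    note cf = chart_facts[OF chart[OF C(1)]]
    define O' where "O' = c ` U \<inter> (coords f U c) -` W"
    have "open O'" unfolding O'_def by (rule continuous_open_preimage[OF assms[OF C(1)] cf(3) W])
    then have "openin M {q \<in> U. c q \<in> O'}" by (rule chart_preimage_open[OF chart[OF C(1)]])
    moreover have "c q \<in> O' \<longleftrightarrow> f q \<in> W" if "q \<in> U" for q using that by (simp add: O'_def cf(5)[OF that])
    then have "{q \<in> U. c q \<in> O'} = {q \<in> U. f q \<in> W}" by blast
    ultimately show "\<exists>T. openin M T \<and> p \<in> T \<and> T \<subseteq> {p \<in> topspace M. f p \<in> W}"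
      using p C cf(2) by (intro exI[of _ "{q \<in> U. f q \<in> W}"]) auto
  qed
qed

lemma attains_max:
  fixes f :: "'a \<Rightarrow> real"
  assumes "\<And>U c. (U, c) \<in> A \<Longrightarrow> continuous_on (c ` U) (coords f U c)"
  obtains p where "p \<in> topspace M" "\<And>q. q \<in> topspace M \<Longrightarrow> f q \<le> f p"
proof -
  have "continuous_map M euclidean f" by (rule continuous_map_from_charts[OF assms])
  then have "compactin euclidean (f ` topspace M)"
    using compact image_compactin unfolding compact_space_def by blast
  then have "Topological_Spaces.compact (f ` topspace M)" by simp
  moreover have "f ` topspace M \<noteq> {}" using nonempty by simp
  ultimately obtain s where "s \<in> f ` topspace M" "\<forall>t\<in>f ` topspace M. t \<le> s"
    using compact_attains_sup by blast
  then show ?thesis using that by blast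
qed

text \<open>In every chart the zero set is open by the strong minimum principle and its complement by continuity, and \<open>M\<close> is connected.\<close>

lemma global_minimum_principle:
  fixes f :: "'a \<Rightarrow> real"
  assumes nn: "\<And>p. p \<in> topspace M \<Longrightarrow> f p \<ge> 0" and p0: "p0 \<in> topspace M" "f p0 = 0"
    and loc: "\<And>U c. (U, c) \<in> A \<Longrightarrow> \<exists>b C. smooth_on (c ` U) (coords f U c) \<and> (\<forall>a. continuous_on (c ` U) (b a)) \<and>
       continuous_on (c ` U) C \<and>
       (\<forall>x\<in>c ` U. sumsq_op (hypersurface_patch.V (coords X U c)) b (coords f U c) x \<le> C x * (coords f U c) x)"
    and p: "p \<in> topspace M"
  shows "f p = 0"
proof -
  define Z where "Z = {p \<in> topspace M. f p = 0}"
  have "Z = topspace M"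
  proof (rule clopen_in_charts)
    show "Z \<subseteq> topspace M" "Z \<noteq> {}" using p0 by (auto simp: Z_def)
    fix U c assume C: "(U, c) \<in> A"
    note cf = chart_facts[OF chart[OF C]]
    interpret P: hypersurface_patch "c ` U" "coords X U c" "coords N U c" by (rule patch[OF C])
    obtain b K where bK: "smooth_on (c ` U) (coords f U c)" "\<And>a. continuous_on (c ` U) (b a)" "continuous_on (c ` U) K"
      "\<And>x. x \<in> c ` U \<Longrightarrow> sumsq_op P.V b (coords f U c) x \<le> K x * (coords f U c) x"
      using loc[OF C] by blast
    have "open {x \<in> c ` U. (coords f U c) x = 0}"
    proof (rule strong_minimum_principle[where V = P.V and b = b and C = K])
      show "(coords f U c) x \<ge> 0" if "x \<in> c ` U" for x using nn cf(2,6) that by (metis comp_apply subsetD)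
      show "\<xi> = 0" if "x \<in> c ` U" "\<And>a. P.V a x \<bullet> \<xi> = 0" for x \<xi> using P.V_span that by blast
    qed (rule P.open_S P.smooth_V bK | assumption)+
    moreover have "c ` (U \<inter> Z) = {x \<in> c ` U. (coords f U c) x = 0}"
      using cf(2,5) by (auto simp: Z_def)
    ultimately show "open (c ` (U \<inter> Z))" by simp
    have "open (c ` U \<inter> (coords f U c) -` (- {0}))"
      by (rule continuous_open_preimage[OF smooth_on_imp_continuous_on[OF bK(1)] cf(3)]) auto
    moreover have "c ` (U - Z) = c ` U \<inter> (coords f U c) -` (- {0})"
      using cf(2,5) by (auto simp: Z_def)
    ultimately show "open (c ` (U - Z))" by simp
  qed
  then show ?thesis using p by (auto simp: Z_def)
qed

text \<open>By \<open>sphere_chart_inverse\<close> the map \<open>X\<close> is open and locally injective.  Its image is thus open in the sphere, and closed by compactness, so it is the whole sphere.  Simple connectivity of the sphere, for \<open>n \<ge> 2\<close>, then makes \<open>X\<close> injective.\<close>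

lemma isometric_to_sphere_if_normal:
  assumes n: "CARD('n) \<ge> 2" and r: "r > 0" and XN: "\<And>p. p \<in> topspace M \<Longrightarrow> X p = - r *\<^sub>R N p"
  shows "isometric_to_round_sphere M A X r"
proof -
  have XN': "(coords X U c) x = - r *\<^sub>R (coords N U c) x" if "(U, c) \<in> A" "x \<in> c ` U" for U c x
    using XN chart_facts(2,6)[OF chart[OF that(1)]] that(2) by (metis comp_apply subsetD)
  have contX: "continuous_map M euclidean X"
  proof (rule continuous_map_from_charts)
    fix U c assume "(U, c) \<in> A"
    then have "smooth_on (c ` U) (coords X U c)" using smooth_X unfolding smooth_map_def by blast
    then show "continuous_on (c ` U) (coords X U c)" by (rule smooth_on_imp_continuous_on)
  qed
  have normX: "norm (X p) = r" if p: "p \<in> topspace M" for p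
  proof -
    obtain U c where "(U, c) \<in> A" "p \<in> U" using chart_cover[OF p] .
    then have "norm (N p) = 1" using normal unfolding unit_normal_field_def by force
    then show ?thesis using XN[OF p] r by simp
  qed
  have inverse: "\<exists>W T F. open W \<and> c p \<in> W \<and> W \<subseteq> c ` (U \<inter> O') \<and> inj_on (coords X U c) W \<and> open T \<and>
      T \<inter> sphere 0 r = (coords X U c) ` W \<and> smooth_on T F \<and> (\<forall>x\<in>W. F ((coords X U c) x) = x)"
    if C: "(U, c) \<in> A" "p \<in> U" and O': "openin M O'" "p \<in> O'" for U c p O'
  proof -
    interpret P: hypersurface_patch "c ` U" "coords X U c" "coords N U c" by (rule patch[OF C(1)])
    have "open (c ` (U \<inter> O'))" by (rule chart_image_open[OF chart[OF C(1)] O'(1)])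
    moreover have "c ` (U \<inter> O') \<subseteq> c ` U" "c p \<in> c ` (U \<inter> O')" using C O' by auto
    ultimately show ?thesis
      using P.sphere_chart_inverse[OF r XN'[OF C(1)], of "c ` (U \<inter> O')" "c p"] by metis
  qed
  have opn: "openin (top_of_set (sphere 0 r)) (X ` O')" if O': "openin M O'" for O'
  proof (subst openin_subopen, intro ballI)
    fix y assume "y \<in> X ` O'"
    then obtain p where p: "p \<in> O'" "y = X p" by auto
    then have "p \<in> topspace M" using O' openin_subset by blast
    then obtain U c where C: "(U, c) \<in> A" "p \<in> U" using chart_cover by blast
    note cf = chart_facts[OF chart[OF C(1)]]
    obtain W T F where W: "c p \<in> W" "W \<subseteq> c ` (U \<inter> O')" "open T" "T \<inter> sphere 0 r = (coords X U c) ` W"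
      using inverse[OF C O' p(1)] by metis
    have "openin (top_of_set (sphere 0 r)) (sphere 0 r \<inter> T)" using W(3) by blast
    moreover have "y \<in> (coords X U c) ` W" using W(1) p(2) cf(5)[OF C(2)] by (force intro: image_eqI[of _ _ "c p"])
    moreover have "(coords X U c) ` W \<subseteq> X ` O'" using W(2) cf(5) by fastforce
    ultimately show "\<exists>T. openin (top_of_set (sphere 0 r)) T \<and> y \<in> T \<and> T \<subseteq> X ` O'"
      using W(4) by (metis inf_commute)
  qed
  have m3: "3 \<le> DIM(real^'m)" using n card_m by simp
  have im: "X ` topspace M = sphere 0 r"
  proof -
    have "openin (top_of_set (sphere 0 r)) (X ` topspace M)" by (rule opn) simp
    moreover have "compactin euclidean (X ` topspace M)"
      using compact contX image_compactin unfolding compact_space_def by blast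
    then have "closed (X ` topspace M)" by (simp add: compact_imp_closed)
    then have "closedin (top_of_set (sphere 0 r)) (X ` topspace M)"
      using normX by (intro closed_subset) auto
    moreover have "Topological_Spaces.connected (sphere (0::real^'m) r)" using connected_sphere[of "0::real^'m" r] m3 by simp
    ultimately show ?thesis using nonempty unfolding connected_clopen by (metis image_is_empty)
  qed
  have inj: "inj_on X (topspace M)"
  proof (rule local_homeo_to_simply_connected_inj[OF compact Hausdorff connected contX im opn])
    fix p assume p: "p \<in> topspace M"
    then obtain U c where C: "(U, c) \<in> A" "p \<in> U" using chart_cover by blast
    note cf = chart_facts[OF chart[OF C(1)]]
    obtain W where W: "open W" "c p \<in> W" "W \<subseteq> c ` (U \<inter> U)" "inj_on (coords X U c) W"
      using inverse[OF C cf(1) C(2)] by metis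
    have "openin M {q \<in> U. c q \<in> W}" by (rule chart_preimage_open[OF chart[OF C(1)] W(1)])
    moreover have "inj_on X {q \<in> U. c q \<in> W}"
    proof (rule inj_onI)
      fix q q' assume q: "q \<in> {q \<in> U. c q \<in> W}" "q' \<in> {q \<in> U. c q \<in> W}" "X q = X q'"
      then have "(coords X U c) (c q) = (coords X U c) (c q')" using cf(5) by simp
      then have "c q = c q'" by (rule inj_onD[OF W(4)]) (use q in auto)
      then show "q = q'" using cf(4) q by (auto dest: inj_onD)
    qed
    ultimately show "\<exists>W. openin M W \<and> p \<in> W \<and> inj_on X W" using C W(2) by blast
  next
    show "simply_connected (sphere (0::real^'m) r)" using m3 by (rule simply_connected_sphere)
    show "locally path_connected (sphere (0::real^'m) r)" by (rule locally_path_connected_sphere)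
  qed
  have "diffeomorphism_onto M A X (sphere 0 r)"
    unfolding diffeomorphism_onto_def
  proof (intro conjI)
    show "bij_betw X (topspace M) (sphere 0 r)" using inj im by (simp add: bij_betw_def)
    show "smooth_map A X" by (rule smooth_X)
    show "\<forall>(U, c)\<in>A. \<forall>p\<in>U. \<exists>W F. open W \<and> X p \<in> W \<and> smooth_on W F \<and> (\<forall>q\<in>topspace M. X q \<in> W \<longrightarrow> q \<in> U \<and> F (X q) = c q)"
    proof (clarify)
      fix U c p assume C: "(U, c) \<in> A" "p \<in> U"
      note cf = chart_facts[OF chart[OF C(1)]]
      obtain W T F where W: "c p \<in> W" "W \<subseteq> c ` (U \<inter> U)" "open T" "T \<inter> sphere 0 r = (coords X U c) ` W"
          "smooth_on T F" "\<And>x. x \<in> W \<Longrightarrow> F ((coords X U c) x) = x"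
        using inverse[OF C cf(1) C(2)] by metis
      have "(coords X U c) (c p) \<in> T" using W(1,4) by blast
      then have pT: "X p \<in> T" using cf(5)[OF C(2)] by simp
      have "q \<in> U \<and> F (X q) = c q" if q: "q \<in> topspace M" "X q \<in> T" for q
      proof -
        have "X q \<in> (coords X U c) ` W" using q normX W(4) by fastforce
        then obtain x where x: "x \<in> W" "X q = X (inv_into U c x)" by auto
        have xU: "x \<in> c ` U" using x(1) W(2) by auto
        then have "inv_into U c x \<in> U" by (rule cf(6))
        then have "q = inv_into U c x" using inj q(1) x(2) cf(2) by (meson inj_onD subsetD)
        then show ?thesis using cf(6,7)[OF xU] W(6)[OF x(1)] by simp
      qed
      then show "\<exists>W F. open W \<and> X p \<in> W \<and> smooth_on W F \<and> (\<forall>q\<in>topspace M. X q \<in> W \<longrightarrow> q \<in> U \<and> F (X q) = c q)"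
        using W(3,5) pT by (intro exI[of _ T] exI[of _ F]) auto
    qed
  qed
  then have "riemannian_isometry_onto M A X X (sphere 0 r)"
    by (simp add: riemannian_isometry_onto_def)
  then show ?thesis using r unfolding isometric_to_round_sphere_def by blast
qed

end

section \<open>Rigidity\<close>

locale compact_lambda_hypersurface = immersed_hypersurface M A X N
  for M :: "'a topology" and A :: "('a, 'n::finite) chart set" and X N :: "'a \<Rightarrow> real ^ 'm::finite" +
  fixes lam :: real
  assumes lam_eq: "\<And>p. p \<in> topspace M \<Longrightarrow> X p \<bullet> N p + mean_curvature A X N p = lam"
    and n_ge_2: "CARD('n) \<ge> 2"
    and H_ge: "\<And>p. p \<in> topspace M \<Longrightarrow> mean_curvature A X N p - lam \<ge> 0"
    and f3_cond: "\<And>p. p \<in> topspace M \<Longrightarrow> lam * (f3 A X N p * (mean_curvature A X N p - lam) - sq_norm_sff A X N p) \<ge> 0"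
begin

text \<open>The support function with respect to \<open>- N\<close>; on a lambda-hypersurface it equals \<open>H - lam\<close>.\<close>

definition supp :: "'a \<Rightarrow> real" where "supp p = - (X p \<bullet> N p)"
definition rad :: "'a \<Rightarrow> real" where "rad p = (norm (X p))\<^sup>2 / 2"

lemma supp_eq: "p \<in> topspace M \<Longrightarrow> supp p = mean_curvature A X N p - lam"
  using lam_eq[of p] by (simp add: supp_def)

lemma u_in_chart: "hypersurface_patch.u (coords X U c) (coords N U c) = coords supp U c"
  if "(U, c) \<in> A" for U c
proof -
  interpret P: hypersurface_patch "c ` U" "coords X U c" "coords N U c" by (rule patch[OF that])
  show ?thesis by (simp add: fun_eq_iff P.u_def supp_def P.Xc_def P.Nc_def inner_vec_def)
qed

lemma R2_in_chart: "hypersurface_patch.R2 (coords X U c) = coords rad U c"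
  if "(U, c) \<in> A" for U c
proof -
  interpret P: hypersurface_patch "c ` U" "coords X U c" "coords N U c" by (rule patch[OF that])
  show ?thesis by (simp add: fun_eq_iff P.R2_norm rad_def)
qed

lemma chart_point:
  assumes C: "(U, c) \<in> A" and x: "x \<in> c ` U"
  shows "inv_into U c x \<in> U" "inv_into U c x \<in> topspace M" "c (inv_into U c x) = x"
  using chart_facts[OF chart[OF C]] x by auto

lemma patch_with_lambda:
  assumes C: "(U, c) \<in> A"
  shows "lambda_patch (c ` U) (coords X U c) (coords N U c) lam"
proof -
  interpret P: hypersurface_patch "c ` U" "coords X U c" "coords N U c" by (rule patch[OF C])
  show ?thesis
  proof
    fix x assume x: "x \<in> c ` U"
    note q = chart_point[OF C x]
    have "P.H x = mean_curvature A X N (inv_into U c x)"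
      using curvatures_in_chart(1)[OF C q(1)] q(3) by simp
    also have "\<dots> = supp (inv_into U c x) + lam" using supp_eq[OF q(2)] by simp
    also have "supp (inv_into U c x) = P.u x" using u_in_chart[OF C] by simp
    finally show "P.H x = P.u x + lam" .
  qed
qed

lemma supp_nonneg: "p \<in> topspace M \<Longrightarrow> supp p \<ge> 0"
  using supp_eq H_ge by simp

lemma sq_in_chart:
  assumes C: "(U, c) \<in> A" and x: "x \<in> c ` U"
  shows "hypersurface_patch.sq (coords X U c) (coords N U c) x = (coords (sq_norm_sff A X N) U c) x"
  using curvatures_in_chart(2)[OF C chart_point(1)[OF C x]] chart_point(3)[OF C x] by simp

lemma smooth_supp: "(U, c) \<in> A \<Longrightarrow> smooth_on (c ` U) (coords supp U c)"
  and smooth_rad: "(U, c) \<in> A \<Longrightarrow> smooth_on (c ` U) (coords rad U c)"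
  and smooth_sq_norm: "(U, c) \<in> A \<Longrightarrow> smooth_on (c ` U) (coords (sq_norm_sff A X N) U c)"
proof -
  assume C: "(U, c) \<in> A"
  interpret P: hypersurface_patch "c ` U" "coords X U c" "coords N U c" by (rule patch[OF C])
  show "smooth_on (c ` U) (coords supp U c)" using P.smooth_u u_in_chart[OF C] by simp
  show "smooth_on (c ` U) (coords rad U c)" using P.smooth_R2 R2_in_chart[OF C] by simp
  show "smooth_on (c ` U) (coords (sq_norm_sff A X N) U c)"
    by (rule iffD1[OF smooth_on_cong[OF P.open_S sq_in_chart[OF C]] P.smooth_sq])
qed

lemma farthest_point:
  obtains U c p where "(U, c) \<in> A" "p \<in> U" "p \<in> topspace M" "\<forall>q\<in>topspace M. rad q \<le> rad p"
proof -
  obtain p where p: "p \<in> topspace M" "\<And>q. q \<in> topspace M \<Longrightarrow> rad q \<le> rad p"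
    using attains_max[of rad] smooth_on_imp_continuous_on[OF smooth_rad] by blast
  obtain U c where "(U, c) \<in> A" "p \<in> U" using chart_cover[OF p(1)] .
  then show ?thesis using that p by blast
qed

text \<open>At a farthest point the Laplacian \<open>n - u H\<close> of half the squared distance is not positive.\<close>

lemma supp_pos_somewhere: "\<exists>p\<in>topspace M. supp p > 0"
proof -
  obtain p U c where p: "(U, c) \<in> A" "p \<in> U" "p \<in> topspace M" "\<forall>q\<in>topspace M. rad q \<le> rad p"
    using farthest_point by metis
  interpret P: lambda_patch "c ` U" "coords X U c" "coords N U c" lam by (rule patch_with_lambda[OF p(1)])
  have x: "c p \<in> c ` U" using p(2) by simp
  have mx: "P.R2 y \<le> P.R2 (c p)" if "y \<in> c ` U" for y
    using p(4)[rule_format] chart_point(2)[OF p(1) that] chart_facts(5)[OF chart[OF p(1)] p(2)] by (simp add: R2_in_chart[OF p(1)])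
  have "real CARD('n) \<le> P.u (c p) * P.H (c p)"
    using P.at_max_R2(1)[OF x mx] P.Lap_R2[OF x] by simp
  then have "P.u (c p) \<noteq> 0" using n_ge_2 by auto
  moreover have "P.u (c p) = supp p" using u_in_chart[OF p(1)] chart_facts(5)[OF chart[OF p(1)] p(2)] by simp
  ultimately show ?thesis using supp_nonneg[OF p(3)] p(3) by force
qed

text \<open>If \<open>lam > 0\<close>, the curvature hypothesis at a zero of \<open>u\<close> forces \<open>S = 0\<close>, so \<open>H = 0\<close> and \<open>u = - lam < 0\<close>.  If \<open>lam \<le> 0\<close>, then \<open>L u = (1 - S) u + lam \<le> u\<close>, and a zero would spread to all of \<open>M\<close>.\<close>

lemma supp_pos: assumes p: "p \<in> topspace M" shows "supp p > 0"
proof (rule ccontr)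
  assume "\<not> supp p > 0"
  then have p0: "supp p = 0" using supp_nonneg[OF p] by simp
  show False
  proof (cases "lam > 0")
    case True
    have "lam * (0 - sq_norm_sff A X N p) \<ge> 0"
      using f3_cond[OF p] supp_eq[OF p] p0 by simp
    then have "sq_norm_sff A X N p \<le> 0" using True by (simp add: mult_le_0_iff)
    then have "sq_norm_sff A X N p = 0" unfolding sq_norm_sff_def by (intro antisym sum_nonneg) auto
    then have "second_fundamental_form A X N p i i = 0" for i
      unfolding sq_norm_sff_def by (simp add: sum_nonneg_eq_0_iff sum_nonneg)
    then have "mean_curvature A X N p = 0" by (simp add: mean_curvature_def)
    then show False using supp_eq[OF p] p0 True by simp
  next
    case False
    have "supp q = 0" if q: "q \<in> topspace M" for q
    proof (rule global_minimum_principle[where f = supp, OF supp_nonneg p p0 _ q])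
      fix U c assume C: "(U, c) \<in> A"
      interpret P: lambda_patch "c ` U" "coords X U c" "coords N U c" lam by (rule patch_with_lambda[OF C])
      have "sumsq_op P.V (\<lambda>a y. - P.Xc a y) P.u x \<le> 1 * P.u x" if x: "x \<in> c ` U" for x
      proof -
        have "sumsq_op P.V (\<lambda>a y. - P.Xc a y) P.u x = P.L P.u x"
          by (simp add: sumsq_op_def P.L_def P.Lap_def P.drift_def sum_negf)
        also have "\<dots> = (1 - P.sq x) * P.u x + lam" by (rule P.L_u[OF x])
        also have "\<dots> \<le> 1 * P.u x"
        proof -
          have "P.u x \<ge> 0" using u_in_chart[OF C] supp_nonneg[OF chart_point(2)[OF C x]] by simp
          moreover have "P.sq x \<ge> 0" unfolding P.sq_def by (simp add: sum_nonneg)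
          ultimately have "P.sq x * P.u x \<ge> 0" by simp
          then show ?thesis using False by (simp add: algebra_simps)
        qed
        finally show ?thesis .
      qed
      moreover have "continuous_on (c ` U) (\<lambda>y. - P.Xc a y)" for a
        by (intro continuous_on_minus smooth_on_imp_continuous_on P.smooth_Xc)
      ultimately show "\<exists>b C. smooth_on (c ` U) (coords supp U c) \<and> (\<forall>a. continuous_on (c ` U) (b a)) \<and>
         continuous_on (c ` U) C \<and> (\<forall>x\<in>c ` U. sumsq_op P.V b (coords supp U c) x \<le> C x * (coords supp U c) x)"
        using smooth_supp[OF C] unfolding u_in_chart[OF C]
        by (intro exI[of _ "\<lambda>a y. - P.Xc a y"] exI[of _ "\<lambda>_. 1"] conjI allI ballI continuous_on_const)
    qed
    then show False using supp_pos_somewhere by force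
  qed
qed

lemma f3_cond_chart:
  assumes C: "(U, c) \<in> A" and x: "x \<in> c ` U"
  shows "lam * (hypersurface_patch.F3 (coords X U c) (coords N U c) x * (coords supp U c) x
    - (coords (sq_norm_sff A X N) U c) x) \<ge> 0"
  using f3_cond[OF chart_point(2)[OF C x]] curvatures_in_chart(3)[OF C chart_point(1)[OF C x]]
    supp_eq[OF chart_point(2)[OF C x]] chart_point(3)[OF C x] by simp

text \<open>Take \<open>K\<close> to be the maximum of \<open>S / u^2\<close>.  The pinching inequality first makes \<open>K u^2 - S\<close> vanish identically and then, read once more with zero on the right, makes the square in it vanish.\<close>

lemma rigidity:
  obtains K where "\<And>p. p \<in> topspace M \<Longrightarrow> sq_norm_sff A X N p = K * (supp p)\<^sup>2"
    "\<And>U c x i j k. (U, c) \<in> A \<Longrightarrow> x \<in> c ` U \<Longrightarrow>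
      hypersurface_patch.u (coords X U c) (coords N U c) x * hypersurface_patch.T (coords X U c) (coords N U c) k i j x
      = dirderiv (hypersurface_patch.V (coords X U c) k) (hypersurface_patch.u (coords X U c) (coords N U c)) x
        * hypersurface_patch.A (coords X U c) (coords N U c) i j x"
proof -
  have "continuous_on (c ` U) ((\<lambda>p. sq_norm_sff A X N p / (supp p)\<^sup>2) \<circ> inv_into U c)" if C: "(U, c) \<in> A" for U c
  proof -
    have "continuous_on (c ` U) (\<lambda>x. (coords (sq_norm_sff A X N) U c) x / ((coords supp U c) x)\<^sup>2)"
      using supp_pos[OF chart_point(2)[OF C]]
      by (intro continuous_on_divide continuous_on_power smooth_on_imp_continuous_on smooth_sq_norm[OF C] smooth_supp[OF C]) force
    then show ?thesis by (simp add: o_def)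
  qed
  then obtain p2 where p2: "p2 \<in> topspace M" "\<And>q. q \<in> topspace M \<Longrightarrow> sq_norm_sff A X N q / (supp q)\<^sup>2 \<le> sq_norm_sff A X N p2 / (supp p2)\<^sup>2"
    using attains_max[of "\<lambda>p. sq_norm_sff A X N p / (supp p)\<^sup>2"] by blast
  define K where "K = sq_norm_sff A X N p2 / (supp p2)\<^sup>2"
  define f where "f p = K * (supp p)\<^sup>2 - sq_norm_sff A X N p" for p
  have f_nonneg: "f p \<ge> 0" if "p \<in> topspace M" for p
    using p2(2)[OF that] supp_pos[OF that] by (simp add: f_def K_def[symmetric] divide_le_eq)
  have f0: "f p2 = 0" using supp_pos[OF p2(1)] by (simp add: f_def K_def)
  have pinch: "sumsq_op (hypersurface_patch.V (coords X U c)) (\<lambda>k y. - hypersurface_patch.Xc (coords X U c) k y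
       - 2 / (coords supp U c) y * dirderiv (hypersurface_patch.V (coords X U c) k) (coords supp U c) y) (coords f U c) x
     + 2 / ((coords supp U c) x)\<^sup>2 * (\<Sum>k. \<Sum>i. \<Sum>j\<in>UNIV.
         ((coords supp U c) x * hypersurface_patch.T (coords X U c) (coords N U c) k i j x
      - dirderiv (hypersurface_patch.V (coords X U c) k) (coords supp U c) x
        * hypersurface_patch.A (coords X U c) (coords N U c) i j x)\<^sup>2)
    \<le> (2 + 2 * \<bar>lam\<bar> / (coords supp U c) x) * (coords f U c) x"
    if C: "(U, c) \<in> A" and x: "x \<in> c ` U" for U c x
  proof -
    interpret P: lambda_patch "c ` U" "coords X U c" "coords N U c" lam by (rule patch_with_lambda[OF C])
    have u: "P.u = coords supp U c" by (rule u_in_chart[OF C])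
    have fP: "(coords f U c) y = K * (P.u y)\<^sup>2 - P.sq y" if "y \<in> c ` U" for y
      using sq_in_chart[OF C that] by (simp add: f_def u)
    have cg: "sumsq_op P.V b (coords f U c) x = sumsq_op P.V b (\<lambda>y. K * (P.u y)\<^sup>2 - P.sq y) x" for b
      by (rule sumsq_op_cong[OF P.open_S x fP])
    have "P.u x > 0" using supp_pos[OF chart_point(2)[OF C x]] by (simp add: u)
    moreover have "K * (P.u x)\<^sup>2 \<ge> P.sq x" using f_nonneg[OF chart_point(2)[OF C x]] fP[OF x] by simp
    moreover have "lam * (P.F3 x * P.u x - P.sq x) \<ge> 0"
      using f3_cond_chart[OF C x] sq_in_chart[OF C x] by (simp add: u)
    ultimately show ?thesis
      unfolding u[symmetric] cg fP[OF x] by (rule P.pinching_inequality[OF x])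
  qed
  have f_zero: "f p = 0" if p: "p \<in> topspace M" for p
  proof (rule global_minimum_principle[where f = f, OF f_nonneg p2(1) f0 _ p])
    fix U c assume C: "(U, c) \<in> A"
    interpret P: lambda_patch "c ` U" "coords X U c" "coords N U c" lam by (rule patch_with_lambda[OF C])
    define b where "b k y = - P.Xc k y - 2 / (coords supp U c) y * dirderiv (P.V k) (coords supp U c) y" for k y
    define K' where "K' y = 2 + 2 * \<bar>lam\<bar> / (coords supp U c) y" for y
    have nz: "(coords supp U c) y \<noteq> 0" if "y \<in> c ` U" for y
      using supp_pos[OF chart_point(2)[OF C that]] by simp
    have 1: "continuous_on (c ` U) (b k)" for k
      unfolding b_def by (intro continuous_on_diff continuous_on_minus continuous_on_mult continuous_on_divide continuous_on_const
          smooth_on_imp_continuous_on P.smooth_Xc P.smooth_delta smooth_supp[OF C]) (use nz in blast)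
    have 2: "continuous_on (c ` U) K'"
      unfolding K'_def by (intro continuous_on_add continuous_on_divide continuous_on_const smooth_on_imp_continuous_on smooth_supp[OF C]) (use nz in blast)
    have 3: "smooth_on (c ` U) (coords f U c)"
    proof -
      have "smooth_on (c ` U) (\<lambda>x. K * ((coords supp U c) x)\<^sup>2 - (coords (sq_norm_sff A X N) U c) x)"
        by (intro P.smooths smooth_supp[OF C] smooth_sq_norm[OF C])
      then show ?thesis by (simp add: f_def o_def)
    qed
    have 4: "sumsq_op P.V b (coords f U c) x \<le> K' x * (coords f U c) x" if x: "x \<in> c ` U" for x
    proof -
      have "0 \<le> 2 / ((coords supp U c) x)\<^sup>2 * (\<Sum>k. \<Sum>i. \<Sum>j\<in>UNIV.
         ((coords supp U c) x * P.T k i j x - dirderiv (P.V k) (coords supp U c) x * P.A i j x)\<^sup>2)"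
        by (intro mult_nonneg_nonneg sum_nonneg) auto
      then show ?thesis using pinch[OF C x] unfolding b_def K'_def by linarith
    qed
    show "\<exists>b C. smooth_on (c ` U) (coords f U c) \<and> (\<forall>a. continuous_on (c ` U) (b a)) \<and>
         continuous_on (c ` U) C \<and> (\<forall>x\<in>c ` U. sumsq_op P.V b (coords f U c) x \<le> C x * (coords f U c) x)"
      using 1 2 3 4 by blast
  qed
  show ?thesis
  proof (rule that)
    show "sq_norm_sff A X N p = K * (supp p)\<^sup>2" if "p \<in> topspace M" for p
      using f_zero[OF that] by (simp add: f_def)
    fix U c x i j k assume C: "(U, c) \<in> A" and x: "x \<in> c ` U"
    interpret P: lambda_patch "c ` U" "coords X U c" "coords N U c" lam by (rule patch_with_lambda[OF C])
    have fz: "(coords f U c) y = 0" if "y \<in> c ` U" for y using f_zero[OF chart_point(2)[OF C that]] by simp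
    define E where "E k i j = (P.u x * P.T k i j x - dirderiv (P.V k) P.u x * P.A i j x)\<^sup>2" for i j k
    have z: "sumsq_op P.V b (coords f U c) x = 0" for b
      using sumsq_op_cong[OF P.open_S x, of "coords f U c" "\<lambda>_. 0"] fz by (simp add: sumsq_op_def)
    have "2 / (P.u x)\<^sup>2 * (\<Sum>k. \<Sum>i. \<Sum>j. E k i j) \<le> 0"
      using pinch[OF C x] unfolding z fz[OF x] by (simp only: E_def u_in_chart[OF C] mult_zero_right add_0)
    moreover have "P.u x > 0" using supp_pos[OF chart_point(2)[OF C x]] by (simp add: u_in_chart[OF C])
    then have "2 / (P.u x)\<^sup>2 > 0" by simp
    ultimately have "(\<Sum>k. \<Sum>i. \<Sum>j. E k i j) \<le> 0" by (metis mult_pos_pos not_le)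
    moreover have En: "E k i j \<ge> 0" for k i j by (simp add: E_def)
    ultimately have "(\<Sum>k. \<Sum>i. \<Sum>j. E k i j) = 0" by (intro antisym sum_nonneg) auto
    then have "E k i j = 0" by (simp add: sum_nonneg_eq_0_iff sum_nonneg En)
    then show "P.u x * P.T k i j x = dirderiv (P.V k) P.u x * P.A i j x" by (simp add: E_def)
  qed
qed

text \<open>For \<open>lam \<noteq> 0\<close> this is the traced identity.  If \<open>lam = 0\<close> and the gradient is not zero at some point, then \<open>S = H^2 = u^2\<close> there, so \<open>K = 1\<close>; this contradicts \<open>S < H^2\<close> at a farthest point.\<close>

lemma gradient_zero:
  assumes C: "(U, c) \<in> A" and x: "x \<in> c ` U"
  shows "dirderiv (hypersurface_patch.V (coords X U c) k) (coords supp U c) x = 0"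
proof -
  obtain K where K: "\<And>p. p \<in> topspace M \<Longrightarrow> sq_norm_sff A X N p = K * (supp p)\<^sup>2"
    and rig: "\<And>U c x i j k. (U, c) \<in> A \<Longrightarrow> x \<in> c ` U \<Longrightarrow>
      hypersurface_patch.u (coords X U c) (coords N U c) x * hypersurface_patch.T (coords X U c) (coords N U c) k i j x
      = dirderiv (hypersurface_patch.V (coords X U c) k) (hypersurface_patch.u (coords X U c) (coords N U c)) x
        * hypersurface_patch.A (coords X U c) (coords N U c) i j x"
    using rigidity by blast
  interpret P: lambda_patch "c ` U" "coords X U c" "coords N U c" lam by (rule patch_with_lambda[OF C])
  have u: "P.u = coords supp U c" by (rule u_in_chart[OF C])
  have up: "P.u x > 0" using supp_pos[OF chart_point(2)[OF C x]] by (simp add: u)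
  note rg = P.rigid_gradient[OF x up rig[OF C x]]
  show ?thesis
  proof (cases "lam = 0")
    case False
    then show ?thesis using rg(1)[of k] by (simp add: u)
  next
    case True
    show ?thesis
    proof (rule ccontr)
      assume nz: "dirderiv (P.V k) (coords supp U c) x \<noteq> 0"
      have "(\<Sum>c. (dirderiv (P.V c) P.u x)\<^sup>2) \<noteq> 0"
        using nz unfolding u by (simp add: sum_nonneg_eq_0_iff) blast
      then have "P.sq x = (P.H x)\<^sup>2" using rg(2) by simp
      moreover have "P.H x = P.u x" using P.lambda_eq[OF x] True by simp
      moreover have "P.sq x = K * (P.u x)\<^sup>2"
        using sq_in_chart[OF C x] K[OF chart_point(2)[OF C x]] by (simp add: u)
      ultimately have K1: "K = 1" using up by simp
      obtain p U1 c1 where p: "(U1, c1) \<in> A" "p \<in> U1" "p \<in> topspace M" "\<forall>q\<in>topspace M. rad q \<le> rad p"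
        using farthest_point by metis
      interpret P1: lambda_patch "c1 ` U1" "coords X U1 c1" "coords N U1 c1" lam by (rule patch_with_lambda[OF p(1)])
      have x1: "c1 p \<in> c1 ` U1" using p(2) by simp
      have mx: "P1.R2 y \<le> P1.R2 (c1 p)" if "y \<in> c1 ` U1" for y
        using p(4)[rule_format] chart_point(2)[OF p(1) that] chart_facts(5)[OF chart[OF p(1)] p(2)] by (simp add: R2_in_chart[OF p(1)])
      have "P1.sq (c1 p) = (P1.u (c1 p))\<^sup>2"
        using sq_in_chart[OF p(1) x1] K[OF chart_point(2)[OF p(1) x1]] K1 by (simp add: u_in_chart[OF p(1)])
      moreover have "P1.H (c1 p) = P1.u (c1 p)" using P1.lambda_eq[OF x1] True by simp
      ultimately show False using P1.sq_less_H2_at_max_R2[OF x1 mx n_ge_2] by simp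
    qed
  qed
qed

theorem round_sphere: "\<exists>r. isometric_to_round_sphere M A X r \<and> lam = real CARD('n) / r - r"
proof -
  obtain p3 where p3: "p3 \<in> topspace M" "\<And>q. q \<in> topspace M \<Longrightarrow> supp q \<le> supp p3"
    using attains_max[of supp] smooth_on_imp_continuous_on[OF smooth_supp] by blast
  define r where "r = supp p3"
  have r: "r > 0" using supp_pos[OF p3(1)] by (simp add: r_def)
  \<comment> \<open>A function on \<open>M\<close> with vanishing Laplacian is constant.  It is applied to \<open>u\<close> and to half the squared distance.\<close>
  have harmonic: "f p = f p0"
    if p0: "p0 \<in> topspace M" "\<And>q. q \<in> topspace M \<Longrightarrow> f q \<le> f p0" and p: "p \<in> topspace M"
      and sm: "\<And>U c. (U, c) \<in> A \<Longrightarrow> smooth_on (c ` U) (coords f U c)"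
      and La: "\<And>U c x. (U, c) \<in> A \<Longrightarrow> x \<in> c ` U \<Longrightarrow> hypersurface_patch.Lap (coords X U c) (coords f U c) x = 0"
    for f p p0
  proof -
    have "f p0 - f p = 0"
    proof (rule global_minimum_principle[of "\<lambda>p. f p0 - f p" p0])
      fix U c assume C: "(U, c) \<in> A"
      interpret P: lambda_patch "c ` U" "coords X U c" "coords N U c" lam by (rule patch_with_lambda[OF C])
      have o: "(\<lambda>p. f p0 - f p) \<circ> inv_into U c = (\<lambda>x. f p0 - (coords f U c) x)" by (simp add: o_def)
      have 1: "sumsq_op P.V (\<lambda>_ _. 0) ((\<lambda>p. f p0 - f p) \<circ> inv_into U c) x \<le> 0 * ((\<lambda>p. f p0 - f p) \<circ> inv_into U c) x"
        if x: "x \<in> c ` U" for x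
        unfolding o using P.sumsq_op_const_minus[OF x sm[OF C], of "f p0"] La[OF C x] by simp
      have "smooth_on (c ` U) ((\<lambda>p. f p0 - f p) \<circ> inv_into U c)"
        unfolding o by (intro P.smooths sm[OF C])
      then show "\<exists>b K. smooth_on (c ` U) ((\<lambda>p. f p0 - f p) \<circ> inv_into U c) \<and> (\<forall>a. continuous_on (c ` U) (b a)) \<and>
         continuous_on (c ` U) K \<and> (\<forall>x\<in>c ` U. sumsq_op P.V b ((\<lambda>p. f p0 - f p) \<circ> inv_into U c) x \<le> K x * ((\<lambda>p. f p0 - f p) \<circ> inv_into U c) x)"
        using 1 by (intro exI[of _ "\<lambda>_ _. 0"] exI[of _ "\<lambda>_. 0"] conjI allI ballI continuous_on_const)
    qed (use p0 p in auto)
    then show ?thesis by simp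
  qed
  have u_const: "supp p = r" if p: "p \<in> topspace M" for p
    unfolding r_def
  proof (rule harmonic[OF p3 p smooth_supp])
    fix U c x assume C: "(U, c) \<in> A" and x: "x \<in> c ` U"
    interpret P: lambda_patch "c ` U" "coords X U c" "coords N U c" lam by (rule patch_with_lambda[OF C])
    have "P.\<delta> a (P.\<delta> a (coords supp U c)) x = P.\<delta> a (\<lambda>_. 0) x" for a
      by (rule P.d_cong[OF x]) (rule gradient_zero[OF C])
    then show "P.Lap (coords supp U c) x = 0" by (simp add: P.Lap_def)
  qed
  define k where "k = real CARD('n) - r * (r + lam)"
  have Lap: "hypersurface_patch.Lap (coords X U c) (coords rad U c) x = k"
    if C: "(U, c) \<in> A" and x: "x \<in> c ` U" for U c x
  proof -
    interpret P: lambda_patch "c ` U" "coords X U c" "coords N U c" lam by (rule patch_with_lambda[OF C])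
    have "P.u x = r" using u_const[OF chart_point(2)[OF C x]] by (simp add: u_in_chart[OF C])
    then show ?thesis using P.Lap_R2[OF x] P.lambda_eq[OF x] by (simp add: R2_in_chart[OF C] k_def)
  qed
  obtain p U c where p: "(U, c) \<in> A" "p \<in> U" "p \<in> topspace M" "\<forall>q\<in>topspace M. rad q \<le> rad p"
    using farthest_point by metis
  have "k \<le> 0"
  proof -
    interpret P: lambda_patch "c ` U" "coords X U c" "coords N U c" lam by (rule patch_with_lambda[OF p(1)])
    have x: "c p \<in> c ` U" using p(2) by simp
    have mx: "P.R2 y \<le> P.R2 (c p)" if "y \<in> c ` U" for y
      using p(4)[rule_format] chart_point(2)[OF p(1) that] chart_facts(5)[OF chart[OF p(1)] p(2)] by (simp add: R2_in_chart[OF p(1)])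
    show ?thesis using P.at_max_R2(1)[OF x mx] Lap[OF p(1) x] by (simp add: R2_in_chart[OF p(1)])
  qed
  moreover have "k \<ge> 0"
  proof -
    have "continuous_on (c ` U) ((\<lambda>p. - rad p) \<circ> inv_into U c)" if "(U, c) \<in> A" for U c
      using continuous_on_minus[OF smooth_on_imp_continuous_on[OF smooth_rad[OF that]]] by (simp add: o_def)
    then obtain p' where p': "p' \<in> topspace M" "\<And>q. q \<in> topspace M \<Longrightarrow> - rad q \<le> - rad p'"
      using attains_max[of "\<lambda>p. - rad p"] by blast
    obtain U c where C: "(U, c) \<in> A" "p' \<in> U" using chart_cover[OF p'(1)] .
    interpret P: lambda_patch "c ` U" "coords X U c" "coords N U c" lam by (rule patch_with_lambda[OF C(1)])
    have x: "c p' \<in> c ` U" using C(2) by simp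
    have mn: "P.R2 (c p') \<le> P.R2 y" if "y \<in> c ` U" for y
      using p'(2) chart_point(2)[OF C(1) that] chart_facts(5)[OF chart[OF C(1)] C(2)] by (simp add: R2_in_chart[OF C(1)])
    have "P.\<delta> a (P.\<delta> a P.R2) (c p') \<ge> 0" for a
      using dirderiv2_nonneg_at_min[OF P.open_S x P.smooth_R2 P.smooth_V mn] by blast
    then have "P.Lap P.R2 (c p') \<ge> 0" by (simp add: P.Lap_def sum_nonneg)
    then show ?thesis using Lap[OF C(1) x] by (simp add: R2_in_chart[OF C(1)])
  qed
  ultimately have k0: "k = 0" by simp
  have rad_const: "rad q = rad p" if "q \<in> topspace M" for q
    by (rule harmonic[OF p(3) p(4)[rule_format] that smooth_rad]) (simp_all add: Lap k0)
  have XN: "X q = - r *\<^sub>R N q" if q: "q \<in> topspace M" for q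
  proof -
    obtain U c where C: "(U, c) \<in> A" "q \<in> U" using chart_cover[OF q] .
    interpret P: lambda_patch "c ` U" "coords X U c" "coords N U c" lam by (rule patch_with_lambda[OF C(1)])
    have x: "c q \<in> c ` U" using C(2) by simp
    have inv: "inv_into U c (c q) = q" using chart_facts(5)[OF chart[OF C(1)] C(2)] .
    have "P.\<delta> a P.R2 (c q) = P.\<delta> a (\<lambda>_. rad p) (c q)" for a
      by (rule P.d_cong[OF x]) (simp add: R2_in_chart[OF C(1)] rad_const chart_point(2)[OF C(1)])
    then have "P.Xc a (c q) + P.u (c q) * P.Nc a (c q) = 0" for a using P.delta_R2[OF x] by simp
    moreover have "P.u (c q) = r" using u_const[OF q] inv by (simp add: u_in_chart[OF C(1)])
    ultimately have "X q $ a = - r * N q $ a" for a by (simp add: P.Xc_def P.Nc_def inv eq_neg_iff_add_eq_0)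
    then show ?thesis by (simp add: vec_eq_iff)
  qed
  have "lam = real CARD('n) / r - r" using k0 r by (simp add: k_def field_simps)
  then show ?thesis using isometric_to_sphere_if_normal[OF n_ge_2 r XN] by blast
qed

end

theorem theorem4p1:
  fixes M :: "'a topology"
    and A :: "('a, 'n::finite) chart set"
    and X N :: "'a \<Rightarrow> real ^ 'm::finite"
    and lam :: real
  assumes "CARD('n) \<ge> 2"
    and "lambda_hypersurface M A X N lam"
    and "compact_space M"
    and "\<forall>p\<in>topspace M. mean_curvature A X N p - lam \<ge> 0"
    and "\<forall>p\<in>topspace M.
           lam * (f3 A X N p * (mean_curvature A X N p - lam) - sq_norm_sff A X N p) \<ge> 0"
  shows "\<exists>r::real. isometric_to_round_sphere M A X r \<and> lam = real CARD('n) / r - r"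
proof -
  interpret compact_lambda_hypersurface M A X N lam
    using assms unfolding lambda_hypersurface_def by unfold_locales blast+
  show ?thesis by (rule round_sphere)
qed

end
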